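(* Let $H$ be a real analytic function in a neighborhood of the origin of $\mathbb{R}^2$ with $H(0,0)=0$, and assume that the Hamiltonian system $$\dot x=-H_y(x,y),\qquad \dot y=H_x(x,y)$$ has a non-degenerate center at the origin, whose surrounding periodic orbits lie on level sets $\{H=h\}$ with $h>0$. Let $T(h)$ and $A(h)$ be the period function and the area function parameterized by the energy $h$. Then: (i) In a neighborhood of $h=0$ the functions $T(h)$ and $A(h)$ are analytic and satisfy $A'(h)=T(h)$. (ii) Let $\top(\rho)$, with $\rho>0$, be the period of the orbit starting at the point $(x,y)=(0,\rho)$. Then: - The function $\top$ is analytic at $\rho=0$, and its Taylor development at $\rho=0$ can be obtained algorithmically from the expression of the Hamiltonian system in polar coordinates. - The equation $H(0,\rho)=h$ has, for $h$ in a positive neighborhood of $h=0$, a positive solution $\rho=S(\sqrt h)$ with $S$ analytic at zero. Moreover, the Taylor development of $S$ at zero can also be obtained algorithmically from the one of $H(0,\rho)$. - It holds that $T(h)=\top\big(S(\sqrt h\,)\big)$. Then $A(h)=\int_0^h T(s)\,ds$.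
   Context: A center is non-degenerate if the linearization of the system at it has nonzero purely imaginary eigenvalues. The periodic orbits surrounding the origin are denoted $\gamma_h\subset\{H=h\}$, with the center itself corresponding to $h=0$ and $h$ ranging over an interval $[0,h_1)$. The period function $T(h)$ is the minimal period of $\gamma_h$; the area function $A(h)$ is the area of the region enclosed by $\gamma_h$. Saying that $T$, $A$ or $\top$, a priori defined for positive values of their argument, is analytic at (or in a neighborhood of) $0$ means that it extends to an analytic function there. "Obtained algorithmically" means that, for each $N$, the Taylor coefficients up to order $N$ can be computed by a finite constructive procedure from the indicated data. *)

theory Defs
  imports "HOL-Analysis.Analysis" "Jordan_Normal_Form.Char_Poly"
begin

section \<open>Analyticity\<close>

definition real_analytic_on :: "(real \<Rightarrow> real) \<Rightarrow> real set \<Rightarrow> bool" where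
  "real_analytic_on f S \<longleftrightarrow> (\<forall>a\<in>S. \<exists>F. (\<lambda>x. f (a + x)) has_fps_expansion F)"

definition real_analytic2_on :: "(real \<times> real \<Rightarrow> real) \<Rightarrow> (real \<times> real) set \<Rightarrow> bool" where
  "real_analytic2_on H U \<longleftrightarrow>
    (\<forall>p\<in>U. \<exists>(c :: nat \<Rightarrow> nat \<Rightarrow> real) r. 0 < r \<and>
      (\<forall>x y. \<bar>x\<bar> < r \<and> \<bar>y\<bar> < r \<longrightarrow>
        ((\<lambda>(i, j). c i j * x ^ i * y ^ j) has_sum H (p + (x, y))) UNIV))"

text \<open>Functions such as the period function are only defined for positive arguments. They are
  analytic at 0 with Taylor series \<open>F\<close> if they agree, on some interval to the right of 0, with a
  function that is analytic at 0 and has Taylor series \<open>F\<close>.\<close>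

definition has_right_expansion :: "(real \<Rightarrow> real) \<Rightarrow> real fps \<Rightarrow> bool" where
  "has_right_expansion f F \<longleftrightarrow>
    (\<exists>g. g has_fps_expansion F \<and> (\<forall>\<^sub>F x in at_right 0. f x = g x))"

section \<open>Planar Hamiltonian systems and centers\<close>

definition partial_x :: "(real \<times> real \<Rightarrow> real) \<Rightarrow> real \<times> real \<Rightarrow> real" where
  "partial_x f p = deriv (\<lambda>x. f (x, snd p)) (fst p)"

definition partial_y :: "(real \<times> real \<Rightarrow> real) \<Rightarrow> real \<times> real \<Rightarrow> real" where
  "partial_y f p = deriv (\<lambda>y. f (fst p, y)) (snd p)"

definition hamiltonian_field :: "(real \<times> real \<Rightarrow> real) \<Rightarrow> real \<times> real \<Rightarrow> real \<times> real" where
  "hamiltonian_field H p = (- partial_y H p, partial_x H p)"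

definition solution_in ::
  "(real \<times> real \<Rightarrow> real \<times> real) \<Rightarrow> (real \<times> real) set \<Rightarrow> (real \<Rightarrow> real \<times> real) \<Rightarrow> bool" where
  "solution_in X U \<phi> \<longleftrightarrow>
    (\<forall>t. \<phi> t \<in> U \<and> (\<phi> has_vector_derivative X (\<phi> t)) (at t))"

definition minimal_period :: "(real \<Rightarrow> 'a) \<Rightarrow> real" where
  "minimal_period \<phi> = (LEAST \<tau>. 0 < \<tau> \<and> (\<forall>t. \<phi> (t + \<tau>) = \<phi> t))"

definition periodic_orbit_around ::
  "(real \<times> real \<Rightarrow> real \<times> real) \<Rightarrow> (real \<times> real) set \<Rightarrow> real \<times> real \<Rightarrow>
    (real \<Rightarrow> real \<times> real) \<Rightarrow> bool" where
  "periodic_orbit_around X U p \<phi> \<longleftrightarrow>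
    solution_in X U \<phi> \<and> \<not> \<phi> constant_on UNIV \<and>
    (\<exists>\<tau>>0. \<forall>t. \<phi> (t + \<tau>) = \<phi> t) \<and>
    p \<in> inside (range \<phi>)"

definition period_neighborhood ::
  "(real \<times> real \<Rightarrow> real \<times> real) \<Rightarrow> (real \<times> real) set \<Rightarrow> real \<times> real \<Rightarrow>
    (real \<times> real) set \<Rightarrow> bool" where
  "period_neighborhood X U p V \<longleftrightarrow>
    open V \<and> p \<in> V \<and> V \<subseteq> U \<and>
    (\<forall>q\<in>V - {p}. \<exists>\<phi>. periodic_orbit_around X U p \<phi> \<and> \<phi> 0 = q \<and> range \<phi> \<subseteq> V)"

definition center ::
  "(real \<times> real \<Rightarrow> real \<times> real) \<Rightarrow> (real \<times> real) set \<Rightarrow> real \<times> real \<Rightarrow> bool" where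
  "center X U p \<longleftrightarrow> X p = (0, 0) \<and> (\<exists>V. period_neighborhood X U p V)"

definition linearization :: "(real \<times> real \<Rightarrow> real \<times> real) \<Rightarrow> real \<times> real \<Rightarrow> real mat" where
  "linearization X p = mat_of_rows_list 2
    [[partial_x (fst \<circ> X) p, partial_y (fst \<circ> X) p],
     [partial_x (snd \<circ> X) p, partial_y (snd \<circ> X) p]]"

definition nondegenerate_center ::
  "(real \<times> real \<Rightarrow> real \<times> real) \<Rightarrow> (real \<times> real) set \<Rightarrow> real \<times> real \<Rightarrow> bool" where
  "nondegenerate_center X U p \<longleftrightarrow> center X U p \<and>
    (\<forall>\<mu>. eigenvalue (map_mat complex_of_real (linearization X p)) \<mu> \<longrightarrow> \<mu> \<noteq> 0 \<and> Re \<mu> = 0)"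

text \<open>\<open>H\<close> is constant along orbits, so the last conjunct says that the periodic orbits filling a
  neighborhood of the origin lie on levels \<open>{H = h}\<close> with \<open>h > 0\<close>.\<close>

definition hamiltonian_center :: "(real \<times> real \<Rightarrow> real) \<Rightarrow> (real \<times> real) set \<Rightarrow> bool" where
  "hamiltonian_center H U \<longleftrightarrow>
    open U \<and> (0, 0) \<in> U \<and> real_analytic2_on H U \<and> H (0, 0) = 0 \<and>
    nondegenerate_center (hamiltonian_field H) U (0, 0) \<and>
    (\<exists>V. period_neighborhood (hamiltonian_field H) U (0, 0) V \<and> (\<forall>q\<in>V - {(0, 0)}. 0 < H q))"

section \<open>Period and area functions\<close>

text \<open>\<open>\<gamma> h\<close>, for \<open>0 < h < h1\<close>, is a solution running along the periodic orbit of energy \<open>h\<close>; together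
  with the center these orbits fill a neighborhood of the origin. Two such families have the same
  orbits for all small \<open>h\<close>. The values \<open>\<gamma> h\<close> for other \<open>h\<close> are irrelevant.\<close>

definition energy_family ::
  "(real \<times> real \<Rightarrow> real) \<Rightarrow> (real \<times> real) set \<Rightarrow> real \<Rightarrow> (real \<Rightarrow> real \<Rightarrow> real \<times> real) \<Rightarrow> bool" where
  "energy_family H U h1 \<gamma> \<longleftrightarrow> 0 < h1 \<and>
    (\<forall>h\<in>{0<..<h1}. periodic_orbit_around (hamiltonian_field H) U (0, 0) (\<gamma> h) \<and>
      range (\<gamma> h) \<subseteq> {p \<in> U. H p = h}) \<and>
    open (insert (0, 0) (\<Union>h\<in>{0<..<h1}. range (\<gamma> h)))"

definition period_function :: "(real \<Rightarrow> real \<Rightarrow> real \<times> real) \<Rightarrow> real \<Rightarrow> real" where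
  "period_function \<gamma> h = minimal_period (\<gamma> h)"

definition area_function :: "(real \<Rightarrow> real \<Rightarrow> real \<times> real) \<Rightarrow> real \<Rightarrow> real" where
  "area_function \<gamma> h = measure lborel (inside (range (\<gamma> h)))"

definition period_from_axis ::
  "(real \<times> real \<Rightarrow> real) \<Rightarrow> (real \<times> real) set \<Rightarrow> real \<Rightarrow> real" where
  "period_from_axis H U \<rho> =
    (THE \<tau>. \<exists>\<phi>. solution_in (hamiltonian_field H) U \<phi> \<and> \<phi> 0 = (0, \<rho>) \<and> \<tau> = minimal_period \<phi>)"

text \<open>\<open>S\<close> is analytic at 0 and \<open>\<rho> = S (sqrt h)\<close> is the small positive solution of \<open>H (0, \<rho>) = h\<close>.
  The condition \<open>S 0 = 0\<close> selects the solution that tends to the center as \<open>h\<close> tends to 0.\<close>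

definition axis_solution :: "(real \<times> real \<Rightarrow> real) \<Rightarrow> (real \<Rightarrow> real) \<Rightarrow> bool" where
  "axis_solution H S \<longleftrightarrow>
    (\<exists>F. S has_fps_expansion F) \<and> S 0 = 0 \<and>
    (\<forall>\<^sub>F h in at_right 0. 0 < S (sqrt h) \<and> H (0, S (sqrt h)) = h)"

section \<open>The expression of a system in polar coordinates\<close>

text \<open>Along \<open>(x, y) = (r cos \<theta>, r sin \<theta>)\<close> a system \<open>X = (X\<^sub>1, X\<^sub>2)\<close> reads
  \<open>r' = cos \<theta> X\<^sub>1 + sin \<theta> X\<^sub>2\<close> and \<open>\<theta>' = (cos \<theta> X\<^sub>2 - sin \<theta> X\<^sub>1) / r\<close>. Expanded in powers of \<open>r\<close>, the
  coefficients of \<open>r ^ k\<close> are homogeneous polynomials in \<open>cos \<theta>\<close> and \<open>sin \<theta>\<close>, of degree \<open>k + 1\<close>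
  and (when \<open>X\<close> vanishes at the origin) \<open>k + 2\<close> respectively. \<open>Radial k j\<close> and \<open>Angular k j\<close>
  index the coefficients of these polynomials at the power \<open>j\<close> of \<open>cos \<theta>\<close>.\<close>

datatype polar_index = Radial nat nat | Angular nat nat

definition polar_expression ::
  "(real \<times> real \<Rightarrow> real \<times> real) \<Rightarrow> (polar_index \<Rightarrow> real) \<Rightarrow> bool" where
  "polar_expression X d \<longleftrightarrow> (\<exists>r0>0. \<forall>r \<theta>. 0 < r \<and> r < r0 \<longrightarrow>
    (let X1 = fst (X (r * cos \<theta>, r * sin \<theta>)); X2 = snd (X (r * cos \<theta>, r * sin \<theta>)) in
      (\<lambda>k. (\<Sum>j\<le>k + 1. d (Radial k j) * cos \<theta> ^ j * sin \<theta> ^ (k + 1 - j)) * r ^ k)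
        sums (cos \<theta> * X1 + sin \<theta> * X2) \<and>
      (\<lambda>k. (\<Sum>j\<le>k + 2. d (Angular k j) * cos \<theta> ^ j * sin \<theta> ^ (k + 2 - j)) * r ^ k)
        sums ((cos \<theta> * X2 - sin \<theta> * X1) / r)))"

section \<open>Finite constructive procedures\<close>

text \<open>A finite procedure is a finite expression built from the input data, integer constants and
  \<open>\<pi>\<close> by the field operations and square roots.\<close>

datatype 'v procedure =
    Datum 'v
  | Const int
  | Pi
  | Add "'v procedure" "'v procedure"
  | Neg "'v procedure"
  | Mult "'v procedure" "'v procedure"
  | Inv "'v procedure"
  | Sqrt "'v procedure"

primrec run :: "('v \<Rightarrow> real) \<Rightarrow> 'v procedure \<Rightarrow> real" where
  "run d (Datum v) = d v"
| "run d (Const n) = of_int n"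
| "run d Pi = pi"
| "run d (Add a b) = run d a + run d b"
| "run d (Neg a) = - run d a"
| "run d (Mult a b) = run d a * run d b"
| "run d (Inv a) = inverse (run d a)"
| "run d (Sqrt a) = sqrt (run d a)"

text \<open>\<open>R d F\<close> relates the data \<open>d\<close> of a problem instance to the Taylor series \<open>F\<close> to be computed.
  For each order \<open>N\<close> the same procedures have to work for all instances.\<close>

definition obtained_algorithmically :: "(('v \<Rightarrow> real) \<Rightarrow> real fps \<Rightarrow> bool) \<Rightarrow> bool" where
  "obtained_algorithmically R \<longleftrightarrow>
    (\<forall>N. \<exists>ps. length ps = Suc N \<and>
      (\<forall>d F. R d F \<longrightarrow> (\<forall>n\<le>N. fps_nth F n = run d (ps ! n))))"

end

theory Submission
  imports Defs "HOL-Complex_Analysis.Complex_Analysis"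
begin

text \<open>In polar coordinates \<open>ray t \<theta>\<close> adapted to the quadratic part of \<open>H\<close>, the Hamiltonian is
  \<open>t\<^sup>2 + t\<^sup>3 G \<theta> t\<close>, so that \<open>H = s\<^sup>2\<close> has a solution \<open>t = R s \<theta> = s V \<theta> s\<close> that a contraction argument shows to
  be holomorphic in \<open>s\<close>. The area of the sublevel set is \<open>J / 2\<close> times the integral of \<open>(R s \<theta>)\<^sup>2\<close> over
  \<open>[0, 2 \<pi>]\<close>, and since \<open>\<theta>\<close> satisfies an autonomous equation along the orbits, the period is the integral of
  \<open>J R / (\<partial>H / \<partial>t)\<close>. Both are power series in \<open>s\<close>; as \<open>R (- s) (\<theta> + \<pi>) = - R s \<theta>\<close>, only even powers of \<open>s\<close>
  survive, so both are analytic in \<open>h = s\<^sup>2\<close>. The period of the orbit through \<open>(0, \<rho>)\<close> is \<open>T (H (0, \<rho>))\<close>. The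
  coefficients of \<open>V\<close> are found recursively from the implicit equation and are trigonometric polynomials
  in \<open>\<theta>\<close>, hence their integrals are computed by finite procedures.\<close>

section \<open>Double power series\<close>

text \<open>The level equation H = s^2 has a double root at the origin. Writing t = s V and dividing
  by s^2 turns it into V^2 + s V^3 G \<theta> (s V) = 1, which has the simple root V = 1 at s = 0;
  this is why everything is first a function of s = sqrt h. The series in s are integrated term by
  term over the angle, so every estimate must be uniform in \<theta>: the constants \<open>M\<close>
  and \<open>B\<close>, and with them the radius \<open>\<delta>\<close> of the contraction, do not
  depend on \<theta>. The contraction runs over the complex numbers because uniform limits of
  holomorphic iterates are holomorphic and Cauchy's inequality then bounds the coefficients. Area
  and period both come from the coefficients \<open>q \<theta> n\<close> of V^2: the area is a
  multiple of the integral of R^2, the period one of the integral of (R^2)' / s, so that A' = T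
  becomes an identity of formal series. The orbits are supplied by the hypothesis of a center; what
  is proved is that every solution meeting a level curve traverses exactly that curve in the
  computed time, which also makes the definite description in \<open>period_from_axis\<close> well
  defined.\<close>

definition double_series :: "real \<Rightarrow> (nat \<Rightarrow> nat \<Rightarrow> real) \<Rightarrow> (real \<times> real \<Rightarrow> real) \<Rightarrow> bool" where
  "double_series r c f \<longleftrightarrow>
    (\<forall>x y. \<bar>x\<bar> < r \<and> \<bar>y\<bar> < r \<longrightarrow> ((\<lambda>(i, j). c i j * x ^ i * y ^ j) has_sum f (x, y)) UNIV)"

lemma double_series_has_sum:
  "double_series r c f \<Longrightarrow> \<bar>x\<bar> < r \<Longrightarrow> \<bar>y\<bar> < r \<Longrightarrow>
    ((\<lambda>(i, j). c i j * x ^ i * y ^ j) has_sum f (x, y)) UNIV"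
  by (simp add: double_series_def)

lemma double_series_abs_summable:
  assumes "double_series r c f" "\<bar>x\<bar> < r" "\<bar>y\<bar> < r"
  shows "(\<lambda>(i, j). \<bar>c i j\<bar> * \<bar>x\<bar> ^ i * \<bar>y\<bar> ^ j) summable_on UNIV"
  using summable_on_iff_abs_summable_on_real[of "\<lambda>(i, j). c i j * x ^ i * y ^ j" UNIV]
    has_sum_imp_summable[OF double_series_has_sum[OF assms]]
  by (simp add: case_prod_unfold abs_mult power_abs)

text \<open>On a smaller box the terms are dominated by their absolute values at the corner
  \<open>(s, s)\<close>, so the M-test applies to the net of finite partial sums. Continuity is
  local, so boxes with \<open>s < r\<close> around each point are enough.\<close>

lemma double_series_continuous_on:
  assumes f: "double_series r c f"
  shows "continuous_on ({-r<..<r} \<times> {-r<..<r}) f"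
proof -
  have "isCont f (x, y)" if xy: "\<bar>x\<bar> < r" "\<bar>y\<bar> < r" for x y
  proof -
    obtain s where s: "\<bar>x\<bar> < s" "\<bar>y\<bar> < s" "s < r"
      using dense[of "max \<bar>x\<bar> \<bar>y\<bar>" r] xy by auto
    then have s0: "\<bar>s\<bar> < r" by linarith
    have "uniform_limit ({-s<..<s} \<times> {-s<..<s}) (\<lambda>X z. \<Sum>(i,j)\<in>X. c i j * fst z ^ i * snd z ^ j) f
        (finite_subsets_at_top UNIV)"
    proof (rule Weierstrass_m_test_general'[where M = "\<lambda>(i, j). \<bar>c i j\<bar> * \<bar>s\<bar> ^ i * \<bar>s\<bar> ^ j"])
      show "norm (case ij of (i, j) \<Rightarrow> c i j * fst z ^ i * snd z ^ j)
          \<le> (case ij of (i, j) \<Rightarrow> \<bar>c i j\<bar> * \<bar>s\<bar> ^ i * \<bar>s\<bar> ^ j)"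
        if "z \<in> {-s<..<s} \<times> {-s<..<s}" for ij z
      proof -
        have "\<bar>fst z\<bar> \<le> \<bar>s\<bar>" "\<bar>snd z\<bar> \<le> \<bar>s\<bar>" using that by auto
        then show ?thesis
          by (auto simp: abs_mult power_abs split: prod.splits intro!: mult_mono power_mono)
      qed
      show "((\<lambda>ij. case ij of (i, j) \<Rightarrow> c i j * fst z ^ i * snd z ^ j) has_sum f z) UNIV"
        if "z \<in> {-s<..<s} \<times> {-s<..<s}" for z
        using double_series_has_sum[OF f, of "fst z" "snd z"] that s by auto
    qed (use double_series_abs_summable[OF f s0 s0] in auto)
    then have "continuous_on ({-s<..<s} \<times> {-s<..<s}) f"
      by (rule uniform_limit_theorem[rotated])
        (auto intro!: always_eventually continuous_intros simp: case_prod_unfold)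
    moreover have "open ({-s<..<s} \<times> {-s<..<s})" by (intro open_Times) auto
    ultimately show ?thesis
      using s by (subst (asm) continuous_on_eq_continuous_at) (auto simp: abs_less_iff)
  qed
  then show ?thesis
    by (intro continuous_at_imp_continuous_on) auto
qed

text \<open>The powers decrease, so \<open>Suc i\<close> copies of \<open>q ^ i\<close> are at most
  a partial sum of the geometric series. This absorbs the factor \<open>Suc i\<close> produced by
  differentiation when passing to a slightly larger radius.\<close>

lemma Suc_mult_power_le:
  fixes q :: real
  assumes "0 \<le> q" "q < 1"
  shows "real (Suc i) * q ^ i \<le> 1 / (1 - q)"
proof -
  have "real (Suc i) * q ^ i = (\<Sum>k<Suc i. q ^ i)" by simp
  also have "\<dots> \<le> (\<Sum>k<Suc i. q ^ k)"
    by (intro sum_mono power_decreasing) (use assms in auto)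
  also have "\<dots> \<le> (\<Sum>k. q ^ k)"
    by (intro sum_le_suminf) (use assms in auto)
  also have "\<dots> = 1 / (1 - q)" using assms by (intro suminf_geometric) auto
  finally show ?thesis .
qed

text \<open>Summing over \<open>j\<close> first makes \<open>f (_, y)\<close> a power series in one
  variable, which may be differentiated termwise. The differentiated double series is dominated by
  the original one at the larger abscissa \<open>s\<close>, and summing it over \<open>j\<close>
  first yields the same derivative.\<close>

lemma double_series_partial_x_aux:
  assumes f: "double_series r c f" and x: "\<bar>x\<bar> < r" and y: "\<bar>y\<bar> < r"
  shows "\<exists>D. ((\<lambda>x. f (x, y)) has_real_derivative D) (at x) \<and>
    ((\<lambda>(i, j). real (Suc i) * c (Suc i) j * x ^ i * y ^ j) has_sum D) UNIV"
proof -
  obtain s where s: "\<bar>x\<bar> < s" "s < r" using dense x by blast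
  have s0: "0 < s" "\<bar>s\<bar> < r" using s by auto
  define a where "a i = (\<Sum>\<^sub>\<infinity>j. c i j * y ^ j)" for i
  have a: "((\<lambda>j. c i j * y ^ j) has_sum a i) UNIV" for i
  proof -
    have "(\<lambda>(i, j). c i j * s ^ i * y ^ j) summable_on (UNIV \<times> UNIV)"
      using has_sum_imp_summable[OF double_series_has_sum[OF f s0(2) y]] by simp
    then have "(\<lambda>j. c i j * s ^ i * y ^ j) summable_on UNIV"
      using summable_on_SigmaD1[of "\<lambda>i j. c i j * s ^ i * y ^ j" UNIV "\<lambda>_. UNIV" i] by simp
    then have "(\<lambda>j. (1 / s ^ i) * (c i j * s ^ i * y ^ j)) summable_on UNIV"
      by (rule summable_on_cmult_right)
    then show ?thesis unfolding a_def using s0 by (simp add: field_simps)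
  qed
  have fa: "(\<lambda>i. a i * t ^ i) sums f (t, y)" if "\<bar>t\<bar> < r" for t
  proof (rule has_sum_imp_sums, rule has_sum_SigmaD[where B = "\<lambda>_. UNIV"])
    show "((\<lambda>(i, j). c i j * t ^ i * y ^ j) has_sum f (t, y)) (UNIV \<times> UNIV)"
      using double_series_has_sum[OF f that y] by simp
    show "((\<lambda>j. case (i, j) of (i, j) \<Rightarrow> c i j * t ^ i * y ^ j) has_sum a i * t ^ i) UNIV" for i
      using has_sum_cmult_left[OF a[of i], of "t ^ i"] by (simp add: mult_ac)
  qed
  have "((\<lambda>t. \<Sum>i. a i * t ^ i) has_real_derivative (\<Sum>i. diffs a i * x ^ i)) (at x)"
    by (rule termdiffs_strong[of _ s]) (use fa[OF s0(2)] s s0 in \<open>auto simp: sums_iff\<close>)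
  then have D: "((\<lambda>x. f (x, y)) has_real_derivative (\<Sum>i. diffs a i * x ^ i)) (at x)"
    by (rule has_field_derivative_transform_within_open[where S = "{-r<..<r}"])
      (use x fa in \<open>auto simp: sums_iff abs_less_iff\<close>)
  define q where "q = \<bar>x\<bar> / s"
  have q: "0 \<le> q" "q < 1" using s s0 by (auto simp: q_def)
  \<comment> \<open>Differentiation drops the terms with \<open>i = 0\<close>; the others are
    reindexed along the injection \<open>(i, j) \<mapsto> (Suc i, j)\<close>.\<close>
  have "(\<lambda>(i, j). \<bar>c i j\<bar> * \<bar>s\<bar> ^ i * \<bar>y\<bar> ^ j) summable_on (\<lambda>(i, j). (Suc i, j)) ` UNIV"
    by (rule summable_on_subset_banach[OF double_series_abs_summable[OF f s0(2) y]]) auto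
  then have "(\<lambda>(i, j). \<bar>c (Suc i) j\<bar> * s ^ Suc i * \<bar>y\<bar> ^ j) summable_on UNIV"
    by (subst (asm) summable_on_reindex)
      (use s0 in \<open>auto simp: inj_on_def o_def case_prod_unfold\<close>)
  then have "(\<lambda>ij. 1 / (1 - q) / s * (case ij of (i, j) \<Rightarrow> \<bar>c (Suc i) j\<bar> * s ^ Suc i * \<bar>y\<bar> ^ j)) summable_on UNIV"
    by (rule summable_on_cmult_right)
  then have "(\<lambda>ij. norm (1 / (1 - q) / s * (case ij of (i, j) \<Rightarrow> \<bar>c (Suc i) j\<bar> * s ^ Suc i * \<bar>y\<bar> ^ j))) summable_on UNIV"
    by (rule summable_on_iff_abs_summable_on_real[THEN iffD1])
  note bound_summable = this
  have "(\<lambda>(i, j). real (Suc i) * c (Suc i) j * x ^ i * y ^ j) summable_on UNIV"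
  proof (rule abs_summable_summable, rule Infinite_Sum.abs_summable_on_comparison_test[OF bound_summable])
    fix ij :: "nat \<times> nat"
    obtain i j where ij: "ij = (i, j)" by force
    have "real (Suc i) * \<bar>x\<bar> ^ i = real (Suc i) * q ^ i * s ^ i"
      using s0 by (simp add: q_def power_divide)
    also have "\<dots> \<le> 1 / (1 - q) * s ^ i"
      by (intro mult_right_mono Suc_mult_power_le q) (use s0 in auto)
    finally have "real (Suc i) * \<bar>x\<bar> ^ i * (\<bar>c (Suc i) j\<bar> * \<bar>y\<bar> ^ j) \<le> 1 / (1 - q) * s ^ i * (\<bar>c (Suc i) j\<bar> * \<bar>y\<bar> ^ j)"
      by (intro mult_right_mono) auto
    moreover have "norm (case ij of (i, j) \<Rightarrow> real (Suc i) * c (Suc i) j * x ^ i * y ^ j)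
        = real (Suc i) * \<bar>x\<bar> ^ i * (\<bar>c (Suc i) j\<bar> * \<bar>y\<bar> ^ j)"
      unfolding ij prod.case real_norm_def abs_mult power_abs abs_of_nat by (simp only: mult_ac)
    moreover have "1 / (1 - q) / s * (case ij of (i, j) \<Rightarrow> \<bar>c (Suc i) j\<bar> * s ^ Suc i * \<bar>y\<bar> ^ j)
        = 1 / (1 - q) * s ^ i * (\<bar>c (Suc i) j\<bar> * \<bar>y\<bar> ^ j)"
      using s0 unfolding ij prod.case by simp
    ultimately have "norm (case ij of (i, j) \<Rightarrow> real (Suc i) * c (Suc i) j * x ^ i * y ^ j)
        \<le> 1 / (1 - q) / s * (case ij of (i, j) \<Rightarrow> \<bar>c (Suc i) j\<bar> * s ^ Suc i * \<bar>y\<bar> ^ j)"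
      by (simp only:)
    then show "norm (case ij of (i, j) \<Rightarrow> real (Suc i) * c (Suc i) j * x ^ i * y ^ j)
        \<le> norm (1 / (1 - q) / s * (case ij of (i, j) \<Rightarrow> \<bar>c (Suc i) j\<bar> * s ^ Suc i * \<bar>y\<bar> ^ j))"
      by (rule order_trans) (simp only: real_norm_def abs_ge_self)
  qed
  then obtain S where S: "((\<lambda>(i, j). real (Suc i) * c (Suc i) j * x ^ i * y ^ j) has_sum S) UNIV"
    using summable_iff_has_sum_infsum by blast
  have "(\<lambda>i. diffs a i * x ^ i) sums S"
  proof (rule has_sum_imp_sums, rule has_sum_SigmaD[where B = "\<lambda>_. UNIV"])
    show "((\<lambda>(i, j). real (Suc i) * c (Suc i) j * x ^ i * y ^ j) has_sum S) (UNIV \<times> UNIV)"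
      using S by simp
    show "((\<lambda>j. case (i, j) of (i, j) \<Rightarrow> real (Suc i) * c (Suc i) j * x ^ i * y ^ j) has_sum
        diffs a i * x ^ i) UNIV" for i
      using has_sum_cmult_left[OF a[of "Suc i"], of "real (Suc i) * x ^ i"]
      by (simp add: mult_ac diffs_def)
  qed
  with D S show ?thesis by (auto simp: sums_iff)
qed

lemma double_series_partial_x:
  assumes f: "double_series r c f"
  shows "double_series r (\<lambda>i j. real (Suc i) * c (Suc i) j) (partial_x f)"
    and "\<bar>x\<bar> < r \<Longrightarrow> \<bar>y\<bar> < r \<Longrightarrow> ((\<lambda>x. f (x, y)) has_real_derivative partial_x f (x, y)) (at x)"
proof -
  show *: "((\<lambda>x. f (x, y)) has_real_derivative partial_x f (x, y)) (at x)" if "\<bar>x\<bar> < r" "\<bar>y\<bar> < r" for x y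
    using double_series_partial_x_aux[OF f that] by (auto simp: partial_x_def dest: DERIV_imp_deriv)
  show "double_series r (\<lambda>i j. real (Suc i) * c (Suc i) j) (partial_x f)"
    unfolding double_series_def
    using double_series_partial_x_aux[OF f] * by (metis (no_types, lifting) DERIV_unique)
qed

lemma double_series_swap:
  assumes "double_series r c f"
  shows "double_series r (\<lambda>i j. c j i) (f \<circ> prod.swap)"
  unfolding double_series_def
proof (intro allI impI)
  fix x y assume "\<bar>x\<bar> < r \<and> \<bar>y\<bar> < r"
  then have "((\<lambda>(i, j). c i j * y ^ i * x ^ j) has_sum f (y, x)) UNIV"
    using double_series_has_sum[OF assms] by blast
  then have "((\<lambda>(i, j). c i j * y ^ i * x ^ j) has_sum f (y, x)) (prod.swap ` UNIV)"
    by simp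
  then show "((\<lambda>(i, j). c j i * x ^ i * y ^ j) has_sum (f \<circ> prod.swap) (x, y)) UNIV"
    by (subst (asm) has_sum_reindex) (auto simp: o_def case_prod_unfold mult_ac)
qed

lemma partial_y_swap: "partial_y f = partial_x (f \<circ> prod.swap) \<circ> prod.swap"
  by (auto simp: partial_y_def partial_x_def fun_eq_iff)

lemma double_series_partial_y:
  assumes f: "double_series r c f"
  shows "double_series r (\<lambda>i j. real (Suc j) * c i (Suc j)) (partial_y f)"
    and "\<bar>x\<bar> < r \<Longrightarrow> \<bar>y\<bar> < r \<Longrightarrow> ((\<lambda>y. f (x, y)) has_real_derivative partial_y f (x, y)) (at y)"
  using double_series_swap[OF double_series_partial_x(1)[OF double_series_swap[OF f]]]
    double_series_partial_x(2)[OF double_series_swap[OF f], of y x]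
  by (simp_all add: partial_y_swap)

text \<open>Total differentiability follows from the two partial derivatives and the continuity of
  one of them; \<open>partial_y f\<close> is again a double series on the same box, hence
  continuous.\<close>

lemma double_series_has_derivative:
  assumes f: "double_series r c f" and xy: "\<bar>x\<bar> < r" "\<bar>y\<bar> < r"
  shows "(f has_derivative (\<lambda>(u, v). u * partial_x f (x, y) + v * partial_y f (x, y))) (at (x, y))"
proof -
  have "((\<lambda>(x, y). f (x, y)) has_derivative
      (\<lambda>(tx, ty). tx * partial_x f (x, y) + blinfun_apply (blinfun_scaleR_left (partial_y f (x, y))) ty))
      (at (x, y) within {-r<..<r} \<times> {-r<..<r})"
  proof (rule has_derivative_partialsI[where fx = "\<lambda>tx. tx * partial_x f (x, y)"
        and fy = "\<lambda>x y. blinfun_scaleR_left (partial_y f (x, y))"])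
    show "((\<lambda>x. f (x, y)) has_derivative (\<lambda>tx. tx * partial_x f (x, y))) (at x within {-r<..<r})"
      using double_series_partial_x(2)[OF f xy, THEN has_field_derivative_at_within]
      by (simp add: has_field_derivative_def mult.commute[of _ "partial_x f (x, y)"])
    show "((\<lambda>y. f (x, y)) has_derivative blinfun_apply (blinfun_scaleR_left (partial_y f (x, y)))) (at y within {-r<..<r})"
      if "x \<in> {-r<..<r}" "y \<in> {-r<..<r}" for x y
      using double_series_partial_y(2)[OF f, of x y, THEN has_field_derivative_at_within] that
      by (simp add: has_field_derivative_def mult.commute[of _ "partial_y f (x, y)"] abs_less_iff)
    have "continuous_on ({-r<..<r} \<times> {-r<..<r}) (partial_y f)"
      using double_series_continuous_on double_series_partial_y(1)[OF f] by blast
    then have "continuous (at (x, y) within {-r<..<r} \<times> {-r<..<r}) (partial_y f)"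
      using xy by (auto simp: continuous_on_eq_continuous_within abs_less_iff)
    then show "continuous (at (x, y) within {-r<..<r} \<times> {-r<..<r}) (\<lambda>(x, y). blinfun_scaleR_left (partial_y f (x, y)))"
      by (auto simp: case_prod_unfold intro: bounded_linear.continuous[OF bounded_linear_blinfun_scaleR_left])
  qed (use xy in auto)
  moreover have "open ({-r<..<r} \<times> {-r<..<r})" by (intro open_Times) auto
  ultimately show ?thesis
    using xy by (subst (asm) at_within_open) (auto simp: case_prod_unfold)
qed

text \<open>A Cauchy estimate: one term is at most the whole absolutely convergent sum. Adding 1
  keeps the bound positive when all coefficients vanish.\<close>

lemma double_series_bound:
  assumes f: "double_series r c f" and s: "0 \<le> s" "s < r"
  obtains M where "0 < M" "\<And>i j. \<bar>c i j\<bar> * s ^ (i + j) \<le> M"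
proof -
  have "\<bar>s\<bar> < r" using s by auto
  note sm = double_series_abs_summable[OF f this this]
  show ?thesis
  proof (rule that[of "infsum (\<lambda>(i, j). \<bar>c i j\<bar> * \<bar>s\<bar> ^ i * \<bar>s\<bar> ^ j) UNIV + 1"])
    show "0 < infsum (\<lambda>(i, j). \<bar>c i j\<bar> * \<bar>s\<bar> ^ i * \<bar>s\<bar> ^ j) UNIV + 1"
      by (intro add_nonneg_pos infsum_nonneg) (simp_all add: case_prod_unfold)
    fix i j
    have "(\<Sum>(i, j)\<in>{(i, j)}. \<bar>c i j\<bar> * \<bar>s\<bar> ^ i * \<bar>s\<bar> ^ j)
        \<le> infsum (\<lambda>(i, j). \<bar>c i j\<bar> * \<bar>s\<bar> ^ i * \<bar>s\<bar> ^ j) UNIV"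
      by (rule finite_sum_le_infsum[OF sm]) (simp_all add: case_prod_unfold)
    then show "\<bar>c i j\<bar> * s ^ (i + j) \<le> infsum (\<lambda>(i, j). \<bar>c i j\<bar> * \<bar>s\<bar> ^ i * \<bar>s\<bar> ^ j) UNIV + 1"
      using s by (simp add: power_add mult.assoc)
  qed
qed

lemma has_sum_diagonals:
  assumes "((\<lambda>(i, j). g i j) has_sum S) UNIV"
  shows "((\<lambda>(n, i). g i (n - i)) has_sum S) (SIGMA n:UNIV. {..n::nat})"
proof -
  have "((\<lambda>(i, j). g i j) has_sum S) UNIV = ((\<lambda>(n, i). g i (n - i)) has_sum S) (SIGMA n:UNIV. {..n})"
    apply (rule has_sum_reindex_bij_witness[where i = "\<lambda>(n, i). (i, n - i)" and j = "\<lambda>(i, j). (i + j, i)"])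
    apply (simp_all only: split_paired_all prod.case)
    apply simp_all
    done
  then show ?thesis using assms by simp
qed

text \<open>Regrouping by total degree is legitimate because the sum is unconditional; the inner
  finite sums are the homogeneous parts at \<open>(u, v)\<close>.\<close>

lemma double_series_ray:
  assumes f: "double_series r c f" and x: "\<bar>t * u\<bar> < r" and y: "\<bar>t * v\<bar> < r"
  shows "(\<lambda>n. (\<Sum>i\<le>n. c i (n - i) * u ^ i * v ^ (n - i)) * t ^ n) sums f (t * u, t * v)"
proof -
  have term_eq: "c i (n - i) * (t * u) ^ i * (t * v) ^ (n - i) = c i (n - i) * u ^ i * v ^ (n - i) * t ^ n"
    if "i \<le> n" for i n
  proof -
    have "t ^ n = t ^ i * t ^ (n - i)" using that by (simp add: power_add[symmetric])
    then show ?thesis by (simp only: power_mult_distrib mult_ac)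
  qed
  have sum_eq: "((\<lambda>i. c i (n - i) * (t * u) ^ i * (t * v) ^ (n - i)) has_sum
      (\<Sum>i\<le>n. c i (n - i) * u ^ i * v ^ (n - i)) * t ^ n) {..n}" for n
    unfolding sum_distrib_right by (rule has_sum_finiteI, simp, rule sum.cong) (simp_all add: term_eq)
  have "((\<lambda>(n, i). c i (n - i) * (t * u) ^ i * (t * v) ^ (n - i)) has_sum f (t * u, t * v)) (SIGMA n:UNIV. {..n})"
    using has_sum_diagonals[of "\<lambda>i j. c i j * (t * u) ^ i * (t * v) ^ j", OF double_series_has_sum[OF f x y]] .
  then have "((\<lambda>n. (\<Sum>i\<le>n. c i (n - i) * u ^ i * v ^ (n - i)) * t ^ n) has_sum f (t * u, t * v)) UNIV"
    by (rule has_sum_SigmaD) (simp only: prod.case sum_eq)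
  then show ?thesis by (rule has_sum_imp_sums)
qed

section \<open>Composition and uniqueness of real power series expansions\<close>

definition complex_fps :: "real fps \<Rightarrow> complex fps" where
  "complex_fps F = Abs_fps (\<lambda>n. of_real (fps_nth F n))"

lemma complex_fps_nth [simp]: "fps_nth (complex_fps F) n = of_real (fps_nth F n)"
  by (simp add: complex_fps_def)

lemma complex_fps_mult: "complex_fps (F * G) = complex_fps F * complex_fps G"
  by (simp add: fps_eq_iff fps_mult_nth)

lemma complex_fps_power: "complex_fps (F ^ n) = complex_fps F ^ n"
  by (induction n) (simp_all add: complex_fps_mult, simp add: fps_eq_iff)

lemma complex_fps_compose: "complex_fps (F oo G) = complex_fps F oo complex_fps G"
  by (simp add: fps_eq_iff fps_compose_nth flip: complex_fps_power)

lemma fps_conv_radius_complex_fps [simp]: "fps_conv_radius (complex_fps F) = fps_conv_radius F"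
  unfolding fps_conv_radius_def conv_radius_def by simp

lemma eval_complex_fps:
  assumes "norm x < fps_conv_radius F"
  shows "eval_fps (complex_fps F) (of_real x) = of_real (eval_fps F x)"
proof -
  have "(\<lambda>n. of_real (fps_nth F n * x ^ n)) sums (of_real (eval_fps F x) :: complex)"
    by (rule sums_of_real) (rule sums_eval_fps[OF assms])
  then show ?thesis by (simp add: eval_fps_def sums_iff)
qed

lemma eventually_eval_complex_fps:
  assumes "fps_conv_radius F > 0"
  shows "\<forall>\<^sub>F x in nhds 0. eval_fps (complex_fps F) (of_real x) = of_real (eval_fps F x)"
proof -
  have "\<forall>\<^sub>F x in nhds (0::real). x \<in> eball 0 (fps_conv_radius F)"
    using assms by (intro eventually_nhds_in_open) (auto simp: zero_ereal_def)
  then show ?thesis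
    by eventually_elim (intro eval_complex_fps, simp)
qed

text \<open>Composition is carried out for the complexified series; restricted to real arguments
  near 0, the resulting identity is one between \<open>of_real\<close> images and can be pulled
  back.\<close>

lemma has_fps_expansion_compose_real:
  fixes f g :: "real \<Rightarrow> real"
  assumes f: "f has_fps_expansion F" and g: "g has_fps_expansion G" and G0: "fps_nth G 0 = 0"
  shows "(\<lambda>x. f (g x)) has_fps_expansion (F oo G)"
proof -
  have rad: "fps_conv_radius F > 0" "fps_conv_radius G > 0"
    using f g by (auto simp: has_fps_expansion_def)
  have comp: "(eval_fps (complex_fps F) \<circ> eval_fps (complex_fps G)) has_fps_expansion complex_fps (F oo G)"
    unfolding complex_fps_compose
    by (intro has_fps_expansion_compose eval_fps_has_fps_expansion) (use rad G0 in auto)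
  then have rad': "fps_conv_radius (F oo G) > 0"
    by (simp add: has_fps_expansion_def)
  have g0: "g 0 = 0"
    using g G0 by (auto simp: has_fps_expansion_def eval_fps_at_0 dest: eventually_nhds_x_imp_x)
  have tg: "(g \<longlongrightarrow> 0) (nhds 0)"
    using has_fps_expansion_imp_continuous[OF g, of UNIV] g0 tendsto_at_iff_tendsto_nhds[of g 0]
    by (simp only: isCont_def)
  have "\<forall>\<^sub>F x in nhds 0. eval_fps (complex_fps (F oo G)) (of_real x)
      = (eval_fps (complex_fps F) \<circ> eval_fps (complex_fps G)) (of_real x)"
  proof -
    have "filterlim (\<lambda>x. of_real x :: complex) (nhds 0) (nhds 0)"
      by (metis continuous_on_of_real_id continuous_on_def UNIV_I of_real_0 tendsto_at_iff_tendsto_nhds)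
    then show ?thesis
      using comp by (auto simp: has_fps_expansion_def dest: eventually_compose_filterlim)
  qed
  moreover have "\<forall>\<^sub>F x in nhds 0. eval_fps G x = g x" using g by (simp add: has_fps_expansion_def)
  moreover have "\<forall>\<^sub>F x in nhds 0. eval_fps F (g x) = f (g x)"
    using f tg by (auto simp: has_fps_expansion_def dest: eventually_compose_filterlim)
  moreover have "\<forall>\<^sub>F x in nhds 0. eval_fps (complex_fps F) (of_real (g x)) = of_real (eval_fps F (g x))"
    using eventually_compose_filterlim[OF eventually_eval_complex_fps[OF rad(1)] tg] .
  ultimately have "\<forall>\<^sub>F x in nhds 0. eval_fps (F oo G) x = f (g x)"
    using eventually_eval_complex_fps[OF rad(2)] eventually_eval_complex_fps[OF rad']
  proof eventually_elim
    case (elim x)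
    then have "(of_real (eval_fps (F oo G) x) :: complex) = of_real (f (g x))" by simp
    then show ?case by (simp only: of_real_eq_iff)
  qed
  with rad' show ?thesis by (simp add: has_fps_expansion_def)
qed

text \<open>A nonzero difference series is a power of the variable times a series with nonzero
  constant term, so it cannot vanish at small positive arguments. One-sided agreement matters
  because period and axis solution are only specified for positive arguments.\<close>

lemma fps_expansion_unique_right:
  fixes f g :: "real \<Rightarrow> real"
  assumes f: "f has_fps_expansion F" and g: "g has_fps_expansion G"
    and eq: "\<forall>\<^sub>F x in at_right 0. f x = g x"
  shows "F = G"
proof (rule ccontr)
  assume "F \<noteq> G"
  define D where "D = F - G"
  then have D: "D \<noteq> 0" using \<open>F \<noteq> G\<close> by simp
  have d: "(\<lambda>x. f x - g x) has_fps_expansion D"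
    unfolding D_def by (intro has_fps_expansion_diff f g)
  define E where "E = fps_shift (subdegree D) D"
  have rad: "fps_conv_radius D > 0" using d by (simp add: has_fps_expansion_def)
  have E0: "eval_fps E 0 \<noteq> 0" using D by (simp add: E_def eval_fps_at_0)
  have "continuous (at 0) (eval_fps E)"
    by (rule continuous_eval_fps) (use rad in \<open>simp add: E_def zero_ereal_def\<close>)
  then have "eval_fps E \<midarrow>0\<rightarrow> eval_fps E 0" by (simp add: isCont_def)
  then have "\<forall>\<^sub>F x in at 0. eval_fps E x \<noteq> 0"
    by (rule tendsto_imp_eventually_ne) (rule E0)
  then have 1: "\<forall>\<^sub>F x in at_right 0. eval_fps E x \<noteq> 0"
    by (rule filter_leD[rotated]) (simp add: at_le)
  have "\<forall>\<^sub>F x in at (0::real). x \<in> eball 0 (fps_conv_radius D)"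
    using rad by (intro eventually_at_in_open') (auto simp: zero_ereal_def)
  then have 2: "\<forall>\<^sub>F x in at_right (0::real). x \<in> eball 0 (fps_conv_radius D)"
    by (rule filter_leD[rotated]) (simp add: at_le)
  have "\<forall>\<^sub>F x in at 0. eval_fps D x = f x - g x"
    using d by (auto simp: has_fps_expansion_def eventually_at_filter elim: eventually_mono)
  then have 3: "\<forall>\<^sub>F x in at_right 0. eval_fps D x = f x - g x"
    by (rule filter_leD[rotated]) (simp add: at_le)
  have "\<forall>\<^sub>F x in at_right (0::real). False"
    using 1 2 3 eq eventually_at_right_less[of "0::real"]
  proof eventually_elim
    case (elim x)
    then show False
      using eval_fps_shift[of "subdegree D" D x] by (simp add: E_def)
  qed
  then show False by simp
qed

lemma fps_expansion_unique_real:
  fixes f :: "real \<Rightarrow> real"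
  assumes "f has_fps_expansion F" "f has_fps_expansion G"
  shows "F = G"
  by (rule fps_expansion_unique_right[OF assms]) simp

section \<open>An implicit equation depending on its coefficients\<close>

text \<open>The sequence \<open>a\<close> will hold the Taylor coefficients along one ray. The
  bounds \<open>M\<close> and \<open>B\<close> are separate parameters so that they can be chosen
  once for all rays.\<close>

locale geometric_bound =
  fixes a :: "nat \<Rightarrow> real" and M B :: real
  assumes M: "0 < M" and B: "0 < B" and a_le: "\<bar>a n\<bar> \<le> M * B ^ n"
begin

text \<open>Polymorphic, so that the real function and its complex extension are the same
  constant.\<close>

definition G :: "'a :: {real_normed_field, banach} \<Rightarrow> 'a" where
  "G z = (\<Sum>n. of_real (a n) * z ^ n)"

definition G' :: "'a :: {real_normed_field, banach} \<Rightarrow> 'a" where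
  "G' z = (\<Sum>n. diffs (\<lambda>n. of_real (a n)) n * z ^ n)"

text \<open>The number 64 leaves room in two later estimates: on the disc of radius 1/4 the map
  \<open>\<Psi> s\<close> has to stay inside the disc and to have a derivative of norm at most
  1/2.\<close>

definition \<delta> :: real where "\<delta> = 1 / (64 * (M + B))"

lemma \<delta>: "0 < \<delta>" "\<delta> * M \<le> 1 / 64" "\<delta> * B \<le> 1 / 64"
  using M B by (auto simp: \<delta>_def field_simps)

lemma norm_term_le: "norm (of_real (a n) * z ^ n :: 'a :: {real_normed_field, banach}) \<le> M * (B * norm z) ^ n"
  using a_le[of n] mult_right_mono[OF a_le[of n], of "norm z ^ n"]
  by (simp add: norm_mult norm_power power_mult_distrib)

lemma summable_G: "summable (\<lambda>n. of_real (a n) * z ^ n :: 'a :: {real_normed_field, banach})" if "norm z < 1 / B"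
proof (rule summable_comparison_test'[where N = 0])
  show "summable (\<lambda>n. M * (B * norm z) ^ n)"
    using that B by (intro summable_mult summable_geometric) (simp add: field_simps)
qed (rule norm_term_le)

lemma norm_G_le: "norm (G z) \<le> 2 * M" if "norm z \<le> 1 / (2 * B)"
proof -
  have q: "B * norm z \<le> 1 / 2" using that B by (simp add: field_simps)
  have "norm (G z) \<le> (\<Sum>n. M * (1 / 2) ^ n)"
    unfolding G_def
  proof (rule norm_suminf_le)
    show "norm (of_real (a n) * z ^ n) \<le> M * (1 / 2) ^ n" for n
      by (rule order_trans[OF norm_term_le]) (use M B q in \<open>auto intro!: mult_left_mono power_mono\<close>)
    show "summable (\<lambda>n. M * (1 / 2) ^ n)" by (intro summable_mult summable_geometric) simp
  qed
  also have "\<dots> = 2 * M" by (subst suminf_mult) (auto simp: suminf_geometric)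
  finally show ?thesis .
qed

lemma has_field_derivative_G: "(G has_field_derivative G' z) (at z)" if "norm z < 1 / B"
  unfolding G_def[abs_def] G'_def by (rule termdiffs_strong'[where K = "1 / B"]) (use that summable_G in auto)

lemma norm_G'_le: "norm (G' z) \<le> 4 * M * B" if "norm z \<le> 1 / (2 * B)"
proof -
  have q: "B * norm z \<le> 1 / 2" using that B by (simp add: field_simps)
  have s: "(\<lambda>n. M * B * (of_nat (Suc n) * (1 / 2 :: real) ^ n)) sums (M * B * (1 / (1 - 1 / 2)\<^sup>2))"
    by (intro sums_mult geometric_deriv_sums) simp
  have "norm (G' z) \<le> (\<Sum>n. M * B * (of_nat (Suc n) * (1 / 2) ^ n))"
    unfolding G'_def
  proof (rule norm_suminf_le)
    fix n
    have "norm (diffs (\<lambda>n. of_real (a n)) n * z ^ n) = real (Suc n) * (\<bar>a (Suc n)\<bar> * norm z ^ n)"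
      by (simp only: diffs_def norm_mult norm_of_nat norm_of_real norm_power mult.assoc)
    also have "\<dots> \<le> real (Suc n) * (M * B ^ Suc n * norm z ^ n)"
      by (intro mult_left_mono mult_right_mono a_le) auto
    also have "\<dots> = M * B * (real (Suc n) * (B * norm z) ^ n)"
      by (simp add: power_mult_distrib)
    also have "\<dots> \<le> M * B * (real (Suc n) * (1 / 2) ^ n)"
      by (intro mult_left_mono power_mono q) (use M B in auto)
    finally show "norm (diffs (\<lambda>n. of_real (a n)) n * z ^ n) \<le> M * B * (real (Suc n) * (1 / 2) ^ n)" .
  qed (use s in \<open>simp add: sums_iff\<close>)
  also have "\<dots> = 4 * M * B" using sums_unique[OF s] by (simp add: power2_eq_square)
  finally show ?thesis .
qed

text \<open>The equation \<open>(1 + u)\<^sup>2 + s (1 + u)\<^sup>3 G (s (1 + u)) = 1\<close>, solved for the linear term \<open>2 u\<close>.\<close>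

definition \<Psi> :: "complex \<Rightarrow> complex \<Rightarrow> complex" where
  "\<Psi> s u = - (u ^ 2) / 2 - s * (1 + u) ^ 3 * G (s * (1 + u)) / 2"

lemma \<Psi>_fixed_iff: "\<Psi> s u = u \<longleftrightarrow> (1 + u) ^ 2 + s * (1 + u) ^ 3 * G (s * (1 + u)) = 1"
proof -
  have "\<Psi> s u = u \<longleftrightarrow> 2 * \<Psi> s u = 2 * u" by simp
  also have "2 * \<Psi> s u = - (u ^ 2) - s * (1 + u) ^ 3 * G (s * (1 + u))" by (simp add: \<Psi>_def field_simps)
  also have "- (u ^ 2) - s * (1 + u) ^ 3 * G (s * (1 + u)) = 2 * u - ((1 + u) ^ 2 + s * (1 + u) ^ 3 * G (s * (1 + u)) - 1)"
    by (simp add: power2_eq_square algebra_simps)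
  finally have "\<Psi> s u = u \<longleftrightarrow> 2 * u - ((1 + u) ^ 2 + s * (1 + u) ^ 3 * G (s * (1 + u)) - 1) = 2 * u" .
  moreover have "x - (y - 1) = x \<longleftrightarrow> y = 1" for x y :: complex by auto
  ultimately show ?thesis by (simp only:)
qed

lemma arg_bound:
  fixes s u :: complex
  assumes "norm s < \<delta>" "norm u \<le> 1 / 4"
  shows "norm (1 + u) \<le> 5 / 4" "norm (s * (1 + u)) \<le> 1 / (2 * B)" "norm (s * (1 + u)) < 1 / B"
proof -
  show 1: "norm (1 + u) \<le> 5 / 4" using norm_triangle_ineq[of 1 u] assms(2) by simp
  have "norm (s * (1 + u)) \<le> \<delta> * (5 / 4)"
    unfolding norm_mult by (intro mult_mono 1) (use assms \<delta> in auto)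
  also have "\<dots> \<le> 5 / (4 * 64 * B)" using \<delta>(3) B by (simp add: field_simps)
  also have "\<dots> \<le> 1 / (2 * B)" using B by (simp add: field_simps)
  finally show "norm (s * (1 + u)) \<le> 1 / (2 * B)" .
  also have "1 / (2 * B) < 1 / B" using B by (simp add: field_simps)
  finally show "norm (s * (1 + u)) < 1 / B" .
qed

lemma norm_\<Psi>_le: "norm (\<Psi> s u) \<le> 1 / 4" if "norm s < \<delta>" "norm u \<le> 1 / 4"
proof -
  have "norm (\<Psi> s u) \<le> norm (- (u ^ 2) / 2) + norm (s * (1 + u) ^ 3 * G (s * (1 + u)) / 2)"
    unfolding \<Psi>_def by (rule norm_triangle_ineq4)
  also have "norm (- (u ^ 2) / 2) \<le> (1 / 4) ^ 2 / 2"
    using that by (simp add: norm_divide norm_power power_mono)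
  also have "norm (s * (1 + u) ^ 3 * G (s * (1 + u)) / 2) \<le> \<delta> * (5 / 4) ^ 3 * (2 * M) / 2"
    unfolding norm_divide norm_mult norm_power norm_numeral
    by (intro divide_right_mono mult_mono power_mono norm_G_le arg_bound that)
      (use that \<delta> M arg_bound[OF that] in auto)
  also have "\<dots> \<le> 1 / 64 * (5 / 4) ^ 3" using \<delta>(2) by simp
  finally show ?thesis by (simp add: power2_eq_square power3_eq_cube)
qed

text \<open>Mean value inequality on the disc of radius 1/4: the quadratic term has derivative
  \<open>- u\<close>, of norm at most 1/4, and the choice of \<open>\<delta>\<close> keeps the
  derivative of the remaining term below another 1/4.\<close>

lemma \<Psi>_contraction:
  assumes s: "norm s < \<delta>" and u: "norm u \<le> 1 / 4" and w: "norm w \<le> 1 / 4"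
  shows "norm (\<Psi> s u - \<Psi> s w) \<le> 1 / 2 * norm (u - w)"
proof (rule field_differentiable_bound[where S = "cball 0 (1 / 4)"
      and f' = "\<lambda>u. - u - s * (3 * (1 + u) ^ 2 * G (s * (1 + u)) + (1 + u) ^ 3 * (G' (s * (1 + u)) * s)) / 2"])
  fix z :: complex assume "z \<in> cball 0 (1 / 4)"
  then have z: "norm z \<le> 1 / 4" by simp
  note b = arg_bound[OF s z]
  define g where "g = (\<lambda>u. G (s * (1 + u)))"
  have dG: "(g has_field_derivative G' (s * (1 + z)) * s) (at z)"
    unfolding g_def
    by (rule DERIV_chain2[where f = G and g = "\<lambda>u. s * (1 + u)", OF has_field_derivative_G[OF b(3)]])
      (auto intro!: derivative_eq_intros)
  have "(\<Psi> s has_field_derivative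
      - z - s * (3 * (1 + z) ^ 2 * G (s * (1 + z)) + (1 + z) ^ 3 * (G' (s * (1 + z)) * s)) / 2) (at z)"
  proof -
    have "((\<lambda>u. - (u ^ 2) / 2 - s * (1 + u) ^ 3 * g u / 2) has_field_derivative
        - z - s * (3 * (1 + z) ^ 2 * g z + (1 + z) ^ 3 * (G' (s * (1 + z)) * s)) / 2) (at z)"
      by (auto intro!: derivative_eq_intros dG simp: power2_eq_square power3_eq_cube field_simps)
    then show ?thesis by (simp only: \<Psi>_def[abs_def] g_def)
  qed
  then show "(\<Psi> s has_field_derivative
      - z - s * (3 * (1 + z) ^ 2 * G (s * (1 + z)) + (1 + z) ^ 3 * (G' (s * (1 + z)) * s)) / 2)
      (at z within cball 0 (1 / 4))"
    by (rule has_field_derivative_at_within)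
  have 1: "norm (3 * (1 + z) ^ 2 * G (s * (1 + z))) \<le> 3 * (5 / 4) ^ 2 * (2 * M)"
    unfolding norm_mult norm_power
    by (intro mult_mono power_mono norm_G_le b) (use M b in auto)
  have 2: "norm ((1 + z) ^ 3 * (G' (s * (1 + z)) * s)) \<le> (5 / 4) ^ 3 * (4 * M * B * \<delta>)"
    unfolding norm_mult norm_power
    by (intro mult_mono power_mono norm_G'_le b) (use M B \<delta> s b in auto)
  have 3: "(5 / 4) ^ 3 * (4 * M * B * \<delta>) \<le> (5 / 4) ^ 3 * (4 * M / 64)"
    using mult_left_mono[OF \<delta>(3), of M] M by (simp add: mult_ac)
  have "norm (s * (3 * (1 + z) ^ 2 * G (s * (1 + z)) + (1 + z) ^ 3 * (G' (s * (1 + z)) * s)) / 2)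
      \<le> \<delta> * (3 * (5 / 4) ^ 2 * (2 * M) + (5 / 4) ^ 3 * (4 * M / 64)) / 2"
    unfolding norm_divide norm_mult[of s] norm_numeral
    by (intro divide_right_mono mult_mono order_trans[OF norm_triangle_ineq add_mono] 1 order_trans[OF 2 3])
      (use s \<delta> in auto)
  also have "\<dots> = \<delta> * M * (3 * (5 / 4) ^ 2 * 2 + (5 / 4) ^ 3 * (4 / 64)) / 2"
    by (simp add: algebra_simps)
  also have "\<dots> \<le> 1 / 64 * (3 * (5 / 4) ^ 2 * 2 + (5 / 4) ^ 3 * (4 / 64)) / 2"
    by (intro divide_right_mono mult_right_mono \<delta>) auto
  also have "\<dots> \<le> 1 / 4" by (simp add: power2_eq_square power3_eq_cube)
  finally have "norm (- z) + norm (s * (3 * (1 + z) ^ 2 * G (s * (1 + z)) + (1 + z) ^ 3 * (G' (s * (1 + z)) * s)) / 2) \<le> 1 / 2"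
    unfolding norm_minus_cancel using z by linarith
  then show "norm (- z - s * (3 * (1 + z) ^ 2 * G (s * (1 + z)) + (1 + z) ^ 3 * (G' (s * (1 + z)) * s)) / 2) \<le> 1 / 2"
    by (rule order_trans[OF norm_triangle_ineq4])
qed (use u w in auto)

lemma \<Psi>_ex1:
  assumes "norm s < \<delta>"
  shows "\<exists>!u. norm u \<le> 1 / 4 \<and> \<Psi> s u = u"
proof -
  have "\<exists>!u. u \<in> cball 0 (1 / 4) \<and> \<Psi> s u = u"
  proof (rule Banach_fix)
    show "\<Psi> s ` cball 0 (1 / 4) \<subseteq> cball 0 (1 / 4)"
      using norm_\<Psi>_le[OF assms] by (simp only: image_subset_iff mem_cball_0 Ball_def) blast
    show "dist (\<Psi> s x) (\<Psi> s y) \<le> 1 / 2 * dist x y" if "x \<in> cball 0 (1 / 4)" "y \<in> cball 0 (1 / 4)" for x y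
      using \<Psi>_contraction[OF assms] that by (simp only: dist_norm mem_cball_0)
  qed (auto simp: complete_eq_closed)
  then show ?thesis by (simp only: mem_cball_0)
qed

definition U :: "complex \<Rightarrow> complex" where
  "U s = (THE u. norm u \<le> 1 / 4 \<and> \<Psi> s u = u)"

lemma U: "norm (U s) \<le> 1 / 4" "\<Psi> s (U s) = U s" if "norm s < \<delta>"
  using theI'[OF \<Psi>_ex1[OF that]] by (auto simp: U_def)

lemma U_unique: "norm s < \<delta> \<Longrightarrow> norm u \<le> 1 / 4 \<Longrightarrow> \<Psi> s u = u \<Longrightarrow> u = U s"
  using \<Psi>_ex1 U by blast

section \<open>Holomorphic dependence of the fixed point on s\<close>

definition iter :: "nat \<Rightarrow> complex \<Rightarrow> complex" where
  "iter k s = (\<Psi> s ^^ k) 0"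

lemma iter_Suc: "iter (Suc k) s = \<Psi> s (iter k s)"
  by (simp add: iter_def)

lemma norm_iter_le:
  assumes "norm s < \<delta>"
  shows "norm (iter k s) \<le> 1 / 4"
proof (induction k)
  case (Suc k)
  show ?case unfolding iter_Suc by (rule norm_\<Psi>_le[OF assms Suc])
qed (simp add: iter_def)

lemma norm_iter_U_le: "norm s < \<delta> \<Longrightarrow> norm (iter k s - U s) \<le> (1 / 2) ^ k / 4"
proof (induction k)
  case 0
  then show ?case using U(1) by (simp add: iter_def)
next
  case (Suc k)
  have "norm (iter (Suc k) s - U s) = norm (\<Psi> s (iter k s) - \<Psi> s (U s))"
    using U(2)[OF Suc.prems] by (simp add: iter_Suc)
  also have "\<dots> \<le> 1 / 2 * norm (iter k s - U s)"
    by (intro \<Psi>_contraction norm_iter_le U Suc.prems)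
  finally show ?case using Suc.IH[OF Suc.prems] by simp
qed

lemma uniform_limit_iter: "uniform_limit (ball 0 \<delta>) iter U sequentially"
proof (rule uniform_limitI)
  fix e :: real assume e: "0 < e"
  have "(\<lambda>k. (1 / 2) ^ k / 4 :: real) \<longlonglongrightarrow> 0 / 4"
    by (intro tendsto_intros LIMSEQ_power_zero) auto
  then have "\<forall>\<^sub>F k in sequentially. (1 / 2) ^ k / 4 < e"
    using e by (intro order_tendstoD(2)[where y = 0]) auto
  then show "\<forall>\<^sub>F k in sequentially. \<forall>s\<in>ball 0 \<delta>. dist (iter k s) (U s) < e"
  proof eventually_elim
    case (elim k)
    show ?case
    proof
      fix s :: complex assume "s \<in> ball 0 \<delta>"
      then show "dist (iter k s) (U s) < e"
        unfolding dist_norm mem_ball_0 by (rule le_less_trans[OF norm_iter_U_le elim])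
    qed
  qed
qed

lemma holomorphic_iter: "iter k holomorphic_on ball 0 \<delta>"
proof (induction k)
  case (Suc k)
  have "G holomorphic_on ball 0 (1 / B)"
    unfolding holomorphic_on_open[OF open_ball] mem_ball_0 Ball_def using has_field_derivative_G by blast
  moreover have "(\<lambda>s. s * (1 + iter k s)) ` ball 0 \<delta> \<subseteq> ball 0 (1 / B)"
    unfolding image_subset_iff mem_ball_0 Ball_def using arg_bound(3)[OF _ norm_iter_le] by blast
  moreover have "(\<lambda>s. s * (1 + iter k s)) holomorphic_on ball 0 \<delta>"
    using Suc by (intro holomorphic_intros)
  ultimately have "(G \<circ> (\<lambda>s. s * (1 + iter k s))) holomorphic_on ball 0 \<delta>"
    by (intro holomorphic_on_compose_gen)
  then show ?case
    unfolding iter_Suc[abs_def] \<Psi>_def using Suc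
    by (auto intro!: holomorphic_intros simp: o_def)
qed (simp add: iter_def)

text \<open>The iterates are holomorphic in \<open>s\<close> and converge uniformly on the whole
  disc, because the contraction factor 1/2 does not depend on \<open>s\<close>; holomorphy passes to
  the limit.\<close>

lemma holomorphic_U: "U holomorphic_on ball 0 \<delta>"
proof (rule holomorphic_uniform_sequence[OF open_ball holomorphic_iter])
  fix x :: complex assume "x \<in> ball 0 \<delta>"
  then obtain d where "0 < d" "cball x d \<subseteq> ball 0 \<delta>"
    by (meson open_ball open_contains_cball)
  then show "\<exists>d>0. cball x d \<subseteq> ball 0 \<delta> \<and> uniform_limit (cball x d) iter U sequentially"
    using uniform_limit_on_subset[OF uniform_limit_iter] by blast
qed

section \<open>Real roots and their Taylor series\<close>

lemma G_of_real: "G (of_real x) = of_real (G x)" if "\<bar>x\<bar> < 1 / B"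
proof -
  have "(\<lambda>n. of_real (a n) * x ^ n) sums G x"
    unfolding G_def by (rule summable_sums, rule summable_G) (use that in simp)
  then have "(\<lambda>n. of_real (of_real (a n) * x ^ n)) sums (of_real (G x) :: 'a)"
    by (rule sums_of_real)
  then show ?thesis by (simp add: G_def sums_iff)
qed

lemma iter_Reals: "\<bar>s\<bar> < \<delta> \<Longrightarrow> iter k (of_real s) \<in> \<real>"
proof (induction k)
  case (Suc k)
  then obtain u where u: "iter k (of_real s) = of_real u" by (auto elim: Reals_cases)
  have "norm (of_real u :: complex) \<le> 1 / 4"
    using norm_iter_le[of "of_real s" k] Suc.prems u by simp
  then have "norm (of_real s * (1 + of_real u) :: complex) < 1 / B"
    using Suc.prems by (intro arg_bound(3)) simp_all
  moreover have "of_real s * (1 + of_real u) = (of_real (s * (1 + u)) :: complex)" by simp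
  ultimately have "\<bar>s * (1 + u)\<bar> < 1 / B" by (simp only: norm_of_real)
  then have "G (of_real s * (1 + of_real u)) = (of_real (G (s * (1 + u))) :: complex)"
    using G_of_real[of "s * (1 + u)"] by simp
  then show ?case by (simp add: iter_Suc \<Psi>_def u)
qed (simp add: iter_def)

text \<open>For real \<open>s\<close> all iterates are real, and the real line is closed in the
  complex plane.\<close>

lemma U_Reals: "U (of_real s) \<in> \<real>" if "\<bar>s\<bar> < \<delta>"
proof (rule closed_sequentially[OF closed_complex_Reals])
  show "(\<lambda>k. iter k (of_real s)) \<longlonglongrightarrow> U (of_real s)"
    by (rule tendsto_uniform_limitI[OF uniform_limit_iter]) (use that in simp)
qed (rule iter_Reals[OF that])

definition v :: "real \<Rightarrow> real" where "v s = 1 + Re (U (of_real s))"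

text \<open>The Taylor series of \<open>v\<close> at 0, read off the complex function. Taking real
  parts is harmless because only real arguments are substituted.\<close>

definition P :: "real fps" where
  "P = Abs_fps (\<lambda>n. Re ((deriv ^^ n) (\<lambda>s. 1 + U s) 0 / fact n))"

lemma of_real_v: "of_real (v s) = 1 + U (of_real s)" if "\<bar>s\<bar> < \<delta>"
  using U_Reals[OF that] by (auto simp: v_def elim: Reals_cases)

lemma v_bound: "\<bar>v s - 1\<bar> \<le> 1 / 4" if "\<bar>s\<bar> < \<delta>"
  using U(1)[of "of_real s"] abs_Re_le_cmod[of "U (of_real s)"] that by (simp add: v_def)

lemma arg_bound_real:
  assumes "\<bar>s\<bar> < \<delta>" "\<bar>w - 1\<bar> \<le> 1 / 4"
  shows "\<bar>s * w\<bar> \<le> 1 / (2 * B)" "\<bar>s * w\<bar> < 1 / B"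
proof -
  have "norm (of_real s :: complex) < \<delta>" "norm (of_real (w - 1) :: complex) \<le> 1 / 4"
    using assms by (simp_all only: norm_of_real)
  note arg_bound(2,3)[OF this]
  moreover have "of_real s * (1 + of_real (w - 1)) = (of_real (s * w) :: complex)" by simp
  ultimately show "\<bar>s * w\<bar> \<le> 1 / (2 * B)" "\<bar>s * w\<bar> < 1 / B" by (simp_all only: norm_of_real)
qed

text \<open>Carries the uniqueness of the complex fixed point over to real \<open>w\<close>. The
  direction from left to right later identifies roots that are found in another way, such as the
  value at \<open>s = 0\<close> and the root on the opposite ray.\<close>

lemma root_iff:
  assumes "\<bar>s\<bar> < \<delta>" "\<bar>w - 1\<bar> \<le> 1 / 4"
  shows "w ^ 2 + s * w ^ 3 * G (s * w) = 1 \<longleftrightarrow> w = v s"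
proof -
  have "w ^ 2 + s * w ^ 3 * G (s * w) = 1 \<longleftrightarrow>
      (of_real (w ^ 2 + s * w ^ 3 * G (s * w)) :: complex) = of_real 1"
    by (simp only: of_real_eq_iff)
  also have "\<dots> \<longleftrightarrow> \<Psi> (of_real s) (of_real w - 1) = of_real w - 1"
    using G_of_real[OF arg_bound_real(2)[OF assms], where 'a = complex] by (simp add: \<Psi>_fixed_iff)
  also have "\<dots> \<longleftrightarrow> of_real w - 1 = U (of_real s)"
  proof -
    have "norm (of_real w - 1 :: complex) = \<bar>w - 1\<bar>"
      by (metis norm_of_real of_real_1 of_real_diff)
    then have "norm (of_real w - 1 :: complex) \<le> 1 / 4" "norm (of_real s :: complex) < \<delta>"
      using assms by (simp_all only: norm_of_real)
    then show ?thesis using U_unique U(2) by metis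
  qed
  also have "\<dots> \<longleftrightarrow> (of_real w :: complex) = of_real (v s)"
    unfolding of_real_v[OF assms(1)] by (simp only: diff_eq_eq add.commute)
  finally show ?thesis by (simp only: of_real_eq_iff)
qed

lemma v_root: "v s ^ 2 + s * v s ^ 3 * G (s * v s) = 1" if "\<bar>s\<bar> < \<delta>"
  using root_iff[OF that v_bound[OF that]] by simp

lemma P_sums: "(\<lambda>n. fps_nth P n * s ^ n) sums v s" if "\<bar>s\<bar> < \<delta>"
proof -
  define d where "d n = (deriv ^^ n) (\<lambda>s. 1 + U s) 0 / fact n" for n
  have "(\<lambda>n. d n * (of_real s - 0) ^ n) sums (1 + U (of_real s))"
    unfolding d_def by (rule holomorphic_power_series[where r = \<delta>]) (use that holomorphic_U in \<open>auto intro!: holomorphic_intros\<close>)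
  then have "(\<lambda>n. Re (d n * of_real (s ^ n))) sums Re (1 + U (of_real s))"
    by (intro sums_Re) simp
  then show ?thesis unfolding times_complex.sel Re_complex_of_real Im_complex_of_real by (simp add: P_def v_def d_def)
qed

text \<open>Cauchy's inequality on the circle of radius \<open>\<delta> / 2\<close>, where the
  function has norm at most 5/4. The bound involves \<open>a\<close> only through \<open>M\<close>
  and \<open>B\<close>, as termwise integration over the angle requires.\<close>

lemma P_bound: "\<bar>fps_nth P n\<bar> \<le> 2 * (2 / \<delta>) ^ n"
proof -
  have "norm ((deriv ^^ n) (\<lambda>s. 1 + U s) 0) \<le> fact n * 2 / (\<delta> / 2) ^ n"
  proof (rule Cauchy_inequality)
    have hol: "(\<lambda>s. 1 + U s) holomorphic_on ball 0 \<delta>"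
      using holomorphic_U by (auto intro!: holomorphic_intros)
    have "ball 0 (\<delta> / 2) \<subseteq> ball (0::complex) \<delta>" "cball 0 (\<delta> / 2) \<subseteq> ball (0::complex) \<delta>" using \<delta> by auto
    then show "(\<lambda>s. 1 + U s) holomorphic_on ball 0 (\<delta> / 2)" "continuous_on (cball 0 (\<delta> / 2)) (\<lambda>s. 1 + U s)"
      using hol by (auto intro: holomorphic_on_subset holomorphic_on_imp_continuous_on)
    show "norm (1 + U x) \<le> 2" if "norm (0 - x) = \<delta> / 2" for x
      using arg_bound(1)[OF _ U(1), of x x] that \<delta> by simp
  qed (use \<delta> in auto)
  then have "norm ((deriv ^^ n) (\<lambda>s. 1 + U s) 0 / fact n) \<le> 2 / (\<delta> / 2) ^ n"
    unfolding norm_divide norm_fact by (simp add: divide_le_eq mult_ac)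
  moreover have "\<bar>fps_nth P n\<bar> \<le> norm ((deriv ^^ n) (\<lambda>s. 1 + U s) 0 / fact n)"
    unfolding P_def fps_nth_Abs_fps by (rule abs_Re_le_cmod)
  moreover have "2 / (\<delta> / 2) ^ n = 2 * (2 / \<delta>) ^ n" by (simp add: power_divide)
  ultimately show ?thesis by linarith
qed

lemma v_has_fps_expansion: "v has_fps_expansion P"
proof (rule has_fps_expansionI)
  have "\<forall>\<^sub>F s in nhds (0::real). s \<in> {-\<delta><..<\<delta>}"
    using \<delta> by (intro eventually_nhds_in_open) auto
  then show "\<forall>\<^sub>F s in nhds 0. (\<lambda>n. fps_nth P n * s ^ n) sums v s"
    by eventually_elim (auto intro: P_sums)
qed

lemma G_has_fps_expansion: "(G :: real \<Rightarrow> real) has_fps_expansion Abs_fps a"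
proof (rule has_fps_expansionI)
  have "\<forall>\<^sub>F s in nhds (0::real). s \<in> {-1/B<..<1/B}"
    using B by (intro eventually_nhds_in_open) auto
  then show "\<forall>\<^sub>F s in nhds (0::real). (\<lambda>n. fps_nth (Abs_fps a) n * s ^ n) sums G s"
    unfolding G_def by eventually_elim (use summable_G[where 'a = real] in \<open>auto intro!: summable_sums simp: abs_less_iff\<close>)
qed

text \<open>The functional equation holds near 0, so by uniqueness of expansions it holds between
  formal series; in this form it is a recursion for the coefficients of \<open>P\<close>.\<close>

lemma P_equation: "P ^ 2 + fps_X * P ^ 3 * (Abs_fps a oo (fps_X * P)) = 1"
proof (rule fps_expansion_unique_right)
  have "(\<lambda>s. G (s * v s)) has_fps_expansion (Abs_fps a oo (fps_X * P))"
    by (intro has_fps_expansion_compose_real G_has_fps_expansion has_fps_expansion_mult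
        has_fps_expansion_fps_X v_has_fps_expansion) simp
  then have "(\<lambda>s. (v s * v s) + s * (v s * v s * v s) * G (s * v s))
      has_fps_expansion (P * P + fps_X * (P * P * P) * (Abs_fps a oo (fps_X * P)))"
    by (intro has_fps_expansion_add has_fps_expansion_mult
        has_fps_expansion_fps_X v_has_fps_expansion)
  then show "(\<lambda>s. v s ^ 2 + s * v s ^ 3 * G (s * v s))
      has_fps_expansion (P ^ 2 + fps_X * P ^ 3 * (Abs_fps a oo (fps_X * P)))"
    by (simp only: power2_eq_square power3_eq_cube)
  show "(\<lambda>_. 1 :: real) has_fps_expansion 1" by simp
  have "\<forall>\<^sub>F s in at_right (0::real). s < \<delta>" using \<delta> by (intro eventually_at_rightI[of 0 \<delta>]) auto
  then show "\<forall>\<^sub>F s in at_right 0. v s ^ 2 + s * v s ^ 3 * G (s * v s) = 1"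
    using eventually_at_right_less[of "0::real"] by eventually_elim (rule v_root, simp)
qed

lemma P_0: "fps_nth P 0 = 1"
proof -
  have 0: "\<bar>0\<bar> < \<delta>" using \<delta> by simp
  have "fps_nth P 0 = v 0" using P_sums[OF 0] by (simp add: sums_iff)
  moreover have "1 = v 0" using root_iff[OF 0, of 1] by simp
  ultimately show ?thesis by simp
qed

end

section \<open>Coefficients of solutions of the implicit equation\<close>

text \<open>Three rings \<open>C\<close> of functions on \<open>Z\<close> are of interest: continuous functions, functions computed by
  finite procedures from the data \<open>z\<close>, and trigonometric polynomials whose coefficients are so computed.\<close>

locale function_ring =
  fixes Z :: "'z set" and C :: "('z \<Rightarrow> real) \<Rightarrow> bool"
  assumes cong: "C f \<Longrightarrow> (\<And>z. z \<in> Z \<Longrightarrow> f z = g z) \<Longrightarrow> C g"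
    and of_int: "C (\<lambda>_. of_int k)"
    and add: "C f \<Longrightarrow> C g \<Longrightarrow> C (\<lambda>z. f z + g z)"
    and mult: "C f \<Longrightarrow> C g \<Longrightarrow> C (\<lambda>z. f z * g z)"
begin

lemma zero: "C (\<lambda>_. 0)" and one: "C (\<lambda>_. 1)"
  using of_int[of 0] of_int[of 1] by simp_all

lemma of_nat: "C (\<lambda>_. of_nat k)"
  using of_int[of "int k"] by simp

lemma uminus: "C f \<Longrightarrow> C (\<lambda>z. - f z)"
  using mult[OF of_int[of "-1"]] by simp

lemma sum: "(\<And>i. i \<in> I \<Longrightarrow> C (f i)) \<Longrightarrow> C (\<lambda>z. \<Sum>i\<in>I. f i z)"
  by (induction I rule: infinite_finite_induct) (simp_all add: zero add)

lemma power: "C f \<Longrightarrow> C (\<lambda>z. f z ^ n)"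
  by (induction n) (simp_all add: one mult)

text \<open>At each stage of the recursion the series is only known up to some order, so closure of
  \<open>C\<close> under series operations is phrased for truncations.\<close>

definition coeffs_upto :: "nat \<Rightarrow> ('z \<Rightarrow> real fps) \<Rightarrow> bool" where
  "coeffs_upto n F \<longleftrightarrow> (\<forall>i\<le>n. C (\<lambda>z. fps_nth (F z) i))"

lemma coeffs_upto_mult:
  assumes "coeffs_upto n F" "coeffs_upto n G"
  shows "coeffs_upto n (\<lambda>z. F z * G z)"
  unfolding coeffs_upto_def fps_mult_nth
  by (intro allI impI sum mult) (use assms in \<open>auto simp: coeffs_upto_def\<close>)

lemma coeffs_upto_power: "coeffs_upto n F \<Longrightarrow> coeffs_upto n (\<lambda>z. F z ^ k)"
proof (induction k)
  case 0
  have "C (\<lambda>z. fps_nth 1 i)" for i by (cases i) (simp_all add: zero one)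
  then show ?case by (simp add: coeffs_upto_def)
qed (simp add: coeffs_upto_mult)

lemma coeffs_upto_X_mult:
  assumes "coeffs_upto n F"
  shows "coeffs_upto (Suc n) (\<lambda>z. fps_X * F z)"
proof -
  have "C (\<lambda>z. fps_nth (fps_X * F z) i)" if "i \<le> Suc n" for i
    using assms that by (cases i) (auto simp: zero coeffs_upto_def)
  then show ?thesis by (simp add: coeffs_upto_def)
qed

lemma coeffs_upto_mono: "coeffs_upto n F \<Longrightarrow> m \<le> n \<Longrightarrow> coeffs_upto m F"
  by (simp add: coeffs_upto_def)

lemma coeffs_upto_compose:
  assumes "coeffs_upto n F" "coeffs_upto n G"
  shows "coeffs_upto n (\<lambda>z. F z oo G z)"
  unfolding coeffs_upto_def fps_compose_nth
  by (intro allI impI sum mult) (use assms coeffs_upto_power in \<open>auto simp: coeffs_upto_def\<close>)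

text \<open>Compare coefficients at order \<open>Suc n\<close>. The factor \<open>fps_X\<close>
  makes the second summand depend on \<open>P\<close> only up to order \<open>n\<close>, while the
  square contains the new coefficient linearly with factor \<open>2 * q z * fps_nth (P z) 0\<close>.
  Hence that factor is the only thing ever divided by, and \<open>C\<close> need not be closed under
  inverses in general.\<close>

lemma implicit_coeffs:
  assumes A: "\<And>n. C (\<lambda>z. fps_nth (A z) n)"
    and q: "C q" and P0: "C (\<lambda>z. fps_nth (P z) 0)"
    and inv: "C (\<lambda>z. inverse (2 * q z * fps_nth (P z) 0))"
    and nz: "\<And>z. z \<in> Z \<Longrightarrow> q z * fps_nth (P z) 0 \<noteq> 0"
    and eq: "\<And>z. z \<in> Z \<Longrightarrow> fps_const (q z) * P z ^ 2 + fps_X * P z ^ 3 * (A z oo (fps_X * P z)) = 1"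
  shows "C (\<lambda>z. fps_nth (P z) n)"
proof -
  have "coeffs_upto n P" for n
  proof (induction n)
    case 0
    then show ?case using P0 by (simp add: coeffs_upto_def)
  next
    case (Suc n)
    define E where "E z = P z ^ 3 * (A z oo (fps_X * P z))" for z
    have E: "coeffs_upto n E"
      unfolding E_def
    proof (rule coeffs_upto_mult[OF coeffs_upto_power[OF Suc] coeffs_upto_compose])
      show "coeffs_upto n A" using A by (simp add: coeffs_upto_def)
      show "coeffs_upto n (\<lambda>z. fps_X * P z)"
        by (rule coeffs_upto_mono[OF coeffs_upto_X_mult[OF Suc]]) simp
    qed
    have "C (\<lambda>z. fps_nth (P z) (Suc n))"
    proof (rule cong)
      show "C (\<lambda>z. inverse (2 * q z * fps_nth (P z) 0) *
          (- (q z * (\<Sum>i\<in>{1..n}. fps_nth (P z) i * fps_nth (P z) (Suc n - i)) + fps_nth (E z) n)))"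
        by (intro mult inv uminus add q sum) (use Suc E in \<open>auto simp: coeffs_upto_def\<close>)
      fix z assume z: "z \<in> Z"
      have "fps_nth (fps_const (q z) * P z ^ 2 + fps_X * E z) (Suc n) = fps_nth 1 (Suc n)"
        using eq[OF z] by (simp add: E_def mult.assoc)
      then have *: "q z * fps_nth (P z ^ 2) (Suc n) + fps_nth (E z) n = 0" by simp
      have "fps_nth (P z ^ 2) (Suc n) = (\<Sum>i\<in>{0..Suc n}. fps_nth (P z) i * fps_nth (P z) (Suc n - i))"
        by (simp only: power2_eq_square fps_mult_nth)
      \<comment> \<open>The new coefficient occurs only in the two end terms of the
        convolution.\<close>
      also have "\<dots> = (\<Sum>i\<in>{1..n}. fps_nth (P z) i * fps_nth (P z) (Suc n - i))
          + 2 * fps_nth (P z) 0 * fps_nth (P z) (Suc n)"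
        by (simp add: sum.atLeast0_atMost_Suc sum.atLeast_Suc_atMost)
      finally have "q z * (\<Sum>i\<in>{1..n}. fps_nth (P z) i * fps_nth (P z) (Suc n - i)) + fps_nth (E z) n
          = - (2 * q z * fps_nth (P z) 0 * fps_nth (P z) (Suc n))"
        using * by (simp add: algebra_simps)
      then show "inverse (2 * q z * fps_nth (P z) 0) *
          (- (q z * (\<Sum>i\<in>{1..n}. fps_nth (P z) i * fps_nth (P z) (Suc n - i)) + fps_nth (E z) n))
          = fps_nth (P z) (Suc n)"
        using nz[OF z] by (simp add: field_simps)
    qed
    then show ?case
      using Suc by (auto simp: coeffs_upto_def le_Suc_eq)
  qed
  then show ?thesis unfolding coeffs_upto_def by blast
qed

end

section \<open>Trigonometric polynomials\<close>

definition trig_moment :: "nat \<Rightarrow> nat \<Rightarrow> real" where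
  "trig_moment i j = integral {0..2 * pi} (\<lambda>t. cos t ^ i * sin t ^ j)"

lemma trig_has_integral:
  "((\<lambda>t. cos t ^ i * sin t ^ j) has_integral trig_moment i j) {0..2 * pi}"
  unfolding trig_moment_def
  by (intro integrable_integral integrable_continuous_interval continuous_intros)

text \<open>Integrates the derivative of \<open>cos t ^ Suc i * sin t ^ Suc j\<close> over a full
  turn; the boundary terms vanish with the sine.\<close>

lemma trig_moment_parts:
  "real (Suc j) * trig_moment (i + 2) j = real (Suc i) * trig_moment i (j + 2)"
proof -
  have "((\<lambda>t. real (Suc j) * (cos t ^ (i + 2) * sin t ^ j) - real (Suc i) * (cos t ^ i * sin t ^ (j + 2)))
      has_integral (cos (2 * pi) ^ Suc i * sin (2 * pi) ^ Suc j - cos 0 ^ Suc i * sin 0 ^ Suc j)) {0..2 * pi}"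
  proof (rule fundamental_theorem_of_calculus)
    fix t :: real
    have "((\<lambda>t. cos t ^ Suc i * sin t ^ Suc j) has_real_derivative
        real (Suc j) * (cos t ^ (i + 2) * sin t ^ j) - real (Suc i) * (cos t ^ i * sin t ^ (j + 2))) (at t)"
      by (auto intro!: derivative_eq_intros simp del: power_Suc simp: algebra_simps)
        (simp add: algebra_simps)
    then show "((\<lambda>t. cos t ^ Suc i * sin t ^ Suc j) has_vector_derivative
        real (Suc j) * (cos t ^ (i + 2) * sin t ^ j) - real (Suc i) * (cos t ^ i * sin t ^ (j + 2)))
        (at t within {0..2 * pi})"
      by (simp add: has_real_derivative_iff_has_vector_derivative has_vector_derivative_at_within)
  qed simp
  then have "((\<lambda>t. real (Suc j) * (cos t ^ (i + 2) * sin t ^ j) - real (Suc i) * (cos t ^ i * sin t ^ (j + 2)))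
      has_integral 0) {0..2 * pi}"
    by simp
  moreover have "((\<lambda>t. real (Suc j) * (cos t ^ (i + 2) * sin t ^ j) - real (Suc i) * (cos t ^ i * sin t ^ (j + 2)))
      has_integral (real (Suc j) * trig_moment (i + 2) j - real (Suc i) * trig_moment i (j + 2))) {0..2 * pi}"
    by (intro has_integral_diff has_integral_mult_right trig_has_integral)
  ultimately have "real (Suc j) * trig_moment (i + 2) j - real (Suc i) * trig_moment i (j + 2) = 0"
    using has_integral_unique by blast
  then show ?thesis by simp
qed

lemma trig_moment_split: "trig_moment i j = trig_moment (i + 2) j + trig_moment i (j + 2)"
proof -
  have "((\<lambda>t. cos t ^ (i + 2) * sin t ^ j + cos t ^ i * sin t ^ (j + 2)) has_integral
      (trig_moment (i + 2) j + trig_moment i (j + 2))) {0..2 * pi}"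
    by (intro has_integral_add trig_has_integral)
  moreover have "cos t ^ (i + 2) * sin t ^ j + cos t ^ i * sin t ^ (j + 2) = cos t ^ i * sin t ^ j" for t :: real
  proof -
    have "cos t ^ (i + 2) * sin t ^ j + cos t ^ i * sin t ^ (j + 2)
        = cos t ^ i * sin t ^ j * ((cos t)\<^sup>2 + (sin t)\<^sup>2)"
      by (simp only: power_add distrib_left mult_ac)
    then show ?thesis by simp
  qed
  ultimately show ?thesis using trig_has_integral[of i j] by (simp add: has_integral_unique)
qed

text \<open>The two moments of degree \<open>i + j + 2\<close> satisfy two linear relations, one
  from integration by parts and one from cos^2 + sin^2 = 1; solving them gives a recursion that
  lowers an exponent by two.\<close>

lemma trig_moment_Suc2:
  "trig_moment (i + 2) j = real (Suc i) / real (i + j + 2) * trig_moment i j"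
  "trig_moment i (j + 2) = real (Suc j) / real (i + j + 2) * trig_moment i j"
proof -
  define a b c where "a = trig_moment (i + 2) j" and "b = trig_moment i (j + 2)" and "c = trig_moment i j"
  have 1: "real (Suc j) * a = real (Suc i) * b" "c = a + b"
    using trig_moment_parts[of j i] trig_moment_split[of i j] by (simp_all add: a_def b_def c_def)
  then have "real (i + j + 2) * a = real (Suc i) * c" "real (i + j + 2) * b = real (Suc j) * c"
    by (simp_all add: algebra_simps)
  then show "trig_moment (i + 2) j = real (Suc i) / real (i + j + 2) * trig_moment i j"
    "trig_moment i (j + 2) = real (Suc j) / real (i + j + 2) * trig_moment i j"
    unfolding a_def[symmetric] b_def[symmetric] c_def[symmetric] by (simp_all add: field_simps)
qed

lemma trig_moment_base:
  "trig_moment 0 0 = 2 * pi" "trig_moment 1 0 = 0" "trig_moment 0 1 = 0" "trig_moment 1 1 = 0"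
proof -
  show "trig_moment 0 0 = 2 * pi" by (simp add: trig_moment_def)
  have "(cos has_integral (sin (2 * pi) - sin 0)) {0..2 * pi}"
    by (rule fundamental_theorem_of_calculus)
      (auto intro!: derivative_eq_intros simp flip: has_real_derivative_iff_has_vector_derivative)
  then show "trig_moment 1 0 = 0" using trig_has_integral[of 1 0] by (simp add: has_integral_unique)
  have "(sin has_integral (- cos (2 * pi) - (- cos 0))) {0..2 * pi}"
    by (rule fundamental_theorem_of_calculus)
      (auto intro!: derivative_eq_intros simp flip: has_real_derivative_iff_has_vector_derivative)
  then show "trig_moment 0 1 = 0" using trig_has_integral[of 0 1] by (simp add: has_integral_unique)
  have "((\<lambda>t. cos t * sin t) has_integral ((sin (2 * pi))\<^sup>2 / 2 - (sin 0)\<^sup>2 / 2)) {0..2 * pi}"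
    by (rule fundamental_theorem_of_calculus)
      (auto intro!: derivative_eq_intros simp flip: has_real_derivative_iff_has_vector_derivative)
  then show "trig_moment 1 1 = 0" using trig_has_integral[of 1 1] by (simp add: has_integral_unique)
qed

section \<open>Normalised polar coordinates\<close>

text \<open>Uniform convergence by the M-test allows the exchange of sum and integral; below, the
  variable is the angle and the summation index the power of \<open>s\<close>.\<close>

lemma has_integral_sums:
  fixes f :: "nat \<Rightarrow> real \<Rightarrow> real"
  assumes cont: "\<And>n. continuous_on {a..b} (f n)"
    and bound: "\<And>n x. x \<in> {a..b} \<Longrightarrow> \<bar>f n x\<bar> \<le> M n" and M: "summable M"
    and sums: "\<And>x. x \<in> {a..b} \<Longrightarrow> (\<lambda>n. f n x) sums g x"
  shows "continuous_on {a..b} g" "(\<lambda>n. integral {a..b} (f n)) sums integral {a..b} g"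
    "(g has_integral integral {a..b} g) {a..b}"
proof -
  have "uniform_limit {a..b} (\<lambda>n x. \<Sum>i<n. f i x) (\<lambda>x. \<Sum>i. f i x) sequentially"
    by (rule Weierstrass_m_test[OF _ M]) (use bound in simp)
  moreover have "(\<Sum>i. f i x) = g x" if "x \<in> {a..b}" for x
    using sums[OF that] by (simp add: sums_iff)
  ultimately have u: "uniform_limit {a..b} (\<lambda>n x. \<Sum>i<n. f i x) g sequentially"
    by (subst (asm) uniform_limit_cong'[where g = "\<lambda>n x. \<Sum>i<n. f i x" and i = g]) auto
  have c: "continuous_on {a..b} (\<lambda>x. \<Sum>i<n. f i x)" for n
    by (intro continuous_on_sum cont)
  show g: "continuous_on {a..b} g"
    by (rule uniform_limit_theorem[OF _ u]) (simp_all add: c)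
  show gI: "(g has_integral integral {a..b} g) {a..b}"
    using integrable_continuous_interval[OF g] by (rule integrable_integral)
  obtain I J where I: "\<And>n. ((\<lambda>x. \<Sum>i<n. f i x) has_integral I n) {a..b}"
    and J: "(g has_integral J) {a..b}" and lim: "I \<longlonglongrightarrow> J"
    using uniform_limit_integral[OF u c] by auto
  have "((\<lambda>x. \<Sum>i<n. f i x) has_integral (\<Sum>i<n. integral {a..b} (f i))) {a..b}" for n
    by (intro has_integral_sum integrable_integral integrable_continuous_interval cont) simp
  then have "I = (\<lambda>n. \<Sum>i<n. integral {a..b} (f i))"
    using I has_integral_unique by blast
  moreover have "J = integral {a..b} g" using J gI has_integral_unique by blast
  ultimately show "(\<lambda>n. integral {a..b} (f n)) sums integral {a..b} g"
    using lim by (simp add: sums_def)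
qed

text \<open>The last two assumptions are Sylvester's criterion for the quadratic part to be positive
  definite; the expression in the last one is the Hessian determinant of \<open>H\<close> at the
  origin.\<close>

locale morse_hamiltonian =
  fixes H :: "real \<times> real \<Rightarrow> real" and c :: "nat \<Rightarrow> nat \<Rightarrow> real" and r :: real
  assumes r: "0 < r" and H: "double_series r c H"
    and c00: "c 0 0 = 0" and c10: "c 1 0 = 0" and c01: "c 0 1 = 0"
    and c02: "0 < c 0 2" and disc: "0 < 4 * c 2 0 * c 0 2 - (c 1 1)\<^sup>2"
begin

text \<open>The frame is chosen such that the quadratic part of \<open>H\<close> is 1 at all points \<open>(e1 \<theta>, e2 \<theta>)\<close>; its
  determinant \<open>J\<close> is the Jacobian of the coordinates \<open>(t\<^sup>2 / 2, \<theta>)\<close>.\<close>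

definition disc where "disc = 4 * c 2 0 * c 0 2 - (c 1 1)\<^sup>2"
definition \<alpha> where "\<alpha> = 2 * sqrt (c 0 2) / sqrt disc"
definition \<beta> where "\<beta> = - (c 1 1 * \<alpha>) / (2 * c 0 2)"
definition \<gamma> where "\<gamma> = 1 / sqrt (c 0 2)"
definition J where "J = 2 / sqrt disc"
definition e1 where "e1 \<theta> = \<alpha> * cos \<theta>"
definition e2 where "e2 \<theta> = \<beta> * cos \<theta> + \<gamma> * sin \<theta>"

definition ray :: "real \<Rightarrow> real \<Rightarrow> real \<times> real" where "ray t \<theta> = (t * e1 \<theta>, t * e2 \<theta>)"

lemma disc_pos: "0 < disc" using disc by (simp add: disc_def)
lemma \<alpha>_pos: "0 < \<alpha>" using disc_pos c02 by (simp add: \<alpha>_def)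
lemma \<gamma>_pos: "0 < \<gamma>" using c02 by (simp add: \<gamma>_def)
lemma J_pos: "0 < J" using disc_pos by (simp add: J_def)
lemma J_eq: "J = \<alpha> * \<gamma>" using c02 by (simp add: J_def \<alpha>_def \<gamma>_def)

text \<open>Completing the square: \<open>\<beta>\<close> removes the mixed term in cos and sin,
  while \<open>\<alpha>\<close> and \<open>\<gamma>\<close> normalise the two squares to coefficient
  1, so cos^2 + sin^2 remains.\<close>

lemma quadratic_part: "c 2 0 * (e1 \<theta>)\<^sup>2 + c 1 1 * e1 \<theta> * e2 \<theta> + c 0 2 * (e2 \<theta>)\<^sup>2 = 1"
proof -
  have g: "c 0 2 * \<gamma>\<^sup>2 = 1" using c02 by (simp add: \<gamma>_def power_divide)
  have b: "c 1 1 * \<alpha> + 2 * c 0 2 * \<beta> = 0" using c02 by (simp add: \<beta>_def)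
  have "\<alpha>\<^sup>2 * disc = 4 * c 0 2" using disc_pos c02 by (simp add: \<alpha>_def power_divide power_mult_distrib)
  moreover have "4 * c 0 2 * (c 2 0 * \<alpha>\<^sup>2 + c 1 1 * \<alpha> * \<beta> + c 0 2 * \<beta>\<^sup>2)
      = \<alpha>\<^sup>2 * disc + (c 1 1 * \<alpha> + 2 * c 0 2 * \<beta>)\<^sup>2"
    by (simp add: disc_def power2_eq_square algebra_simps)
  ultimately have a: "c 2 0 * \<alpha>\<^sup>2 + c 1 1 * \<alpha> * \<beta> + c 0 2 * \<beta>\<^sup>2 = 1"
    using b c02 by simp
  have "c 2 0 * (e1 \<theta>)\<^sup>2 + c 1 1 * e1 \<theta> * e2 \<theta> + c 0 2 * (e2 \<theta>)\<^sup>2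
      = (c 2 0 * \<alpha>\<^sup>2 + c 1 1 * \<alpha> * \<beta> + c 0 2 * \<beta>\<^sup>2) * (cos \<theta>)\<^sup>2
        + (c 1 1 * \<alpha> + 2 * c 0 2 * \<beta>) * \<gamma> * cos \<theta> * sin \<theta> + c 0 2 * \<gamma>\<^sup>2 * (sin \<theta>)\<^sup>2"
    by (simp add: e1_def e2_def power2_eq_square algebra_simps)
  then show ?thesis unfolding a b g by simp
qed

definition L where "L = \<bar>\<alpha>\<bar> + \<bar>\<beta>\<bar> + \<bar>\<gamma>\<bar>"

lemma L_pos: "0 < L" using \<alpha>_pos by (simp add: L_def)

lemma e_bound: "\<bar>e1 \<theta>\<bar> \<le> L" "\<bar>e2 \<theta>\<bar> \<le> L"
proof -
  have "\<bar>\<alpha> * cos \<theta>\<bar> \<le> \<bar>\<alpha>\<bar> * 1" "\<bar>\<beta> * cos \<theta>\<bar> \<le> \<bar>\<beta>\<bar> * 1" "\<bar>\<gamma> * sin \<theta>\<bar> \<le> \<bar>\<gamma>\<bar> * 1"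
    unfolding abs_mult by (intro mult_left_mono; simp)+
  then show "\<bar>e1 \<theta>\<bar> \<le> L" "\<bar>e2 \<theta>\<bar> \<le> L" unfolding e1_def e2_def L_def by linarith+
qed

text \<open>The homogeneous part of degree \<open>n\<close> of \<open>H\<close> at the frame point.
  The parts of degree 0, 1, 2 are 0, 0, 1 there, so the shift by 3 in \<open>a\<close> leaves
  exactly the series of the perturbation \<open>G\<close>.\<close>

definition k where "k \<theta> n = (\<Sum>i\<le>n. c i (n - i) * e1 \<theta> ^ i * e2 \<theta> ^ (n - i))"
definition a where "a \<theta> n = k \<theta> (n + 3)"

lemma k_low: "k \<theta> 0 = 0" "k \<theta> 1 = 0" "k \<theta> 2 = 1"
  using quadratic_part[of \<theta>] c00 c10 c01
  by (simp_all add: k_def numeral_2_eq_2 power2_eq_square algebra_simps)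

definition M0 where "M0 = (SOME M. 0 < M \<and> (\<forall>i j. \<bar>c i j\<bar> * (r / 2) ^ (i + j) \<le> M))"
text \<open>The factor 4 is 2 * 2: the Cauchy estimate at radius \<open>r / 2\<close> contributes
  \<open>2 / r\<close> per degree, and a further 2 absorbs the \<open>n + 1\<close> summands of
  \<open>k \<theta> n\<close> by n + 1 \<le> 2^n. \<open>L\<close> bounds the frame, and the cube in
  \<open>M\<close> pays for the index shift by 3.\<close>

definition B where "B = 4 * L / r"
definition M where "M = M0 * B ^ 3"

lemma M0: "0 < M0" "\<bar>c i j\<bar> * (r / 2) ^ (i + j) \<le> M0"
proof -
  have "\<exists>M. 0 < M \<and> (\<forall>i j. \<bar>c i j\<bar> * (r / 2) ^ (i + j) \<le> M)"
    using double_series_bound[OF H, of "r / 2"] r by (metis divide_less_eq_1_pos half_gt_zero less_eq_real_def field_less_half_sum field_sum_of_halves add_cancel_left_left less_add_same_cancel1 half_gt_zero_iff)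
  from someI_ex[OF this] show "0 < M0" "\<bar>c i j\<bar> * (r / 2) ^ (i + j) \<le> M0"
    unfolding M0_def by blast+
qed

lemma B_pos: "0 < B" using L_pos r by (simp add: B_def)
lemma M_pos: "0 < M" using M0 B_pos by (simp add: M_def)

lemma k_bound: "\<bar>k \<theta> n\<bar> \<le> M0 * B ^ n"
proof -
  have "\<bar>k \<theta> n\<bar> \<le> (\<Sum>i\<le>n. \<bar>c i (n - i) * e1 \<theta> ^ i * e2 \<theta> ^ (n - i)\<bar>)"
    unfolding k_def by (rule sum_abs)
  also have "\<dots> \<le> (\<Sum>i\<le>n. M0 * (2 * L / r) ^ n)"
  proof (rule sum_mono)
    fix i assume "i \<in> {..n}"
    then have n: "n = i + (n - i)" by simp
    have "\<bar>c i (n - i)\<bar> * (r / 2) ^ n \<le> M0" using M0(2)[of i "n - i"] n by simp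
    then have c: "\<bar>c i (n - i)\<bar> \<le> M0 * (2 / r) ^ n"
      using r by (simp add: field_simps)
    have "\<bar>e1 \<theta>\<bar> ^ i * \<bar>e2 \<theta>\<bar> ^ (n - i) \<le> L ^ i * L ^ (n - i)"
      by (intro mult_mono power_mono e_bound) (use L_pos in auto)
    also have "\<dots> = L ^ n" using n by (metis power_add)
    finally have "\<bar>c i (n - i)\<bar> * (\<bar>e1 \<theta>\<bar> ^ i * \<bar>e2 \<theta>\<bar> ^ (n - i)) \<le> M0 * (2 / r) ^ n * L ^ n"
      by (intro mult_mono c) (use M0 r in auto)
    also have "\<dots> = M0 * (2 * L / r) ^ n" by (simp add: power_mult_distrib power_divide)
    finally show "\<bar>c i (n - i) * e1 \<theta> ^ i * e2 \<theta> ^ (n - i)\<bar> \<le> M0 * (2 * L / r) ^ n"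
      by (simp add: abs_mult power_abs mult.assoc)
  qed
  also have "\<dots> = real (Suc n) * (M0 * (2 * L / r) ^ n)" by simp
  also have "\<dots> \<le> 2 ^ n * (M0 * (2 * L / r) ^ n)"
    by (intro mult_right_mono) (use M0 L_pos r in \<open>auto simp: of_nat_Suc[symmetric] simp del: of_nat_Suc
        intro!: of_nat_le_iff[THEN iffD2, of _ "2 ^ _", simplified of_nat_power of_nat_numeral] Suc_leI less_exp\<close>)
  also have "\<dots> = M0 * (2 * (2 * L / r)) ^ n" by (simp only: power_mult_distrib mult_ac)
  also have "2 * (2 * L / r) = B" by (simp add: B_def)
  finally show ?thesis .
qed

lemma gb: "geometric_bound (a \<theta>) M B"
proof
  show "\<bar>a \<theta> n\<bar> \<le> M * B ^ n" for n
    using k_bound[of \<theta> "n + 3"] by (simp add: a_def M_def power_add mult_ac)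
qed (rule M_pos B_pos)+

abbreviation G :: "real \<Rightarrow> real \<Rightarrow> real" where "G \<theta> \<equiv> geometric_bound.G (a \<theta>)"
abbreviation G' :: "real \<Rightarrow> real \<Rightarrow> real" where "G' \<theta> \<equiv> geometric_bound.G' (a \<theta>)"
abbreviation \<delta> where "\<delta> \<equiv> geometric_bound.\<delta> M B"
abbreviation V where "V \<theta> \<equiv> geometric_bound.v (a \<theta>)"
abbreviation P where "P \<theta> \<equiv> geometric_bound.P (a \<theta>)"

lemmas \<delta> = geometric_bound.\<delta>[OF gb]

lemma fourth_\<delta>: "4 * \<delta> \<le> 1 / (16 * B)" "4 * \<delta> \<le> 1 / (16 * M)" "4 * \<delta> < 1 / B" "4 * \<delta> \<le> 1 / (2 * B)"
  using \<delta> M_pos B_pos by (auto simp: field_simps)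

lemma ray_in_box:
  assumes "\<bar>t\<bar> < 1 / B"
  shows "\<bar>t * e1 \<theta>\<bar> < r" "\<bar>t * e2 \<theta>\<bar> < r"
proof -
  have "\<bar>t\<bar> * L < r"
  proof -
    have "\<bar>t\<bar> * L < 1 / B * L" using assms L_pos by (rule mult_strict_right_mono)
    also have "\<dots> < r" using L_pos r by (simp add: B_def)
    finally show ?thesis .
  qed
  moreover have "\<bar>t * e1 \<theta>\<bar> \<le> \<bar>t\<bar> * L" "\<bar>t * e2 \<theta>\<bar> \<le> \<bar>t\<bar> * L"
    unfolding abs_mult by (intro mult_left_mono e_bound; simp)+
  ultimately show "\<bar>t * e1 \<theta>\<bar> < r" "\<bar>t * e2 \<theta>\<bar> < r" by linarith+
qed

lemma H_ray_sums: "\<bar>t\<bar> < 1 / B \<Longrightarrow> (\<lambda>n. k \<theta> n * t ^ n) sums H (ray t \<theta>)"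
  unfolding k_def ray_def by (intro double_series_ray[OF H] ray_in_box)

lemma H_ray:
  assumes "\<bar>t\<bar> < 1 / B"
  shows "H (ray t \<theta>) = t ^ 2 + t ^ 3 * G \<theta> t"
proof -
  have "(\<lambda>n. a \<theta> n * t ^ n) sums G \<theta> t"
    using geometric_bound.summable_G[OF gb, of t \<theta>] assms
    by (simp add: geometric_bound.G_def[OF gb] summable_sums)
  then have "(\<lambda>n. t ^ 3 * (a \<theta> n * t ^ n)) sums (t ^ 3 * G \<theta> t)" by (rule sums_mult)
  then have "(\<lambda>n. k \<theta> (n + 3) * t ^ (n + 3)) sums (t ^ 3 * G \<theta> t)"
    by (simp add: a_def power_add mult_ac)
  then have "(\<lambda>n. k \<theta> n * t ^ n) sums (t ^ 3 * G \<theta> t + (\<Sum>n<3. k \<theta> n * t ^ n))"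
    by (subst (asm) sums_iff_shift)
  also have "(\<Sum>n<3. k \<theta> n * t ^ n) = t ^ 2"
    using k_low[of \<theta>] by (simp add: eval_nat_numeral)
  finally show ?thesis using sums_unique2[OF H_ray_sums[OF assms]] by fastforce
qed

section \<open>The radial derivative and monotonicity along rays\<close>

definition Hr where "Hr t \<theta> = e1 \<theta> * partial_x H (ray t \<theta>) + e2 \<theta> * partial_y H (ray t \<theta>)"

lemma H_ray_deriv:
  assumes "\<bar>t\<bar> < 1 / B"
  shows "((\<lambda>t. H (ray t \<theta>)) has_real_derivative Hr t \<theta>) (at t)"
    "Hr t \<theta> = 2 * t + 3 * t ^ 2 * G \<theta> t + t ^ 3 * G' \<theta> t"
proof -
  have "((\<lambda>t. ray t \<theta>) has_derivative (\<lambda>s. (s * e1 \<theta>, s * e2 \<theta>))) (at t)"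
    unfolding ray_def by (auto intro!: derivative_eq_intros)
  then have "((\<lambda>t. H (ray t \<theta>)) has_derivative (\<lambda>s. (\<lambda>(u, v). u * partial_x H (ray t \<theta>) + v * partial_y H (ray t \<theta>))
      (s * e1 \<theta>, s * e2 \<theta>))) (at t)"
    by (rule has_derivative_compose)
      (use double_series_has_derivative[OF H ray_in_box[OF assms]] in \<open>simp add: ray_def\<close>)
  then show d: "((\<lambda>t. H (ray t \<theta>)) has_real_derivative Hr t \<theta>) (at t)"
    unfolding has_field_derivative_def
    by (rule has_derivative_eq_rhs) (simp add: Hr_def fun_eq_iff algebra_simps)
  have "((\<lambda>t. t ^ 2 + t ^ 3 * G \<theta> t) has_real_derivative 2 * t + 3 * t ^ 2 * G \<theta> t + t ^ 3 * G' \<theta> t) (at t)"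
    by (auto intro!: derivative_eq_intros geometric_bound.has_field_derivative_G[OF gb] simp: assms)
  then have "((\<lambda>t. H (ray t \<theta>)) has_real_derivative 2 * t + 3 * t ^ 2 * G \<theta> t + t ^ 3 * G' \<theta> t) (at t)"
    by (rule has_field_derivative_transform_within_open[where S = "{-1/B<..<1/B}"])
      (use assms H_ray in \<open>auto simp: abs_less_iff\<close>)
  from DERIV_unique[OF d this] show "Hr t \<theta> = 2 * t + 3 * t ^ 2 * G \<theta> t + t ^ 3 * G' \<theta> t" .
qed

text \<open>The main term is \<open>2 * t\<close>; for \<open>t\<close> up to
  \<open>4 * \<delta>\<close> the products with \<open>M\<close> and \<open>B\<close> are at most
  1/16, so the perturbation is at most \<open>t\<close> in absolute value.\<close>

lemma Hr_ge:
  assumes "0 \<le> t" "t \<le> 4 * \<delta>"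
  shows "t \<le> Hr t \<theta>"
proof -
  have t: "\<bar>t\<bar> \<le> 1 / (2 * B)" "\<bar>t\<bar> < 1 / B" using assms fourth_\<delta> by auto
  have tM: "t * M \<le> 1 / 16" "t * B \<le> 1 / 16"
    using order_trans[OF assms(2) fourth_\<delta>(2)] order_trans[OF assms(2) fourth_\<delta>(1)] M_pos B_pos
    by (auto simp: field_simps)
  have 1: "\<bar>t * G \<theta> t\<bar> \<le> t * (2 * M)"
    using geometric_bound.norm_G_le[OF gb, of t \<theta>] t assms by (auto simp: abs_mult intro!: mult_left_mono)
  have 2: "\<bar>t * (t * G' \<theta> t)\<bar> \<le> t * (t * (4 * M * B))"
    using geometric_bound.norm_G'_le[OF gb, of t \<theta>] t assms by (auto simp: abs_mult intro!: mult_left_mono)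
  have "t * (t * (4 * M * B)) = 4 * (t * M) * (t * B)" by simp
  also have "\<dots> \<le> 4 * (1 / 16) * (1 / 16)"
    by (intro mult_mono tM) (use assms M_pos B_pos in auto)
  finally have "\<bar>3 * (t * G \<theta> t) + t * (t * G' \<theta> t)\<bar> \<le> 1" using 1 2 tM by linarith
  then have "0 \<le> t * (1 + (3 * (t * G \<theta> t) + t * (t * G' \<theta> t)))"
    using assms by (intro mult_nonneg_nonneg) auto
  then show ?thesis
    unfolding H_ray_deriv(2)[OF t(2)] by (simp add: algebra_simps power2_eq_square power3_eq_cube)
qed

lemma H_ray_strict_mono:
  assumes "0 \<le> t" "t < t'" "t' \<le> 4 * \<delta>"
  shows "H (ray t \<theta>) < H (ray t' \<theta>)"
proof (rule DERIV_pos_imp_increasing_open[OF assms(2)])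
  fix x assume "t < x" "x < t'"
  then have "x \<le> Hr x \<theta>" "0 < x" "\<bar>x\<bar> < 1 / B" using Hr_ge[of x \<theta>] assms fourth_\<delta>(3) by auto
  then show "\<exists>y. ((\<lambda>t. H (ray t \<theta>)) has_real_derivative y) (at x) \<and> 0 < y"
    using H_ray_deriv(1) by (intro exI[of _ "Hr x \<theta>"]) auto
next
  show "continuous_on {t..t'} (\<lambda>t. H (ray t \<theta>))"
  proof (rule DERIV_continuous_on)
    fix x assume "x \<in> {t..t'}"
    then have "\<bar>x\<bar> < 1 / B" using assms fourth_\<delta>(3) by auto
    then show "((\<lambda>t. H (ray t \<theta>)) has_real_derivative Hr x \<theta>) (at x within {t..t'})"
      by (rule has_field_derivative_at_within[OF H_ray_deriv(1)])
  qed
qed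

definition R where "R s \<theta> = s * V \<theta> s"

lemma R_bounds:
  assumes "0 < s" "s < \<delta>"
  shows "0 < R s \<theta>" "R s \<theta> < 2 * s" "R s \<theta> < 4 * \<delta>"
proof -
  have "\<bar>V \<theta> s - 1\<bar> \<le> 1 / 4" using geometric_bound.v_bound[OF gb] assms by simp
  then have "0 < V \<theta> s" "V \<theta> s < 2" by linarith+
  then show "0 < R s \<theta>" "R s \<theta> < 2 * s" using assms by (auto simp: R_def)
  then show "R s \<theta> < 4 * \<delta>" using assms by linarith
qed

lemma R_small: "\<bar>s\<bar> < \<delta> \<Longrightarrow> \<bar>R s \<theta>\<bar> < 1 / B"
  unfolding R_def by (intro geometric_bound.arg_bound_real(2)[OF gb] geometric_bound.v_bound[OF gb])

lemma H_R: "\<bar>s\<bar> < \<delta> \<Longrightarrow> H (ray (R s \<theta>) \<theta>) = s ^ 2"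
proof -
  assume s: "\<bar>s\<bar> < \<delta>"
  have "H (ray (R s \<theta>) \<theta>) = s ^ 2 * (V \<theta> s ^ 2 + s * V \<theta> s ^ 3 * G \<theta> (s * V \<theta> s))"
    unfolding H_ray[OF R_small[OF s]] by (simp add: R_def power2_eq_square power3_eq_cube algebra_simps)
  then show ?thesis using geometric_bound.v_root[OF gb s] by simp
qed

text \<open>Strict monotonicity along the ray makes \<open>R s \<theta>\<close> its only crossing of
  the level within the radius \<open>4 * \<delta>\<close>. The shape of the level and sublevel sets
  is read off from this.\<close>

lemma H_ray_compare:
  assumes "0 \<le> t" "t \<le> 4 * \<delta>" "0 < s" "s < \<delta>"
  shows "H (ray t \<theta>) < s ^ 2 \<longleftrightarrow> t < R s \<theta>" "H (ray t \<theta>) = s ^ 2 \<longleftrightarrow> t = R s \<theta>"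
proof -
  have "H (ray (R s \<theta>) \<theta>) = s ^ 2" using H_R assms by simp
  then show "H (ray t \<theta>) < s ^ 2 \<longleftrightarrow> t < R s \<theta>" "H (ray t \<theta>) = s ^ 2 \<longleftrightarrow> t = R s \<theta>"
    using H_ray_strict_mono[of t "R s \<theta>" \<theta>] H_ray_strict_mono[of "R s \<theta>" t \<theta>] R_bounds[OF assms(3,4), of \<theta>] assms
    by (smt (verit))+
qed

section \<open>The period and area series\<close>

text \<open>The coefficients of V^2 grow at most like \<open>(4 / \<delta>) ^ n\<close>; one eighth
  of \<open>\<delta>\<close> gives the convergent majorant \<open>4 * (1 / 2) ^ n\<close>.\<close>

definition \<sigma> where "\<sigma> = \<delta> / 8"

lemma \<sigma>: "0 < \<sigma>" "\<sigma> < \<delta>" using \<delta>(1) by (auto simp: \<sigma>_def)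

definition q where "q \<theta> n = fps_nth (P \<theta> ^ 2) n"

lemma q_bound: "\<bar>q \<theta> n\<bar> \<le> 4 * (4 / \<delta>) ^ n"
proof -
  have "\<bar>q \<theta> n\<bar> \<le> (\<Sum>i=0..n. \<bar>fps_nth (P \<theta>) i * fps_nth (P \<theta>) (n - i)\<bar>)"
    unfolding q_def power2_eq_square fps_mult_nth by (rule sum_abs)
  also have "\<dots> \<le> (\<Sum>i=0..n. 4 * (2 / \<delta>) ^ n)"
  proof (rule sum_mono)
    fix i assume "i \<in> {0..n}"
    then have n: "n = i + (n - i)" by simp
    have "\<bar>fps_nth (P \<theta>) i * fps_nth (P \<theta>) (n - i)\<bar> \<le> (2 * (2 / \<delta>) ^ i) * (2 * (2 / \<delta>) ^ (n - i))"
      unfolding abs_mult by (intro mult_mono geometric_bound.P_bound[OF gb]) (use \<delta>(1) in auto)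
    also have "\<dots> = 4 * (2 / \<delta>) ^ n"
    proof -
      have "(2 / \<delta>) ^ n = (2 / \<delta>) ^ i * (2 / \<delta>) ^ (n - i)" using n by (metis power_add)
      then show ?thesis by simp
    qed
    finally show "\<bar>fps_nth (P \<theta>) i * fps_nth (P \<theta>) (n - i)\<bar> \<le> 4 * (2 / \<delta>) ^ n" .
  qed
  also have "\<dots> = real (Suc n) * (4 * (2 / \<delta>) ^ n)" by simp
  also have "\<dots> \<le> 2 ^ n * (4 * (2 / \<delta>) ^ n)"
  proof (rule mult_right_mono)
    have "Suc n \<le> 2 ^ n" by (simp add: Suc_leI less_exp)
    then show "real (Suc n) \<le> 2 ^ n" by (metis of_nat_le_iff of_nat_numeral of_nat_power)
  qed (use \<delta>(1) in auto)
  also have "\<dots> = 4 * (2 * (2 / \<delta>)) ^ n" by (simp only: power_mult_distrib mult_ac)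
  finally show ?thesis by simp
qed

lemma q_term_bound:
  assumes "\<bar>s\<bar> < \<sigma>"
  shows "\<bar>q \<theta> n * s ^ n\<bar> \<le> 4 * (1 / 2) ^ n"
proof -
  have "\<bar>q \<theta> n * s ^ n\<bar> \<le> 4 * (4 / \<delta>) ^ n * \<sigma> ^ n"
    unfolding abs_mult power_abs
    by (intro mult_mono q_bound power_mono) (use assms \<delta>(1) in auto)
  also have "\<dots> = 4 * (4 / \<delta> * \<sigma>) ^ n" by (simp only: power_mult_distrib mult_ac)
  also have "4 / \<delta> * \<sigma> = 1 / 2" using \<delta>(1) by (simp add: \<sigma>_def)
  finally show ?thesis .
qed

lemma fps_conv_radius_P: "ereal \<delta> \<le> fps_conv_radius (P \<theta>)"
  unfolding fps_conv_radius_def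
proof (rule conv_radius_geI_ex')
  fix s :: real assume "0 < s" "ereal s < ereal \<delta>"
  then show "summable (\<lambda>n. fps_nth (P \<theta>) n * of_real s ^ n)"
    using geometric_bound.P_sums[OF gb, of s \<theta>] by (auto simp: sums_iff)
qed

lemma q_sums: "\<bar>s\<bar> < \<sigma> \<Longrightarrow> (\<lambda>n. q \<theta> n * s ^ n) sums (V \<theta> s ^ 2)"
proof -
  assume s: "\<bar>s\<bar> < \<sigma>"
  then have s': "\<bar>s\<bar> < \<delta>" using \<sigma> by linarith
  have n: "ereal (norm s) < fps_conv_radius (P \<theta>)"
    using s' by (intro less_le_trans[OF _ fps_conv_radius_P]) simp
  have "eval_fps (P \<theta>) s = V \<theta> s"
    using geometric_bound.P_sums[OF gb s'] by (simp add: eval_fps_def sums_iff)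
  then have "eval_fps (P \<theta> ^ 2) s = V \<theta> s ^ 2" using eval_fps_power[OF n, of 2] by simp
  moreover have "(\<lambda>n. fps_nth (P \<theta> ^ 2) n * s ^ n) sums eval_fps (P \<theta> ^ 2) s"
    using less_le_trans[OF n fps_conv_radius_power[of "P \<theta>" 2]] by (rule sums_eval_fps)
  ultimately show ?thesis by (simp only: q_def)
qed

lemma P_0: "fps_nth (P \<theta>) 0 = 1"
  by (rule geometric_bound.P_0[OF gb])

lemma continuous_a: "continuous_on UNIV (\<lambda>\<theta>. a \<theta> n)"
  unfolding a_def k_def e1_def e2_def by (intro continuous_intros)

text \<open>Continuity in the angle is obtained coefficient by coefficient from the recursion, with
  continuous functions as the ring; the only divisor is the constant 2.\<close>

lemma continuous_P_nth: "continuous_on UNIV (\<lambda>\<theta>. fps_nth (P \<theta>) n)"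
proof -
  interpret function_ring UNIV "\<lambda>f :: real \<Rightarrow> real. continuous_on UNIV f"
  proof
    show "continuous_on UNIV f \<Longrightarrow> (\<And>z. z \<in> UNIV \<Longrightarrow> f z = g z) \<Longrightarrow> continuous_on UNIV g"
      for f g :: "real \<Rightarrow> real"
      by (metis (mono_tags, lifting) continuous_on_cong)
  qed (auto intro: continuous_intros)
  show ?thesis
  proof (rule implicit_coeffs)
    show "continuous_on UNIV (\<lambda>\<theta>. fps_nth (Abs_fps (a \<theta>)) n)" for n using continuous_a by simp
    show "fps_const 1 * P \<theta> ^ 2 + fps_X * P \<theta> ^ 3 * (Abs_fps (a \<theta>) oo (fps_X * P \<theta>)) = 1" for \<theta>
      using geometric_bound.P_equation[OF gb, of \<theta>] by simp
  qed (simp_all add: P_0)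
qed

lemma continuous_q: "continuous_on A (\<lambda>\<theta>. q \<theta> n)"
proof (rule continuous_on_subset)
  show "continuous_on UNIV (\<lambda>\<theta>. q \<theta> n)"
    unfolding q_def power2_eq_square fps_mult_nth by (intro continuous_intros continuous_P_nth)
qed simp

section \<open>Parity under the half turn\<close>

lemma e_shift: "e1 (\<theta> + pi) = - e1 \<theta>" "e2 (\<theta> + pi) = - e2 \<theta>"
  by (simp_all add: e1_def e2_def)

text \<open>\<open>a \<theta> n\<close> is homogeneous of degree \<open>n + 3\<close> in the frame
  vector, which changes sign under the half turn; the odd offset 3 accounts for the outer minus
  sign.\<close>

lemma a_shift: "a (\<theta> + pi) n = - ((-1) ^ n * a \<theta> n)"
proof -
  have "k (\<theta> + pi) n = (-1) ^ n * k \<theta> n" for n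
    unfolding k_def sum_distrib_left e_shift
  proof (rule sum.cong)
    fix i assume "i \<in> {..n}"
    then have n: "n = i + (n - i)" by simp
    have "(- e1 \<theta>) ^ i * (- e2 \<theta>) ^ (n - i) = ((-1) ^ i * (-1) ^ (n - i)) * (e1 \<theta> ^ i * e2 \<theta> ^ (n - i))"
      by (simp only: power_minus[of "e1 \<theta>"] power_minus[of "e2 \<theta>"] mult_ac)
    also have "(-1) ^ i * (-1) ^ (n - i) = (-1 :: real) ^ n" using n by (metis power_add)
    finally show "c i (n - i) * (- e1 \<theta>) ^ i * (- e2 \<theta>) ^ (n - i)
        = (- 1) ^ n * (c i (n - i) * e1 \<theta> ^ i * e2 \<theta> ^ (n - i))"
      by (simp only: mult_ac)
  qed simp
  then show ?thesis by (simp add: a_def power_add)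
qed

lemma G_shift:
  assumes "\<bar>t\<bar> < 1 / B"
  shows "G (\<theta> + pi) (- t) = - G \<theta> t"
proof -
  have "a (\<theta> + pi) n * (- t) ^ n = - (a \<theta> n * t ^ n)" for n
  proof -
    have "a (\<theta> + pi) n * (- t) ^ n = - ((-1) ^ n * (-1) ^ n * (a \<theta> n * t ^ n))"
      unfolding a_shift power_minus[of t] by simp
    also have "(-1) ^ n * (-1) ^ n = (1::real)" by (simp flip: power_mult_distrib)
    finally show ?thesis by simp
  qed
  moreover have "summable (\<lambda>n. a \<theta> n * t ^ n)"
    using geometric_bound.summable_G[OF gb, of t \<theta>] assms by simp
  ultimately show ?thesis by (simp add: geometric_bound.G_def[OF gb] suminf_minus)
qed

text \<open>\<open>ray t \<theta>\<close> and \<open>ray (- t) (\<theta> + pi)\<close> are the same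
  point, so \<open>V \<theta> s\<close> also solves the equation belonging to \<open>- s\<close> and
  \<open>\<theta> + pi\<close>; the root near 1 is unique.\<close>

lemma V_shift: "V (\<theta> + pi) (- s) = V \<theta> s" if s: "\<bar>s\<bar> < \<delta>"
proof -
  have "(V \<theta> s) ^ 2 + (- s) * (V \<theta> s) ^ 3 * G (\<theta> + pi) (- s * V \<theta> s) = 1"
    using geometric_bound.v_root[OF gb s, of \<theta>] G_shift[OF R_small[OF s, of \<theta>], of \<theta>]
    by (simp add: R_def)
  then show ?thesis
    using geometric_bound.root_iff[OF gb, of "- s" "V \<theta> s" "\<theta> + pi"] geometric_bound.v_bound[OF gb s, of \<theta>] s
    by simp
qed

lemma P_shift: "fps_nth (P (\<theta> + pi)) n = (-1) ^ n * fps_nth (P \<theta>) n"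
proof -
  have "(V \<theta>) has_fps_expansion Abs_fps (\<lambda>n. (-1) ^ n * fps_nth (P (\<theta> + pi)) n)"
  proof (rule has_fps_expansionI)
    have "\<forall>\<^sub>F s in nhds (0::real). s \<in> {-\<delta><..<\<delta>}"
      using \<delta>(1) by (intro eventually_nhds_in_open) auto
    then show "\<forall>\<^sub>F s in nhds 0. (\<lambda>n. fps_nth (Abs_fps (\<lambda>n. (-1) ^ n * fps_nth (P (\<theta> + pi)) n)) n * s ^ n) sums V \<theta> s"
    proof eventually_elim
      case (elim s)
      then have s: "\<bar>s\<bar> < \<delta>" "\<bar>- s\<bar> < \<delta>" by auto
      have "(\<lambda>n. fps_nth (P (\<theta> + pi)) n * (- s) ^ n) sums V \<theta> s"
        using geometric_bound.P_sums[OF gb s(2), of "\<theta> + pi"] V_shift[OF s(1), of \<theta>] by simp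
      then show ?case unfolding power_minus[of s] by (simp add: mult_ac)
    qed
  qed
  then have eq: "P \<theta> = Abs_fps (\<lambda>n. (-1) ^ n * fps_nth (P (\<theta> + pi)) n)"
    by (rule fps_expansion_unique_real[OF geometric_bound.v_has_fps_expansion[OF gb]])
  have "fps_nth (P \<theta>) n = (-1) ^ n * fps_nth (P (\<theta> + pi)) n" by (subst eq) simp
  then have "(-1) ^ n * fps_nth (P \<theta>) n = ((-1) ^ n * (-1) ^ n) * fps_nth (P (\<theta> + pi)) n" by simp
  also have "(-1) ^ n * (-1) ^ n = (1::real)" by (simp flip: power_mult_distrib)
  finally show ?thesis by simp
qed

lemma q_shift: "q (\<theta> + pi) n = (-1) ^ n * q \<theta> n"
  unfolding q_def power2_eq_square fps_mult_nth sum_distrib_left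
proof (rule sum.cong)
  fix i assume "i \<in> {0..n}"
  then have n: "n = i + (n - i)" by simp
  have "(-1) ^ n = (-1) ^ i * (-1 :: real) ^ (n - i)" using n by (metis power_add)
  then show "fps_nth (P (\<theta> + pi)) i * fps_nth (P (\<theta> + pi)) (n - i)
      = (-1) ^ n * (fps_nth (P \<theta>) i * fps_nth (P \<theta>) (n - i))"
    unfolding P_shift by simp
qed simp

text \<open>The halving anticipates the factor 1/2 of area in polar coordinates, so that the
  coefficients of the area become \<open>J * Q\<close>.\<close>

definition Q where "Q n = integral {0..2 * pi} (\<lambda>\<theta>. q \<theta> n) / 2"

text \<open>The half turn carries one half of the interval to the other and reverses the sign of the
  integrand, so the two halves cancel.\<close>

lemma Q_odd: "odd n \<Longrightarrow> Q n = 0"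
proof -
  assume n: "odd n"
  have int: "(\<lambda>\<theta>. q \<theta> n) integrable_on S" if "S = {a..b}" for S and a b :: real
    unfolding that by (intro integrable_continuous_interval continuous_q)
  have "integral {0..2 * pi} (\<lambda>\<theta>. q \<theta> n) = integral {0..pi} (\<lambda>\<theta>. q \<theta> n) + integral {pi..2 * pi} (\<lambda>\<theta>. q \<theta> n)"
    by (rule Henstock_Kurzweil_Integration.integral_combine[symmetric]) (simp_all add: int)
  also have "integral {pi..2 * pi} (\<lambda>\<theta>. q \<theta> n) = integral {0..pi} ((\<lambda>\<theta>. q \<theta> n) \<circ> (+) pi)"
  proof (rule integral_unique[symmetric])
    have "((\<lambda>\<theta>. q \<theta> n) has_integral integral {pi..2 * pi} (\<lambda>\<theta>. q \<theta> n)) (cbox (0 + pi) (pi + pi))"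
      using integrable_integral[OF int[of "{pi..2 * pi}" pi "2 * pi"]] by simp
    then show "((\<lambda>\<theta>. q \<theta> n) \<circ> (+) pi has_integral integral {pi..2 * pi} (\<lambda>\<theta>. q \<theta> n)) {0..pi}"
      unfolding has_integral_shift_cbox_iff[symmetric] by simp
  qed
  also have "(\<lambda>\<theta>. q \<theta> n) \<circ> (+) pi = (\<lambda>\<theta>. - q \<theta> n)"
    using n q_shift by (auto simp: fun_eq_iff add.commute[of pi])
  finally show ?thesis by (simp add: Q_def)
qed

text \<open>In the variable h = s^2 this is the termwise derivative of \<open>area_fps\<close>, so
  the relation A' = T is built in; the substance lies in \<open>period_sums\<close> and
  \<open>R_deriv\<close>, by which the period integral has this series.\<close>

definition period_fps where "period_fps = Abs_fps (\<lambda>m. J * real (Suc m) * Q (2 * m))"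
definition area_fps where "area_fps = Abs_fps (\<lambda>m. if m = 0 then 0 else J * Q (2 * (m - 1)))"

lemma area_fps_deriv: "fps_deriv area_fps = period_fps"
  by (simp add: fps_eq_iff area_fps_def period_fps_def)

lemma Q_even_sums:
  assumes "(\<lambda>n. f n * Q n) sums S"
  shows "(\<lambda>m. f (2 * m) * Q (2 * m)) sums S"
proof -
  have "strict_mono (\<lambda>m::nat. 2 * m)" by (simp add: strict_mono_def)
  then show ?thesis
    by (subst sums_mono_reindex) (use assms Q_odd in \<open>auto simp: image_iff elim!: evenE\<close>)
qed

lemma Suc_Suc_summable: "summable (\<lambda>n. real (n + 2) * (C * (1 / 2) ^ n))"
proof -
  have "(\<lambda>n. of_nat (Suc n) * (1 / 2 :: real) ^ n) sums (1 / (1 - 1 / 2)\<^sup>2)"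
    by (rule geometric_deriv_sums) simp
  then have "summable (\<lambda>n. C * (of_nat (Suc n) * (1 / 2 :: real) ^ n + (1 / 2) ^ n))"
    by (intro summable_mult summable_add summable_geometric) (auto simp: sums_iff)
  then show ?thesis by (simp add: algebra_simps)
qed

text \<open>Since R^2 is the sum of \<open>q \<theta> n * s ^ (n + 2)\<close>, its derivative in
  \<open>s\<close> is \<open>s * D s \<theta>\<close>.\<close>

definition D where "D s \<theta> = (\<Sum>n. real (n + 2) * (q \<theta> n * s ^ n))"

lemma D_term_bound: "\<bar>s\<bar> < \<sigma> \<Longrightarrow> \<bar>real (n + 2) * (q \<theta> n * s ^ n)\<bar> \<le> real (n + 2) * (4 * (1 / 2) ^ n)"
  unfolding abs_mult[of "real (n + 2)"] using q_term_bound by (simp add: mult_left_mono)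

lemma D_sums: "\<bar>s\<bar> < \<sigma> \<Longrightarrow> (\<lambda>n. real (n + 2) * (q \<theta> n * s ^ n)) sums D s \<theta>"
  unfolding D_def
  by (intro summable_sums summable_comparison_test'[OF Suc_Suc_summable[of 4], where N = 0])
    (use D_term_bound in simp)

lemma D_integral:
  assumes "\<bar>s\<bar> < \<sigma>"
  shows "continuous_on {x..y} (D s)" "(\<lambda>n. integral {x..y} (\<lambda>\<theta>. real (n + 2) * (q \<theta> n * s ^ n))) sums integral {x..y} (D s)"
    "(D s has_integral integral {x..y} (D s)) {x..y}"
proof -
  have "continuous_on {x..y} (\<lambda>\<theta>. real (n + 2) * (q \<theta> n * s ^ n))" for n
    by (intro continuous_intros continuous_q)
  note h = has_integral_sums[OF this D_term_bound[OF assms] Suc_Suc_summable D_sums[OF assms]]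
  show "continuous_on {x..y} (D s)" "(\<lambda>n. integral {x..y} (\<lambda>\<theta>. real (n + 2) * (q \<theta> n * s ^ n))) sums integral {x..y} (D s)"
    "(D s has_integral integral {x..y} (D s)) {x..y}"
    by (rule h)+
qed

lemma V_integral:
  assumes "\<bar>s\<bar> < \<sigma>"
  shows "continuous_on {x..y} (\<lambda>\<theta>. V \<theta> s ^ 2)"
    "(\<lambda>n. integral {x..y} (\<lambda>\<theta>. q \<theta> n * s ^ n)) sums integral {x..y} (\<lambda>\<theta>. V \<theta> s ^ 2)"
    "((\<lambda>\<theta>. V \<theta> s ^ 2) has_integral integral {x..y} (\<lambda>\<theta>. V \<theta> s ^ 2)) {x..y}"
proof -
  have c: "continuous_on {x..y} (\<lambda>\<theta>. q \<theta> n * s ^ n)" for n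
    by (intro continuous_intros continuous_q)
  have "summable (\<lambda>n. 4 * (1 / 2 :: real) ^ n)" by (intro summable_mult summable_geometric) simp
  note h = has_integral_sums[OF c q_term_bound[OF assms] this q_sums[OF assms]]
  show "continuous_on {x..y} (\<lambda>\<theta>. V \<theta> s ^ 2)"
    "(\<lambda>n. integral {x..y} (\<lambda>\<theta>. q \<theta> n * s ^ n)) sums integral {x..y} (\<lambda>\<theta>. V \<theta> s ^ 2)"
    "((\<lambda>\<theta>. V \<theta> s ^ 2) has_integral integral {x..y} (\<lambda>\<theta>. V \<theta> s ^ 2)) {x..y}"
    by (rule h)+
qed

text \<open>Termwise bounds give continuity of the square; as \<open>V\<close> is at least 3/4, it
  is the square root of that square.\<close>

lemma continuous_V: "\<bar>s\<bar> < \<sigma> \<Longrightarrow> continuous_on A (\<lambda>\<theta>. V \<theta> s)"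
proof -
  assume s: "\<bar>s\<bar> < \<sigma>"
  have "V \<theta> s = sqrt (V \<theta> s ^ 2)" for \<theta>
  proof -
    have "\<bar>V \<theta> s - 1\<bar> \<le> 1 / 4" using geometric_bound.v_bound[OF gb, of s \<theta>] s \<sigma> by simp
    then have "0 \<le> V \<theta> s" by linarith
    then show ?thesis by simp
  qed
  moreover have "isCont (\<lambda>\<theta>. sqrt (V \<theta> s ^ 2)) \<theta>" for \<theta>
  proof -
    have "continuous_on {\<theta> - 1..\<theta> + 1} (\<lambda>\<theta>. sqrt (V \<theta> s ^ 2))"
      by (intro continuous_intros V_integral(1) s)
    then have "continuous_on {\<theta> - 1<..<\<theta> + 1} (\<lambda>\<theta>. sqrt (V \<theta> s ^ 2))"
      by (rule continuous_on_subset) auto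
    then show ?thesis by (subst (asm) continuous_on_eq_continuous_at) auto
  qed
  ultimately have "isCont (\<lambda>\<theta>. V \<theta> s) \<theta>" for \<theta> by simp
  then show ?thesis by (intro continuous_at_imp_continuous_on) auto
qed

lemma period_sums:
  assumes "\<bar>s\<bar> < \<sigma>"
  shows "(\<lambda>m. fps_nth period_fps m * (s\<^sup>2) ^ m) sums integral {0..2 * pi} (\<lambda>\<theta>. J / 4 * D s \<theta>)"
proof -
  have "integral {0..2 * pi} (\<lambda>\<theta>. real (n + 2) * (q \<theta> n * s ^ n)) = (2 * real (n + 2) * s ^ n) * Q n" for n
    by (simp add: Q_def)
  then have "(\<lambda>n. (2 * real (n + 2) * s ^ n) * Q n) sums integral {0..2 * pi} (D s)"
    using D_integral(2)[OF assms, of 0 "2 * pi"] by (simp only:)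
  \<comment> \<open>At n = 2 m the factors combine to J / 4 times 2 times (2 m + 2), which is J (m +
    1).\<close>
  from sums_mult[OF Q_even_sums[OF this], of "J / 4"]
  show ?thesis by (simp add: period_fps_def power_mult[symmetric] algebra_simps)
qed

lemma area_sums:
  assumes "\<bar>s\<bar> < \<sigma>"
  shows "(\<lambda>m. fps_nth area_fps m * (s\<^sup>2) ^ m) sums integral {0..2 * pi} (\<lambda>\<theta>. J / 2 * (R s \<theta>)\<^sup>2)"
proof -
  have "integral {0..2 * pi} (\<lambda>\<theta>. q \<theta> n * s ^ n) = (2 * s ^ n) * Q n" for n
    by (simp add: Q_def)
  then have "(\<lambda>n. (2 * s ^ n) * Q n) sums integral {0..2 * pi} (\<lambda>\<theta>. V \<theta> s ^ 2)"
    using V_integral(2)[OF assms, of 0 "2 * pi"] by (simp only:)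
  from sums_mult[OF Q_even_sums[OF this], of "J / 2 * s\<^sup>2"]
  have "(\<lambda>m. fps_nth area_fps (Suc m) * (s\<^sup>2) ^ Suc m) sums
      (J / 2 * s\<^sup>2 * integral {0..2 * pi} (\<lambda>\<theta>. V \<theta> s ^ 2))"
    by (simp add: area_fps_def power_mult[symmetric] mult_ac)
  also have "J / 2 * s\<^sup>2 * integral {0..2 * pi} (\<lambda>\<theta>. V \<theta> s ^ 2) = integral {0..2 * pi} (\<lambda>\<theta>. J / 2 * (R s \<theta>)\<^sup>2)"
    by (simp add: R_def power_mult_distrib mult_ac)
  finally show ?thesis
    by (subst (asm) sums_Suc_iff) (simp add: area_fps_def)
qed

text \<open>Differentiating H = s^2 along R gives Hr R' = 2 s, and differentiating the series of R^2
  gives 2 R R' = s D. Eliminating R' turns the quotient R / Hr, whose dependence on s is implicit,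
  into an explicit power series.\<close>

lemma R_deriv:
  assumes s: "0 < s" "s < \<sigma>"
  shows "J * R s \<theta> / Hr (R s \<theta>) \<theta> = J / 4 * D s \<theta>"
proof -
  have s': "\<bar>s\<bar> < \<sigma>" "\<bar>s\<bar> < \<delta>" "0 < s" "s < \<delta>" using s \<sigma> by auto
  have "((\<lambda>s. \<Sum>n. fps_nth (P \<theta>) n * s ^ n) has_real_derivative (\<Sum>n. diffs (fps_nth (P \<theta>)) n * s ^ n)) (at s)"
    by (rule termdiffs_strong'[where K = \<delta>])
      (use geometric_bound.P_sums[OF gb] s' in \<open>auto simp: sums_iff\<close>)
  then have "(V \<theta> has_real_derivative (\<Sum>n. diffs (fps_nth (P \<theta>)) n * s ^ n)) (at s)"
    by (rule has_field_derivative_transform_within_open[where S = "{-\<delta><..<\<delta>}"])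
      (use geometric_bound.P_sums[OF gb] s' in \<open>auto simp: sums_iff abs_less_iff\<close>)
  then have "\<exists>R'. ((\<lambda>s. R s \<theta>) has_real_derivative R') (at s)"
    unfolding R_def by (intro exI) (rule DERIV_mult[OF DERIV_ident])
  then obtain R' where R': "((\<lambda>s. R s \<theta>) has_real_derivative R') (at s)" by blast
  have "((\<lambda>s. H (ray (R s \<theta>) \<theta>)) has_real_derivative Hr (R s \<theta>) \<theta> * R') (at s)"
    by (rule DERIV_chain2[where f = "\<lambda>t. H (ray t \<theta>)" and g = "\<lambda>s. R s \<theta>", OF H_ray_deriv(1)[OF R_small[OF s'(2)]] R'])
  then have "((\<lambda>s. s\<^sup>2) has_real_derivative Hr (R s \<theta>) \<theta> * R') (at s)"
    by (rule has_field_derivative_transform_within_open[where S = "{-\<delta><..<\<delta>}"])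
      (use H_R s' in \<open>auto simp: abs_less_iff\<close>)
  moreover have "((\<lambda>s. s\<^sup>2) has_real_derivative 2 * s) (at s)" by (auto intro!: derivative_eq_intros)
  ultimately have 1: "Hr (R s \<theta>) \<theta> * R' = 2 * s" by (rule DERIV_unique)
  have "((\<lambda>s. (R s \<theta>)\<^sup>2) has_real_derivative 2 * R s \<theta> * R') (at s)"
    by (auto intro!: derivative_eq_intros R')
  moreover have "((\<lambda>s. (R s \<theta>)\<^sup>2) has_real_derivative s * D s \<theta>) (at s)"
  proof -
    have q: "((\<lambda>s. \<Sum>n. q \<theta> n * s ^ n) has_real_derivative (\<Sum>n. diffs (q \<theta>) n * s ^ n)) (at s)"
      by (rule termdiffs_strong'[where K = \<sigma>]) (use q_sums s' in \<open>auto simp: sums_iff\<close>)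
    have "((\<lambda>s. V \<theta> s ^ 2) has_real_derivative (\<Sum>n. diffs (q \<theta>) n * s ^ n)) (at s)"
      by (rule has_field_derivative_transform_within_open[OF q, where S = "{-\<sigma><..<\<sigma>}"])
        (use q_sums s' in \<open>auto simp: sums_iff abs_less_iff\<close>)
    with \<open>((\<lambda>s. s\<^sup>2) has_real_derivative 2 * s) (at s)\<close>
    have d: "((\<lambda>s. s ^ 2 * V \<theta> s ^ 2) has_real_derivative
        (2 * s * V \<theta> s ^ 2 + (\<Sum>n. diffs (q \<theta>) n * s ^ n) * s ^ 2)) (at s)"
      by (rule DERIV_mult)
    have "summable (\<lambda>n. diffs (q \<theta>) n * s ^ n)"
      by (rule termdiff_converges[where K = \<sigma>]) (use q_sums s' in \<open>auto simp: sums_iff\<close>)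
    then have "(\<lambda>n. of_nat n * q \<theta> n * s ^ (n - Suc 0)) sums (\<Sum>n. diffs (q \<theta>) n * s ^ n)"
      by (rule diffs_equiv)
    then have "(\<lambda>n. s * (of_nat n * q \<theta> n * s ^ (n - Suc 0))) sums (s * (\<Sum>n. diffs (q \<theta>) n * s ^ n))"
      by (rule sums_mult)
    moreover have "s * (of_nat n * q \<theta> n * s ^ (n - Suc 0)) = real n * (q \<theta> n * s ^ n)" for n
      by (cases n) simp_all
    ultimately have "(\<lambda>n. real n * (q \<theta> n * s ^ n) + 2 * (q \<theta> n * s ^ n)) sums
        (s * (\<Sum>n. diffs (q \<theta>) n * s ^ n) + 2 * V \<theta> s ^ 2)"
      by (intro sums_add sums_mult q_sums s') simp
    then have "(\<lambda>n. real (n + 2) * (q \<theta> n * s ^ n)) sums (s * (\<Sum>n. diffs (q \<theta>) n * s ^ n) + 2 * V \<theta> s ^ 2)"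
      by (simp add: algebra_simps)
    then have "D s \<theta> = s * (\<Sum>n. diffs (q \<theta>) n * s ^ n) + 2 * V \<theta> s ^ 2"
      using D_sums[OF s'(1), of \<theta>] sums_unique2 by blast
    then show ?thesis using d by (simp add: R_def power_mult_distrib algebra_simps power2_eq_square)
  qed
  ultimately have 2: "2 * R s \<theta> * R' = s * D s \<theta>" by (rule DERIV_unique)
  have pos: "0 < R s \<theta>" "R s \<theta> < 4 * \<delta>" using R_bounds s' by blast+
  then have "0 < Hr (R s \<theta>) \<theta>" using Hr_ge[of "R s \<theta>" \<theta>] by simp
  moreover have "s * D s \<theta> * Hr (R s \<theta>) \<theta> = 4 * R s \<theta> * s"
    unfolding 2[symmetric] using 1 by (simp add: algebra_simps)
  ultimately show ?thesis using s by (simp add: field_simps)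
qed

lemma conv_radius_period_area:
  "ereal (\<sigma>\<^sup>2) \<le> fps_conv_radius period_fps" "ereal (\<sigma>\<^sup>2) \<le> fps_conv_radius area_fps"
proof -
  have "\<exists>s. \<bar>s\<bar> < \<sigma> \<and> x = s\<^sup>2" if "0 < x" "ereal x < ereal (\<sigma>\<^sup>2)" for x :: real
  proof (intro exI conjI)
    show "\<bar>sqrt x\<bar> < \<sigma>" using that \<sigma>(1) by (simp add: real_less_lsqrt)
    show "x = (sqrt x)\<^sup>2" using that by simp
  qed
  then show "ereal (\<sigma>\<^sup>2) \<le> fps_conv_radius period_fps" "ereal (\<sigma>\<^sup>2) \<le> fps_conv_radius area_fps"
    unfolding fps_conv_radius_def
    by (safe intro!: conv_radius_geI_ex'; use period_sums area_sums in \<open>force simp: sums_iff\<close>)+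
qed

lemma period_integral:
  assumes "0 < s" "s < \<sigma>"
  shows "((\<lambda>\<theta>. J * R s \<theta> / Hr (R s \<theta>) \<theta>) has_integral eval_fps period_fps (s\<^sup>2)) {0..2 * pi}"
proof -
  have s: "\<bar>s\<bar> < \<sigma>" using assms by simp
  have "((\<lambda>\<theta>. J / 4 * D s \<theta>) has_integral J / 4 * integral {0..2 * pi} (D s)) {0..2 * pi}"
    by (intro has_integral_mult_right D_integral s)
  moreover have "eval_fps period_fps (s\<^sup>2) = J / 4 * integral {0..2 * pi} (D s)"
    using period_sums[OF s] by (simp add: eval_fps_def sums_iff)
  ultimately show ?thesis by (simp only: R_deriv[OF assms])
qed

lemma area_integral:
  assumes "0 < s" "s < \<sigma>"
  shows "((\<lambda>\<theta>. J / 2 * (R s \<theta>)\<^sup>2) has_integral eval_fps area_fps (s\<^sup>2)) {0..2 * pi}"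
proof -
  have s: "\<bar>s\<bar> < \<sigma>" using assms by simp
  have "(\<lambda>\<theta>. J / 2 * (R s \<theta>)\<^sup>2) integrable_on {0..2 * pi}"
    unfolding R_def by (intro integrable_continuous_interval continuous_intros continuous_V s)
  moreover have "eval_fps area_fps (s\<^sup>2) = integral {0..2 * pi} (\<lambda>\<theta>. J / 2 * (R s \<theta>)\<^sup>2)"
    using area_sums[OF s] by (simp add: eval_fps_def sums_iff)
  ultimately show ?thesis by (simp only: integrable_integral)
qed

section \<open>Level curves\<close>

text \<open>The linear inverse of the frame, with values in the complex plane. It turns the adapted
  polar coordinates into the usual ones, so that \<open>Arg\<close> and complex logarithms supply
  the angles.\<close>

definition \<zeta> :: "real \<times> real \<Rightarrow> complex" where
  "\<zeta> p = Complex (fst p / \<alpha>) ((snd p - \<beta> * fst p / \<alpha>) / \<gamma>)"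

lemma \<zeta>_ray: "\<zeta> (ray t \<theta>) = of_real t * cis \<theta>"
  using \<alpha>_pos \<gamma>_pos by (simp add: \<zeta>_def ray_def e1_def e2_def complex_eq_iff field_simps)

lemma norm_\<zeta>_ray: "norm (\<zeta> (ray t \<theta>)) = \<bar>t\<bar>"
  by (simp add: \<zeta>_ray norm_mult)

lemma \<zeta>_inverse: "p = (\<alpha> * Re (\<zeta> p), \<beta> * Re (\<zeta> p) + \<gamma> * Im (\<zeta> p))"
  using \<alpha>_pos \<gamma>_pos by (cases p) (simp add: \<zeta>_def)

lemma ray_\<zeta>: "\<zeta> p = of_real t * cis \<theta> \<Longrightarrow> p = ray t \<theta>"
  by (subst \<zeta>_inverse) (simp add: ray_def e1_def e2_def algebra_simps)

lemma ray_polar: "p = ray (norm (\<zeta> p)) (Arg (\<zeta> p))"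
  by (rule ray_\<zeta>) (metis rcis_cmod_Arg rcis_def)

lemma bounded_linear_\<zeta>: "bounded_linear \<zeta>"
proof -
  have "\<zeta> = (\<lambda>p. of_real (fst p / \<alpha>) + \<i> * of_real ((snd p - \<beta> * fst p / \<alpha>) / \<gamma>))"
    by (simp add: fun_eq_iff \<zeta>_def complex_eq_iff)
  moreover have "linear (\<lambda>p :: real \<times> real. of_real (fst p / \<alpha>) + \<i> * of_real ((snd p - \<beta> * fst p / \<alpha>) / \<gamma>))"
    by (rule linearI) (simp_all add: complex_eq_iff add_divide_distrib diff_divide_distrib algebra_simps)
  ultimately show ?thesis by (simp add: linear_conv_bounded_linear)
qed

lemma continuous_\<zeta>: "continuous_on A \<zeta>"
  by (rule linear_continuous_on[OF bounded_linear_\<zeta>])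

lemma ray_cong: "cis \<theta> = cis \<theta>' \<Longrightarrow> ray t \<theta> = ray t \<theta>'"
  by (rule ray_\<zeta>) (simp add: \<zeta>_ray)

text \<open>The disc, seen through the frame, on which \<open>H\<close> is known to increase along
  rays; it lies inside the box of convergence.\<close>

definition N where "N = {p. norm (\<zeta> p) < 4 * \<delta>}"

lemma open_N: "open N"
  unfolding N_def by (intro open_Collect_less continuous_intros continuous_\<zeta>)

lemma ray_in_N: "0 \<le> t \<Longrightarrow> ray t \<theta> \<in> N \<longleftrightarrow> t < 4 * \<delta>"
  by (simp add: N_def norm_\<zeta>_ray)

lemma N_cases:
  assumes "p \<in> N"
  obtains t \<theta> where "p = ray t \<theta>" "0 \<le> t" "t < 4 * \<delta>" "-pi \<le> \<theta>" "\<theta> \<le> pi"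
  using that[OF ray_polar[of p]] assms Arg_bounded[of "\<zeta> p"] by (simp add: N_def)

lemma N_box: "p \<in> N \<Longrightarrow> \<bar>fst p\<bar> < r \<and> \<bar>snd p\<bar> < r"
proof (erule N_cases)
  fix t \<theta> assume "p = ray t \<theta>" "0 \<le> t" "t < 4 * \<delta>"
  then show ?thesis using ray_in_box[of t \<theta>] fourth_\<delta>(3) by (simp add: ray_def)
qed

lemma H_has_derivative:
  "p \<in> N \<Longrightarrow> (H has_derivative (\<lambda>(u, v). u * partial_x H p + v * partial_y H p)) (at p)"
  using double_series_has_derivative[OF H, of "fst p" "snd p"] N_box[of p] by simp

lemma continuous_H: "continuous_on N H"
  by (intro continuous_at_imp_continuous_on ballI has_derivative_continuous[OF H_has_derivative])

definition curve where "curve s = range (\<lambda>\<theta>. ray (R s \<theta>) \<theta>)"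

lemma curve_iff: "p \<in> curve s \<longleftrightarrow> p \<in> N \<and> H p = s\<^sup>2" if s: "0 < s" "s < \<delta>"
proof
  assume "p \<in> curve s"
  then show "p \<in> N \<and> H p = s\<^sup>2"
    using R_bounds[OF s] H_R s by (auto simp: curve_def ray_in_N less_imp_le)
next
  assume p: "p \<in> N \<and> H p = s\<^sup>2"
  then obtain t \<theta> where "p = ray t \<theta>" "0 \<le> t" "t < 4 * \<delta>" using N_cases by blast
  then show "p \<in> curve s" using H_ray_compare(2)[of t s \<theta>] p s by (auto simp: curve_def)
qed

lemma R_cong: "cis \<theta> = cis \<theta>' \<Longrightarrow> 0 < s \<Longrightarrow> s < \<delta> \<Longrightarrow> R s \<theta> = R s \<theta>'"
  using H_R[of s \<theta>] H_ray_compare(2)[of "R s \<theta>" s \<theta>'] R_bounds[of s \<theta>] ray_cong[of \<theta> \<theta>' "R s \<theta>"]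
  by simp

lemma continuous_R: "\<bar>s\<bar> < \<sigma> \<Longrightarrow> continuous_on A (R s)"
  unfolding R_def[abs_def] by (intro continuous_intros continuous_V)

definition sublevel where "sublevel s = {p \<in> N. H p < s\<^sup>2}"

text \<open>The region is star-shaped along the rays, which exhibits it as the image of a rectangle;
  compactness is derived from this.\<close>

lemma sublevel_curve_eq:
  assumes s: "0 < s" "s < \<delta>"
  shows "sublevel s \<union> curve s = (\<lambda>(u, \<theta>). ray (u * R s \<theta>) \<theta>) ` ({0..1} \<times> {-pi..pi})"
proof (intro equalityI subsetI)
  fix p assume p: "p \<in> sublevel s \<union> curve s"
  then have "p \<in> N" "H p \<le> s\<^sup>2" by (auto simp: sublevel_def curve_iff[OF s])
  then obtain t \<theta> where t: "p = ray t \<theta>" "0 \<le> t" "t < 4 * \<delta>" "-pi \<le> \<theta>" "\<theta> \<le> pi" using N_cases by blast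
  have "t \<le> R s \<theta>" using H_ray_compare[of t s \<theta>] t s \<open>H p \<le> s\<^sup>2\<close> by force
  then show "p \<in> (\<lambda>(u, \<theta>). ray (u * R s \<theta>) \<theta>) ` ({0..1} \<times> {-pi..pi})"
    using t R_bounds(1)[OF s, of \<theta>] by (intro image_eqI[of _ _ "(t / R s \<theta>, \<theta>)"]) auto
next
  fix p assume "p \<in> (\<lambda>(u, \<theta>). ray (u * R s \<theta>) \<theta>) ` ({0..1} \<times> {-pi..pi})"
  then obtain u \<theta> where p: "p = ray (u * R s \<theta>) \<theta>" "0 \<le> u" "u \<le> 1" by auto
  have "0 \<le> u * R s \<theta>" "u * R s \<theta> \<le> R s \<theta>"
    using p R_bounds(1)[OF s, of \<theta>] by (auto simp: mult_left_le_one_le)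
  then show "p \<in> sublevel s \<union> curve s"
    using H_ray_compare[of "u * R s \<theta>" s \<theta>] R_bounds(3)[OF s, of \<theta>] s p
    by (auto simp: sublevel_def curve_iff[OF s] ray_in_N)
qed

lemma compact_sublevel_curve:
  assumes s: "0 < s" "s < \<sigma>"
  shows "compact (sublevel s \<union> curve s)"
proof -
  have "\<bar>s\<bar> < \<sigma>" "s < \<delta>" using s \<sigma> by auto
  have "continuous_on ({0..1} \<times> {-pi..pi}) (\<lambda>z. R s (snd z))"
    by (rule continuous_on_compose2[OF continuous_R[OF \<open>\<bar>s\<bar> < \<sigma>\<close>, of UNIV]]) (auto intro: continuous_intros)
  then have "continuous_on ({0..1} \<times> {-pi..pi}) (\<lambda>(u, \<theta>). ray (u * R s \<theta>) \<theta>)"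
    unfolding case_prod_unfold ray_def e1_def e2_def by (intro continuous_intros)
  then show ?thesis
    unfolding sublevel_curve_eq[OF s(1) \<open>s < \<delta>\<close>]
    by (rule compact_continuous_image) (intro compact_Times compact_Icc)
qed

lemma open_sublevel: "open (sublevel s)"
proof -
  have "sublevel s = N \<inter> H -` {..<s\<^sup>2}" by (auto simp: sublevel_def)
  then show ?thesis using continuous_open_preimage[OF continuous_H open_N, of "{..<s\<^sup>2}"] by simp
qed

lemma closed_curve: "0 < s \<Longrightarrow> s < \<sigma> \<Longrightarrow> closed (curve s)"
proof -
  assume s: "0 < s" "s < \<sigma>"
  have "curve s = (sublevel s \<union> curve s) - sublevel s"
    using s \<sigma> by (auto simp: sublevel_def curve_iff)
  then show ?thesis
    using compact_imp_closed[OF compact_sublevel_curve[OF s]] open_sublevel[of s] closed_Diff by metis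
qed

text \<open>The complement of the curve splits into two open sets, the sublevel set and the exterior
  \<open>F\<close>. A component meeting the first is trapped in a compact set. From a point of the
  second the outward ray stays in \<open>F\<close>, so its component is unbounded.\<close>

lemma inside_curve:
  assumes s: "0 < s" "s < \<sigma>"
  shows "inside (curve s) = sublevel s"
proof -
  have s': "s < \<delta>" using s \<sigma> by simp
  define F where "F = - (sublevel s \<union> curve s)"
  have "open F"
    unfolding F_def by (rule open_Compl[OF compact_imp_closed[OF compact_sublevel_curve[OF s]]])
  then have F: "open F" "sublevel s \<inter> F = {}" "- curve s \<subseteq> sublevel s \<union> F"
    by (auto simp: F_def)
  have disj: "sublevel s \<inter> curve s = {}" by (auto simp: sublevel_def curve_iff[OF s(1) s'])
  have 1: "x \<in> inside (curve s)" if x: "x \<in> sublevel s" for x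
  proof -
    let ?T = "connected_component_set (- curve s) x"
    have "x \<in> ?T" using x disj by auto
    moreover have "connected ?T" "?T \<subseteq> sublevel s \<union> F"
      using connected_component_subset[of "- curve s" x] F(3) by auto
    ultimately have "F \<inter> ?T = {}"
      using connectedD[of ?T "sublevel s" F] open_sublevel F x by blast
    then have "?T \<subseteq> sublevel s \<union> curve s" using \<open>?T \<subseteq> sublevel s \<union> F\<close> by blast
    then have "bounded ?T" using compact_imp_bounded[OF compact_sublevel_curve[OF s]] bounded_subset by blast
    then show ?thesis using x disj by (auto simp: inside_def)
  qed
  have 2: "x \<notin> inside (curve s)" if x: "x \<in> F" for x
  proof
    assume "x \<in> inside (curve s)"
    then have bd: "bounded (connected_component_set (- curve s) x)" by (simp add: inside_def)
    define t \<theta> where "t = norm (\<zeta> x)" and "\<theta> = Arg (\<zeta> x)"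
    have xt: "x = ray t \<theta>" unfolding t_def \<theta>_def by (rule ray_polar)
    have F_iff: "ray u \<theta> \<in> F \<longleftrightarrow> R s \<theta> < u" if "0 \<le> u" for u
    proof (cases "u < 4 * \<delta>")
      case True
      then show ?thesis
        using H_ray_compare[of u s \<theta>] that s s' by (auto simp: F_def sublevel_def curve_iff ray_in_N)
    next
      case False
      then show ?thesis
        using R_bounds(3)[OF s(1) s', of \<theta>] s s' that by (auto simp: F_def sublevel_def curve_iff ray_in_N)
    qed
    have t0: "0 \<le> t" by (simp add: t_def)
    have "ray t \<theta> \<in> F" using x unfolding xt[symmetric] .
    then have "R s \<theta> < t" unfolding F_iff[OF t0] .
    let ?ray = "(\<lambda>u. ray u \<theta>) ` {t..}"
    have "connected ?ray"
      unfolding ray_def by (intro connected_continuous_image continuous_intros) simp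
    moreover have "x \<in> ?ray" using xt by auto
    moreover have "?ray \<subseteq> - curve s"
    proof
      fix y assume "y \<in> ?ray"
      then obtain u where u: "y = ray u \<theta>" "t \<le> u" by auto
      then have "y \<in> F" using F_iff[of u] \<open>R s \<theta> < t\<close> t0 by simp
      then show "y \<in> - curve s" by (simp add: F_def)
    qed
    ultimately have "?ray \<subseteq> connected_component_set (- curve s) x"
      by (intro connected_component_maximal)
    then have "bounded (\<zeta> ` ?ray)"
      using bd bounded_subset bounded_linear_image bounded_linear_\<zeta> by metis
    then obtain b where b: "\<And>u. t \<le> u \<Longrightarrow> norm (\<zeta> (ray u \<theta>)) \<le> b"
      by (auto simp: bounded_iff)
    have "\<bar>max t (\<bar>b\<bar> + 1)\<bar> \<le> b" using b[of "max t (\<bar>b\<bar> + 1)"] by (simp only: norm_\<zeta>_ray max.cobounded1)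
    then show False by linarith
  qed
  show ?thesis
  proof (intro equalityI subsetI)
    fix x assume x: "x \<in> inside (curve s)"
    then have "x \<notin> curve s" using inside_no_overlap[of "curve s"] by blast
    moreover have "x \<notin> F" using x 2 by blast
    ultimately show "x \<in> sublevel s" unfolding F_def by blast
  qed (rule 1)
qed

section \<open>The motion on a level curve\<close>

text \<open>The times spent on the curve form a clopen subset of the line. Closedness is that of the
  curve; for openness, the solution stays in \<open>N\<close> for a short while, where
  \<open>H\<close> is differentiable and hence conserved.\<close>

lemma solution_stays_on_curve:
  assumes s: "0 < s" "s < \<sigma>" and \<phi>: "solution_in (hamiltonian_field H) U \<phi>" and 0: "\<phi> 0 \<in> curve s"
  shows "\<phi> t \<in> curve s"
proof -
  have s': "s < \<delta>" using s \<sigma> by simp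
  have d: "(\<phi> has_vector_derivative hamiltonian_field H (\<phi> t)) (at t)" for t
    using \<phi> by (simp add: solution_in_def)
  have cont: "continuous_on UNIV \<phi>"
    using d has_vector_derivative_continuous by (intro continuous_at_imp_continuous_on) blast
  let ?S = "{t. \<phi> t \<in> curve s}"
  have S1: "closed ?S"
    using continuous_closed_vimage[OF closed_curve[OF s], of \<phi>] cont
    by (simp add: vimage_def continuous_on_eq_continuous_at)
  have S2: "open ?S"
    unfolding open_contains_ball
  proof
    fix t assume t: "t \<in> ?S"
    have "open (\<phi> -` N)" using continuous_open_vimage[OF open_N, of \<phi>] cont by (simp add: continuous_on_eq_continuous_at)
    moreover have "t \<in> \<phi> -` N" using t by (simp add: curve_iff[OF s(1) s'])
    ultimately obtain e where e: "0 < e" "ball t e \<subseteq> \<phi> -` N" by (meson open_contains_ball)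
    have "\<exists>c. \<forall>u\<in>ball t e. H (\<phi> u) = c"
    proof (rule has_derivative_zero_constant)
      fix u assume "u \<in> ball t e"
      then have u: "\<phi> u \<in> N" using e by auto
      have "((\<lambda>u. H (\<phi> u)) has_derivative (\<lambda>v. (\<lambda>(x, y). x * partial_x H (\<phi> u) + y * partial_y H (\<phi> u))
          (v *\<^sub>R hamiltonian_field H (\<phi> u)))) (at u)"
        by (rule has_derivative_compose[where f = \<phi> and g = H, OF _ H_has_derivative[OF u]])
          (use d[of u] in \<open>simp add: has_vector_derivative_def\<close>)
      then have "((\<lambda>u. H (\<phi> u)) has_derivative (\<lambda>h. 0)) (at u)"
        by (rule has_derivative_eq_rhs) (simp add: hamiltonian_field_def fun_eq_iff)
      then show "((\<lambda>u. H (\<phi> u)) has_derivative (\<lambda>h. 0)) (at u within ball t e)"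
        by (rule has_derivative_at_withinI)
    qed simp
    then obtain c where c: "\<And>u. u \<in> ball t e \<Longrightarrow> H (\<phi> u) = c" by blast
    have "c = s\<^sup>2" using c[of t] t e(1) by (simp add: curve_iff[OF s(1) s'])
    then have "ball t e \<subseteq> ?S" using c e by (auto simp: curve_iff[OF s(1) s'])
    then show "\<exists>e>0. ball t e \<subseteq> ?S" using e(1) by blast
  qed
  have "?S = {} \<or> ?S = UNIV" by (rule clopen[THEN iffD1, OF conjI[OF S1 S2]])
  moreover have "0 \<in> ?S" using 0 by simp
  ultimately have "t \<in> ?S" by auto
  then show ?thesis by simp
qed

text \<open>The lift \<open>g\<close> is only assumed continuous. Near \<open>t\<close> its
  imaginary part moves by less than \<pi>, so there it coincides with the principal logarithm of
  \<open>z u / z t\<close> shifted by \<open>g t\<close>, and that can be differentiated.\<close>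

lemma has_vector_derivative_logarithm:
  fixes z g :: "real \<Rightarrow> complex"
  assumes g: "isCont g t" and z: "(z has_vector_derivative z') (at t)" and eq: "\<And>t. z t = exp (g t)"
  shows "(g has_vector_derivative z' / z t) (at t)"
proof -
  have "((\<lambda>u. z u / z t) has_vector_derivative z' / z t) (at t)"
    using z by (rule has_vector_derivative_divide)
  moreover have "(Ln has_field_derivative inverse (z t / z t)) (at (z t / z t))"
    by (rule has_field_derivative_Ln) (simp add: eq)
  ultimately have "(Ln \<circ> (\<lambda>u. z u / z t) has_vector_derivative z' / z t * inverse (z t / z t)) (at t)"
    by (rule field_vector_diff_chain_at)
  then have "((\<lambda>u. Ln (z u / z t) + g t) has_vector_derivative z' / z t) (at t)"
    by (auto simp: o_def eq intro!: derivative_eq_intros)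
  moreover have "\<forall>\<^sub>F u in nhds t. Ln (z u / z t) + g t = g u"
  proof -
    have "(\<lambda>u. \<bar>Im (g u) - Im (g t)\<bar>) \<midarrow>t\<rightarrow> \<bar>Im (g t) - Im (g t)\<bar>"
      by (intro tendsto_intros isContD g)
    then have "\<forall>\<^sub>F u in at t. \<bar>Im (g u) - Im (g t)\<bar> < pi"
      by (rule order_tendstoD(2)) simp
    then have "\<forall>\<^sub>F u in nhds t. \<bar>Im (g u) - Im (g t)\<bar> < pi"
      by (auto simp: eventually_nhds_conv_at)
    then show ?thesis
      by eventually_elim (simp add: eq flip: exp_diff)
  qed
  then obtain S where "open S" "t \<in> S" "\<And>u. u \<in> S \<Longrightarrow> Ln (z u / z t) + g t = g u"
    unfolding eventually_nhds by blast
  ultimately show ?thesis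
    by (rule has_vector_derivative_transform_within_open)
qed

text \<open>The angle is the imaginary part of a continuous logarithm of the solution in frame
  coordinates, defined for all times. Its derivative is the imaginary part of the logarithmic
  derivative and depends on the angle alone, because the radius is tied to it by the level
  equation.\<close>

lemma solution_angle:
  assumes s: "0 < s" "s < \<sigma>" and \<phi>: "solution_in (hamiltonian_field H) U \<phi>" and 0: "\<phi> 0 \<in> curve s"
  obtains \<theta> where "\<And>t. \<phi> t = ray (R s (\<theta> t)) (\<theta> t)"
    "\<And>t. (\<theta> has_real_derivative Hr (R s (\<theta> t)) (\<theta> t) / (J * R s (\<theta> t))) (at t)"
proof -
  have s': "s < \<delta>" using s \<sigma> by simp
  have d: "(\<phi> has_vector_derivative hamiltonian_field H (\<phi> t)) (at t)" for t
    using \<phi> by (simp add: solution_in_def)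
  have dz: "((\<lambda>t. \<zeta> (\<phi> t)) has_vector_derivative \<zeta> (hamiltonian_field H (\<phi> t))) (at t)" for t
    using bounded_linear.has_vector_derivative[OF bounded_linear_\<zeta> d] .
  have on: "\<phi> t \<in> curve s" for t by (rule solution_stays_on_curve[OF s \<phi> 0])
  have nz: "\<zeta> (\<phi> t) \<noteq> 0" for t
  proof -
    obtain \<theta> where "\<phi> t = ray (R s \<theta>) \<theta>" using on[of t] by (auto simp: curve_def)
    then show ?thesis using R_bounds(1)[OF s(1) s', of \<theta>] by (simp add: \<zeta>_ray)
  qed
  have "continuous_on UNIV (\<lambda>t. \<zeta> (\<phi> t))"
    using dz has_vector_derivative_continuous by (intro continuous_at_imp_continuous_on) blast
  then obtain g where g: "continuous_on UNIV g" "\<And>t. \<zeta> (\<phi> t) = exp (g t)"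
    using continuous_logarithm_on_contractible[of UNIV "\<lambda>t. \<zeta> (\<phi> t)"] nz
    by (metis UNIV_I convex_UNIV convex_imp_contractible)
  have dg: "(g has_vector_derivative \<zeta> (hamiltonian_field H (\<phi> t)) / \<zeta> (\<phi> t)) (at t)" for t
    using has_vector_derivative_logarithm[OF _ dz g(2)] g(1) by (simp add: continuous_on_eq_continuous_at)
  define \<theta> where "\<theta> t = Im (g t)" for t
  have \<phi>_eq: "\<phi> t = ray (R s (\<theta> t)) (\<theta> t)" for t
  proof -
    have "\<zeta> (\<phi> t) = of_real (exp (Re (g t))) * cis (\<theta> t)"
      unfolding g(2) \<theta>_def by (simp add: exp_eq_polar)
    then have *: "\<phi> t = ray (exp (Re (g t))) (\<theta> t)" by (rule ray_\<zeta>)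
    \<comment> \<open>The radius found from the logarithm lies on the level \<open>s^2\<close>, and
      the ray meets that level only at \<open>R s\<close>.\<close>
    then show ?thesis
      using on[of t] H_ray_compare(2)[of "exp (Re (g t))" s "\<theta> t"] s s'
      by (auto simp: curve_iff ray_in_N)
  qed
  have "(\<theta> has_real_derivative Hr (R s (\<theta> t)) (\<theta> t) / (J * R s (\<theta> t))) (at t)" for t
  proof -
    define x y where "x = partial_x H (\<phi> t)" and "y = partial_y H (\<phi> t)"
    have R: "0 < R s (\<theta> t)" by (rule R_bounds(1)[OF s(1) s'])
    have "Im (\<zeta> (hamiltonian_field H (\<phi> t)) / \<zeta> (\<phi> t)) = Im (\<zeta> (- y, x) * cis (- \<theta> t)) / R s (\<theta> t)"
    proof -
      have "\<zeta> (\<phi> t) = of_real (R s (\<theta> t)) * cis (\<theta> t)" by (subst \<phi>_eq) (rule \<zeta>_ray)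
      then have "\<zeta> (hamiltonian_field H (\<phi> t)) / \<zeta> (\<phi> t) = (\<zeta> (- y, x) * cis (- \<theta> t)) / of_real (R s (\<theta> t))"
        by (simp add: hamiltonian_field_def x_def y_def divide_inverse cis_inverse mult_ac)
      then show ?thesis by (simp only: Im_divide_of_real)
    qed
    \<comment> \<open>Turning the field by a right angle exchanges the angular part of the field
      with the radial derivative of \<open>H\<close>; the determinant of the frame remains as
      denominator.\<close>
    also have "Im (\<zeta> (- y, x) * cis (- \<theta> t)) = (e1 (\<theta> t) * x + e2 (\<theta> t) * y) / J"
      using \<alpha>_pos \<gamma>_pos by (simp add: \<zeta>_def J_eq e1_def e2_def field_simps)
    also have "e1 (\<theta> t) * x + e2 (\<theta> t) * y = Hr (R s (\<theta> t)) (\<theta> t)"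
      by (simp add: Hr_def x_def y_def \<phi>_eq[symmetric])
    finally have "Im (\<zeta> (hamiltonian_field H (\<phi> t)) / \<zeta> (\<phi> t)) = Hr (R s (\<theta> t)) (\<theta> t) / (J * R s (\<theta> t))"
      by simp
    then show ?thesis
      using bounded_linear.has_vector_derivative[OF bounded_linear_Im dg[of t]]
      by (simp add: \<theta>_def[abs_def] has_real_derivative_iff_has_vector_derivative)
  qed
  with \<phi>_eq show ?thesis by (rule that)
qed

text \<open>The reciprocal of the angular velocity is a positive function of the angle alone, so its
  antiderivative is the time at which an angle is reached, up to a constant.\<close>

lemma time_of:
  assumes s: "0 < s" "s < \<sigma>"
  obtains \<tau> where "\<And>\<theta>. (\<tau> has_real_derivative J * R s \<theta> / Hr (R s \<theta>) \<theta>) (at \<theta>)"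
    "strict_mono \<tau>" "\<And>\<theta>. \<tau> (\<theta> + 2 * pi) = \<tau> \<theta> + eval_fps period_fps (s\<^sup>2)"
proof -
  have s': "\<bar>s\<bar> < \<sigma>" "s < \<delta>" using s \<sigma> by auto
  define p where "p \<theta> = J * R s \<theta> / Hr (R s \<theta>) \<theta>" for \<theta>
  have p_D: "p \<theta> = J / 4 * D s \<theta>" for \<theta> unfolding p_def by (rule R_deriv[OF s])
  have p_cont: "continuous_on {x..y} p" for x y
    unfolding p_D[abs_def] by (intro continuous_intros D_integral(1) s')
  have p_pos: "0 < p \<theta>" for \<theta>
  proof -
    have "0 < R s \<theta>" "R s \<theta> < 4 * \<delta>" using R_bounds[OF s(1) s'(2)] by blast+
    then show ?thesis using Hr_ge[of "R s \<theta>" \<theta>] J_pos by (simp add: p_def)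
  qed
  have p_periodic: "p (\<theta> + 2 * pi) = p \<theta>" for \<theta>
  proof -
    have c: "cis (\<theta> + 2 * pi) = cis \<theta>" by (simp add: cis_divide[symmetric] flip: cis_mult)
    have "e1 (\<theta> + 2 * pi) = e1 \<theta>" "e2 (\<theta> + 2 * pi) = e2 \<theta>" by (simp_all add: e1_def e2_def)
    then show ?thesis using R_cong[OF c s(1) s'(2)] by (simp add: p_def Hr_def ray_def)
  qed
  have "\<exists>\<tau>. \<forall>x. - \<infinity> < ereal x \<longrightarrow> ereal x < \<infinity> \<longrightarrow> (\<tau> has_vector_derivative p x) (at x)"
  proof (rule einterval_antiderivative)
    fix x :: real
    have "continuous_on {x - 1<..<x + 1} p" by (rule continuous_on_subset[OF p_cont[of "x - 1" "x + 1"]]) auto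
    then show "isCont p x" by (subst (asm) continuous_on_eq_continuous_at) auto
  qed simp
  then obtain \<tau> where \<tau>: "\<And>x. (\<tau> has_real_derivative p x) (at x)"
    by (auto simp: has_real_derivative_iff_has_vector_derivative)
  have mono: "strict_mono \<tau>"
  proof (rule strict_monoI)
    fix x y :: real assume "x < y"
    then show "\<tau> x < \<tau> y" by (rule DERIV_pos_imp_increasing) (use \<tau> p_pos in blast)
  qed
  have "(p has_integral (\<tau> (2 * pi) - \<tau> 0)) {0..2 * pi}"
    by (rule fundamental_theorem_of_calculus)
      (use \<tau> in \<open>auto simp: has_real_derivative_iff_has_vector_derivative intro: has_vector_derivative_at_within\<close>)
  then have "\<tau> (2 * pi) - \<tau> 0 = eval_fps period_fps (s\<^sup>2)"
    using period_integral[OF s] has_integral_unique unfolding p_def by blast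
  \<comment> \<open>The integrand has period 2 \<pi>, so the increment over a full turn has
    derivative 0 and equals the one from 0.\<close>
  moreover have "\<tau> (\<theta> + 2 * pi) - \<tau> \<theta> = \<tau> (0 + 2 * pi) - \<tau> 0" for \<theta>
  proof -
    have "((\<lambda>x. \<tau> (x + 2 * pi) - \<tau> x) has_real_derivative 0) (at x)" for x
      using DERIV_diff[OF DERIV_shift[THEN iffD1, OF \<tau>[of "x + 2 * pi"]] \<tau>[of x]] p_periodic[of x] by simp
    then show ?thesis
      using DERIV_isconst_all[of "\<lambda>x. \<tau> (x + 2 * pi) - \<tau> x" \<theta> 0] by blast
  qed
  ultimately have "\<tau> (\<theta> + 2 * pi) = \<tau> \<theta> + eval_fps period_fps (s\<^sup>2)" for \<theta>
    by (smt (verit) add_0)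
  with \<tau> mono show ?thesis by (intro that) (simp_all add: p_def)
qed

lemma cis_eq_imp_between:
  assumes "cis x = cis y" "x < y"
  shows "x + 2 * pi \<le> y"
proof -
  have "cis (y - x) = 1" using assms(1) by (simp flip: cis_divide)
  then have "cos (y - x) = 1" by (metis cis.simps(1) one_complex.simps(1))
  then obtain n :: int where n: "y - x = n * 2 * pi" by (auto simp: cos_one_2pi_int)
  have "0 < y - x" using assms(2) by simp
  then have "0 < n" unfolding n by (simp add: zero_less_mult_iff)
  then have "1 * (2 * pi) \<le> real_of_int n * (2 * pi)" by (intro mult_right_mono) auto
  then show ?thesis using n by linarith
qed

text \<open>\<open>\<tau> (\<theta> t) - t\<close> is constant, so the angle is the inverse of
  \<open>\<tau>\<close> up to a shift of time and advances by 2 \<pi> exactly when the time advances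
  by \<open>T\<close>. An earlier return would need an advance by a smaller positive multiple of 2
  \<pi>. The argument applies to every solution starting on the curve.\<close>

theorem orbit_on_curve:
  assumes s: "0 < s" "s < \<sigma>" and \<phi>: "solution_in (hamiltonian_field H) U \<phi>" and 0: "\<phi> 0 \<in> curve s"
  shows "minimal_period \<phi> = eval_fps period_fps (s\<^sup>2)" "range \<phi> = curve s"
proof -
  have s': "s < \<delta>" using s \<sigma> by simp
  define T where "T = eval_fps period_fps (s\<^sup>2)"
  obtain \<tau> where \<tau>: "\<And>\<theta>. (\<tau> has_real_derivative J * R s \<theta> / Hr (R s \<theta>) \<theta>) (at \<theta>)"
    "strict_mono \<tau>" "\<And>\<theta>. \<tau> (\<theta> + 2 * pi) = \<tau> \<theta> + T"
    using time_of[OF s] unfolding T_def by metis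
  obtain \<theta> where \<theta>: "\<And>t. \<phi> t = ray (R s (\<theta> t)) (\<theta> t)"
    "\<And>t. (\<theta> has_real_derivative Hr (R s (\<theta> t)) (\<theta> t) / (J * R s (\<theta> t))) (at t)"
    using solution_angle[OF s \<phi> 0] by metis
  have R: "0 < R s x" "0 < Hr (R s x) x" for x
    using R_bounds[OF s(1) s', of x] Hr_ge[of "R s x" x] by auto
  have "((\<lambda>t. \<tau> (\<theta> t) - t) has_real_derivative 0) (at t)" for t
  proof -
    have "Hr (R s (\<theta> t)) (\<theta> t) \<noteq> 0" "R s (\<theta> t) \<noteq> 0" "J \<noteq> 0"
      using R[of "\<theta> t"] J_pos by simp_all
    then show ?thesis
      using DERIV_diff[OF DERIV_chain2[OF \<tau>(1) \<theta>(2)[of t]] DERIV_ident] by simp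
  qed
  then have \<tau>\<theta>: "\<tau> (\<theta> t) = \<tau> (\<theta> 0) + t" for t
    using DERIV_isconst_all[of "\<lambda>t. \<tau> (\<theta> t) - t" t 0] by simp
  have T: "0 < T" using \<tau>(3)[of 0] strict_monoD[OF \<tau>(2), of 0 "0 + 2 * pi"] by simp
  have shift: "\<theta> (t + T) = \<theta> t + 2 * pi" for t
  proof -
    have "\<tau> (\<theta> (t + T)) = \<tau> (\<theta> t + 2 * pi)" using \<tau>\<theta>[of "t + T"] \<tau>\<theta>[of t] \<tau>(3)[of "\<theta> t"] by simp
    then show ?thesis using strict_mono_eq[OF \<tau>(2)] by simp
  qed
  have mono: "strict_mono \<theta>"
  proof (rule strict_monoI)
    fix x y :: real assume "x < y"
    then have "\<tau> (\<theta> x) < \<tau> (\<theta> y)" using \<tau>\<theta>[of x] \<tau>\<theta>[of y] by simp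
    then show "\<theta> x < \<theta> y" using strict_mono_less[OF \<tau>(2)] by simp
  qed
  have periodic: "ray (R s (x + 2 * pi)) (x + 2 * pi) = ray (R s x) x" for x
  proof -
    have "cis (x + 2 * pi) = cis x" by (simp flip: cis_mult)
    then show ?thesis using R_cong[OF _ s(1) s'] ray_cong by metis
  qed
  have T_le: "T \<le> u" if "0 < u" "\<phi> (0 + u) = \<phi> 0" for u
  proof -
    have "\<zeta> (\<phi> u) = \<zeta> (\<phi> 0)" using that by simp
    then have z: "of_real (R s (\<theta> u)) * cis (\<theta> u) = of_real (R s (\<theta> 0)) * cis (\<theta> 0)"
      unfolding \<theta>(1) \<zeta>_ray .
    then have "norm (of_real (R s (\<theta> u)) * cis (\<theta> u)) = norm (of_real (R s (\<theta> 0)) * cis (\<theta> 0))" by simp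
    then have "R s (\<theta> u) = R s (\<theta> 0)" using R(1)[of "\<theta> u"] R(1)[of "\<theta> 0"] by (simp add: norm_mult)
    then have "cis (\<theta> u) = cis (\<theta> 0)" using z R(1)[of "\<theta> 0"] by simp
    then have "\<theta> 0 + 2 * pi \<le> \<theta> u"
      using cis_eq_imp_between[of "\<theta> 0" "\<theta> u"] strict_monoD[OF mono that(1)] by simp
    then have "\<theta> (0 + T) \<le> \<theta> u" using shift[of 0] by simp
    then show ?thesis using strict_mono_less_eq[OF mono] by simp
  qed
  show "minimal_period \<phi> = eval_fps period_fps (s\<^sup>2)"
    unfolding minimal_period_def T_def[symmetric]
  proof (rule Least_equality)
    show "0 < T \<and> (\<forall>t. \<phi> (t + T) = \<phi> t)" using T by (simp add: \<theta>(1) shift periodic)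
    show "T \<le> u" if "0 < u \<and> (\<forall>t. \<phi> (t + u) = \<phi> t)" for u using T_le[of u] that by blast
  qed
  show "range \<phi> = curve s"
  proof
    show "range \<phi> \<subseteq> curve s" using \<theta>(1) by (auto simp: curve_def)
    show "curve s \<subseteq> range \<phi>"
    proof
      fix p assume "p \<in> curve s"
      then obtain x where x: "p = ray (R s x) x" by (auto simp: curve_def)
      \<comment> \<open>The representative of \<open>x\<close> modulo 2 \<pi> in the range swept
        during one period, so that the intermediate value theorem finds a time for it.\<close>
      define y where "y = x - of_int \<lfloor>(x - \<theta> 0) / (2 * pi)\<rfloor> * (2 * pi)"
      have "of_int \<lfloor>(x - \<theta> 0) / (2 * pi)\<rfloor> * (2 * pi) \<le> x - \<theta> 0"
        "x - \<theta> 0 \<le> (of_int \<lfloor>(x - \<theta> 0) / (2 * pi)\<rfloor> + 1) * (2 * pi)"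
        using of_int_floor_le[of "(x - \<theta> 0) / (2 * pi)"] real_of_int_floor_add_one_ge[of "(x - \<theta> 0) / (2 * pi)"]
        by (simp_all only: pos_le_divide_eq pos_divide_le_eq pi_gt_zero mult_pos_pos zero_less_numeral)
      then have y: "\<theta> 0 \<le> y" "y \<le> \<theta> T"
        using shift[of 0] by (simp_all add: y_def algebra_simps)
      have "continuous_on {0..T} \<theta>"
        using \<theta>(2) DERIV_isCont by (intro continuous_at_imp_continuous_on) blast
      then obtain t where t: "\<theta> t = y"
        using IVT'[of \<theta> 0 y T] y T by (auto simp: less_imp_le)
      have "cis x = cis y"
        unfolding y_def by (simp add: complex_eq_iff cos_diff sin_diff mult.commute[of _ "2 * pi"]
            cos_int_2pin sin_int_2pin)
      then have "p = \<phi> t" unfolding x \<theta>(1) t using R_cong[OF _ s(1) s'] ray_cong by metis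
      then show "p \<in> range \<phi>" by blast
    qed
  qed
qed

end

section \<open>The area enclosed by a level curve\<close>

lemma Basis_real_2: "(Basis :: (real ^ 2) set) = {axis 1 1, axis 2 1}"
  by (auto simp: Basis_vec_def UNIV_2)

text \<open>The change of variables formula used for the area concerns \<open>real ^ 2\<close>,
  whereas the area function measures subsets of \<open>real \<times> real\<close>. Agreement on
  boxes identifies the two measures.\<close>

lemma distr_lborel_vec_2: "distr lborel borel (\<lambda>v :: real ^ 2. (vec_nth v 1, vec_nth v 2)) = lborel"
proof (rule lborel_eqI[symmetric])
  fix l u :: "real \<times> real"
  assume "\<And>b. b \<in> Basis \<Longrightarrow> l \<bullet> b \<le> u \<bullet> b"
  from this[of "(1, 0)"] this[of "(0, 1)"] have lu: "fst l \<le> fst u" "snd l \<le> snd u"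
    by (auto simp: Basis_prod_def inner_prod_def)
  have "emeasure (distr lborel borel (\<lambda>v :: real ^ 2. (vec_nth v 1, vec_nth v 2))) (box l u)
      = emeasure lborel ((\<lambda>v :: real ^ 2. (vec_nth v 1, vec_nth v 2)) -` box l u \<inter> space lborel)"
    by (rule emeasure_distr) (auto intro!: borel_measurable_continuous_onI continuous_intros)
  also have "(\<lambda>v :: real ^ 2. (vec_nth v 1, vec_nth v 2)) -` box l u \<inter> space lborel
      = box (vector [fst l, snd l]) (vector [fst u, snd u])"
    by (auto simp: box_def Basis_real_2 Basis_prod_def inner_axis inner_prod_def)
  also have "emeasure lborel (box (vector [fst l, snd l]) (vector [fst u, snd u] :: real ^ 2))
      = (\<Prod>b\<in>Basis. (vector [fst u, snd u] - vector [fst l, snd l] :: real ^ 2) \<bullet> b)"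
    by (rule emeasure_lborel_box) (use lu in \<open>auto simp: Basis_real_2 inner_axis\<close>)
  also have "(\<Prod>b\<in>Basis. (vector [fst u, snd u] - vector [fst l, snd l] :: real ^ 2) \<bullet> b)
      = (fst u - fst l) * (snd u - snd l)"
    by (simp add: Basis_real_2 inner_axis axis_eq_axis)
  also have "\<dots> = (\<Prod>b\<in>Basis. (u - l) \<bullet> b)"
    by (simp add: Basis_prod_def inner_prod_def)
  finally show "emeasure (distr lborel borel (\<lambda>v :: real ^ 2. (vec_nth v 1, vec_nth v 2))) (box l u)
      = (\<Prod>b\<in>Basis. (u - l) \<bullet> b)" .
qed simp

lemma emeasure_lborel_vec_2:
  assumes "A \<in> sets borel"
  shows "emeasure lborel ((\<lambda>v :: real ^ 2. (vec_nth v 1, vec_nth v 2)) -` A) = emeasure lborel A"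
    "(\<lambda>v :: real ^ 2. (vec_nth v 1, vec_nth v 2)) -` A \<in> sets borel"
proof -
  have m: "(\<lambda>v :: real ^ 2. (vec_nth v 1, vec_nth v 2)) \<in> borel_measurable borel"
    by (auto intro!: borel_measurable_continuous_onI continuous_intros)
  show "(\<lambda>v :: real ^ 2. (vec_nth v 1, vec_nth v 2)) -` A \<in> sets borel"
    using measurable_sets[OF m assms] by simp
  have "emeasure lborel A = emeasure (distr lborel borel (\<lambda>v :: real ^ 2. (vec_nth v 1, vec_nth v 2))) A"
    by (simp only: distr_lborel_vec_2)
  also have "\<dots> = emeasure lborel ((\<lambda>v :: real ^ 2. (vec_nth v 1, vec_nth v 2)) -` A \<inter> space lborel)"
    by (rule emeasure_distr) (use m assms in auto)
  finally show "emeasure lborel ((\<lambda>v :: real ^ 2. (vec_nth v 1, vec_nth v 2)) -` A) = emeasure lborel A" by simp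
qed

lemma emeasure_under_graph:
  fixes f :: "real \<Rightarrow> real"
  assumes cont: "continuous_on UNIV f" and pos: "\<And>x. 0 < f x" and I: "(f has_integral I) {a..b}"
  shows "open {(w, x). a < x \<and> x < b \<and> 0 < w \<and> w < f x}"
    "emeasure lborel {(w, x). a < x \<and> x < b \<and> 0 < w \<and> w < f x} = ennreal I"
proof -
  let ?A = "{(w, x). a < x \<and> x < b \<and> 0 < w \<and> w < f x}"
  have "?A = {z. a < snd z} \<inter> {z. snd z < b} \<inter> {z. 0 < fst z} \<inter> {z. fst z < f (snd z)}" by auto
  also have "open \<dots>"
    by (intro open_Int open_Collect_less continuous_intros continuous_on_compose2[OF cont]) auto
  finally show op: "open ?A" .

  have "emeasure lborel ?A = emeasure (lborel \<Otimes>\<^sub>M lborel) ?A" by (simp add: lborel_prod)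
  also have "\<dots> = (\<integral>\<^sup>+x. emeasure lborel ((\<lambda>w. (w, x)) -` ?A) \<partial>lborel)"
  proof (rule lborel_pair.emeasure_pair_measure_alt2)
    show "?A \<in> sets (lborel \<Otimes>\<^sub>M lborel)" unfolding lborel_prod using op by simp
  qed
  also have "\<dots> = (\<integral>\<^sup>+x. ennreal (f x) * indicator {a<..<b} x \<partial>lborel)"
  proof (rule nn_integral_cong)
    fix x
    have "(\<lambda>w. (w, x)) -` ?A = (if a < x \<and> x < b then {0<..<f x} else {})" by auto
    then show "emeasure lborel ((\<lambda>w. (w, x)) -` ?A) = ennreal (f x) * indicator {a<..<b} x"
      using pos[of x] by (simp add: less_imp_le)
  qed
  also have "\<dots> = ennreal I"
  proof (rule nn_integral_has_integral_lebesgue')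
    show "(f has_integral I) {a<..<b}" using I by (simp add: has_integral_Icc_iff_Ioo)
  qed (use pos in \<open>simp add: less_imp_le\<close>)
  finally show "emeasure lborel ?A = ennreal I" .
qed

context morse_hamiltonian
begin

text \<open>\<open>polar (w, \<theta>) = ray t \<theta>\<close> with \<open>w = t\<^sup>2 / 2\<close>, which makes the Jacobian constant.\<close>

definition polar :: "real ^ 2 \<Rightarrow> real ^ 2" where
  "polar x = (sqrt (2 * vec_nth x 1) * e1 (vec_nth x 2)) *\<^sub>R axis 1 1 + (sqrt (2 * vec_nth x 1) * e2 (vec_nth x 2)) *\<^sub>R axis 2 1"

definition polar' :: "real ^ 2 \<Rightarrow> real ^ 2 \<Rightarrow> real ^ 2" where
  "polar' x h =
    (vec_nth h 1 / sqrt (2 * vec_nth x 1) * e1 (vec_nth x 2) + sqrt (2 * vec_nth x 1) * (- \<alpha> * sin (vec_nth x 2) * vec_nth h 2)) *\<^sub>R axis 1 1 +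
    (vec_nth h 1 / sqrt (2 * vec_nth x 1) * e2 (vec_nth x 2) + sqrt (2 * vec_nth x 1) * ((\<gamma> * cos (vec_nth x 2) - \<beta> * sin (vec_nth x 2)) * vec_nth h 2)) *\<^sub>R axis 2 1"

lemma polar_nth [simp]:
  "vec_nth (polar x) 1 = sqrt (2 * vec_nth x 1) * e1 (vec_nth x 2)" "vec_nth (polar x) 2 = sqrt (2 * vec_nth x 1) * e2 (vec_nth x 2)"
  by (simp_all add: polar_def axis_def)

lemma polar_has_derivative:
  assumes "0 < vec_nth x 1"
  shows "(polar has_derivative polar' x) (at x)"
proof -
  have n: "((\<lambda>x. vec_nth x i) has_derivative (\<lambda>h. vec_nth h i)) (at x)" for i :: 2
    by (rule bounded_linear_imp_has_derivative[OF bounded_linear_vec_nth])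
  have s: "((\<lambda>x. sqrt (2 * vec_nth x 1)) has_derivative (\<lambda>h. vec_nth h 1 / sqrt (2 * vec_nth x 1))) (at x)"
    using assms by (auto intro!: derivative_eq_intros n simp: fun_eq_iff field_simps)
  have 1: "((\<lambda>x. e1 (vec_nth x 2)) has_derivative (\<lambda>h. - \<alpha> * sin (vec_nth x 2) * vec_nth h 2)) (at x)"
    unfolding e1_def by (auto intro!: derivative_eq_intros n simp: fun_eq_iff)
  have 2: "((\<lambda>x. e2 (vec_nth x 2)) has_derivative (\<lambda>h. (\<gamma> * cos (vec_nth x 2) - \<beta> * sin (vec_nth x 2)) * vec_nth h 2)) (at x)"
    unfolding e2_def by (auto intro!: derivative_eq_intros n simp: fun_eq_iff algebra_simps)
  note has_derivative_add[OF
      bounded_linear.has_derivative[OF bounded_linear_scaleR_left has_derivative_mult[OF s 1], of "axis 1 1"]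
      bounded_linear.has_derivative[OF bounded_linear_scaleR_left has_derivative_mult[OF s 2], of "axis 2 1"]]
  then show ?thesis
    unfolding polar_def[abs_def]
    by (rule has_derivative_eq_rhs) (simp add: polar'_def fun_eq_iff add_ac mult_ac)
qed

lemma det_polar':
  assumes "0 < vec_nth x 1"
  shows "Determinants.det (matrix (polar' x)) = J"
proof -
  have "Determinants.det (matrix (polar' x)) =
      (e1 (vec_nth x 2) / sqrt (2 * vec_nth x 1)) * (sqrt (2 * vec_nth x 1) * (\<gamma> * cos (vec_nth x 2) - \<beta> * sin (vec_nth x 2)))
      - (sqrt (2 * vec_nth x 1) * (- \<alpha> * sin (vec_nth x 2))) * (e2 (vec_nth x 2) / sqrt (2 * vec_nth x 1))"
    by (simp add: Determinants.det_2 matrix_def polar'_def axis_def)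
  also have "\<dots> = e1 (vec_nth x 2) * (\<gamma> * cos (vec_nth x 2) - \<beta> * sin (vec_nth x 2)) + \<alpha> * sin (vec_nth x 2) * e2 (vec_nth x 2)"
    using assms by (simp add: field_simps)
  also have "\<dots> = \<alpha> * \<gamma> * ((cos (vec_nth x 2))\<^sup>2 + (sin (vec_nth x 2))\<^sup>2)"
  proof -
    have "\<alpha> * C * (\<gamma> * C - \<beta> * S) + \<alpha> * S * (\<beta> * C + \<gamma> * S) = \<alpha> * \<gamma> * (C\<^sup>2 + S\<^sup>2)" for C S
      by (simp add: power2_eq_square algebra_simps)
    then show ?thesis unfolding e1_def e2_def .
  qed
  also have "\<dots> = J" by (simp add: J_eq)
  finally show ?thesis .
qed

text \<open>\<open>polar\<close> maps the region \<open>S\<close> below the graph of R^2 / 2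
  injectively into the sublevel set with constant Jacobian \<open>J\<close>, and misses only points
  of one line. Hence the area is \<open>J\<close> times the area below the graph.\<close>

lemma measure_sublevel:
  assumes s: "0 < s" "s < \<sigma>"
  shows "measure lborel (sublevel s) = eval_fps area_fps (s\<^sup>2)"
proof -
  have s': "\<bar>s\<bar> < \<sigma>" "s < \<delta>" using s \<sigma> by auto
  define A where "A = eval_fps area_fps (s\<^sup>2)"
  define g where "g = (\<lambda>v :: real ^ 2. (vec_nth v 1, vec_nth v 2))"
  define S' where "S' = {(w, x). 0 < x \<and> x < 2 * pi \<and> 0 < w \<and> w < (R s x)\<^sup>2 / 2}"
  define S where "S = g -` S'"
  have S_iff: "v \<in> S \<longleftrightarrow> 0 < vec_nth v 2 \<and> vec_nth v 2 < 2 * pi \<and> 0 < vec_nth v 1 \<and> vec_nth v 1 < (R s (vec_nth v 2))\<^sup>2 / 2" for v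
    by (simp add: S_def S'_def g_def)
  have R: "0 < R s x" "R s x < 4 * \<delta>" for x using R_bounds[OF s(1) s'(2)] by auto
  have "((\<lambda>x. 1 / J * (J / 2 * (R s x)\<^sup>2)) has_integral 1 / J * A) {0..2 * pi}"
    unfolding A_def by (intro has_integral_mult_right area_integral s)
  then have I: "((\<lambda>x. (R s x)\<^sup>2 / 2) has_integral A / J) {0..2 * pi}"
    using J_pos by (simp add: field_simps)
  have A: "0 \<le> A / J" by (rule has_integral_nonneg[OF I]) simp
  have "continuous_on UNIV (\<lambda>x. (R s x)\<^sup>2 / 2)" by (intro continuous_intros continuous_R s') simp
  note G = emeasure_under_graph[OF this _ I, folded S'_def]
  have "open S'" "emeasure lborel S' = ennreal (A / J)"
    by (rule G; simp add: R(1) less_imp_neq[OF R(1), symmetric])+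
  then have S: "emeasure lborel S = ennreal (A / J)" "S \<in> sets borel"
    using emeasure_lborel_vec_2[of S'] by (simp_all add: S_def g_def)
  then have S_lm: "S \<in> lmeasurable"
    by (simp add: fmeasurable_def)
  have "measure lebesgue S = A / J"
    using S A by (simp add: measure_def)
  have "measure lebesgue (polar ` S) = integral S (\<lambda>x. \<bar>Determinants.det (matrix (polar' x))\<bar>)"
    and fS: "polar ` S \<in> lmeasurable"
  proof -
    have d: "(polar has_derivative polar' x) (at x within S)" if "x \<in> S" for x
      by (rule has_derivative_at_withinI[OF polar_has_derivative]) (use that in \<open>simp add: S_iff\<close>)
    have inj: "inj_on polar S"
    proof
      fix x y assume xy: "x \<in> S" "y \<in> S" "polar x = polar y"
      have "ray (sqrt (2 * vec_nth x 1)) (vec_nth x 2) = ray (sqrt (2 * vec_nth y 1)) (vec_nth y 2)"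
        using arg_cong[OF xy(3), of "\<lambda>v. (vec_nth v 1, vec_nth v 2)"] by (simp add: ray_def)
      from arg_cong[OF this, of \<zeta>]
      have z: "of_real (sqrt (2 * vec_nth x 1)) * cis (vec_nth x 2) = of_real (sqrt (2 * vec_nth y 1)) * cis (vec_nth y 2)"
        by (simp only: \<zeta>_ray)
      then have "norm (of_real (sqrt (2 * vec_nth x 1)) * cis (vec_nth x 2)) = norm (of_real (sqrt (2 * vec_nth y 1)) * cis (vec_nth y 2))"
        by simp
      then have 1: "vec_nth x 1 = vec_nth y 1" using xy(1,2) by (simp add: norm_mult S_iff)
      then have "cis (vec_nth x 2) = cis (vec_nth y 2)" using z xy(1) by (simp add: S_iff)
      then have "vec_nth x 2 = vec_nth y 2"
        using cis_eq_imp_between[of "vec_nth x 2" "vec_nth y 2"] cis_eq_imp_between[of "vec_nth y 2" "vec_nth x 2"] xy(1,2)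
        by (cases "vec_nth x 2" "vec_nth y 2" rule: linorder_cases) (auto simp: S_iff)
      with 1 show "x = y" by (simp add: Finite_Cartesian_Product.vec_eq_iff forall_2)
    qed
    have "(\<lambda>x. J *\<^sub>R (1 :: real)) integrable_on S"
      using S_lm by (intro integrable_cmul) (simp add: lmeasurable_iff_integrable_on)
    then have int: "(\<lambda>x. \<bar>Determinants.det (matrix (polar' x))\<bar>) integrable_on S"
      by (rule integrable_eq) (use det_polar' J_pos in \<open>simp add: S_iff\<close>)
    have S_leb: "S \<in> sets lebesgue" using S_lm by (rule fmeasurableD)
    show "measure lebesgue (polar ` S) = integral S (\<lambda>x. \<bar>Determinants.det (matrix (polar' x))\<bar>)"
      by (rule measure_differentiable_image_eq[OF S_leb d inj int])
    show "polar ` S \<in> lmeasurable"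
      using measurable_differentiable_image_eq[OF S_leb d inj, THEN iffD2, OF _ int] by simp
  qed
  note \<open>measure lebesgue (polar ` S) = integral S (\<lambda>x. \<bar>Determinants.det (matrix (polar' x))\<bar>)\<close>
  also have "integral S (\<lambda>x. \<bar>Determinants.det (matrix (polar' x))\<bar>) = integral S (\<lambda>x. J * 1)"
    by (rule integral_cong) (use det_polar' J_pos in \<open>simp add: S_iff\<close>)
  also have "\<dots> = J * measure lebesgue S"
    by (simp only: integral_mult_right lmeasure_integral[OF S_lm])
  also have "\<dots> = A" using \<open>measure lebesgue S = A / J\<close> J_pos by simp
  finally have area: "measure lebesgue (polar ` S) = A" .
  define E where "E = g -` sublevel s"
  have sub: "polar ` S \<subseteq> E"
  proof (clarsimp simp: E_def g_def)
    fix x assume x: "x \<in> S"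
    define t where "t = sqrt (2 * vec_nth x 1)"
    have t: "0 < t" "t < R s (vec_nth x 2)"
      using x R(1)[of "vec_nth x 2"] by (auto simp: S_iff t_def intro!: real_less_lsqrt)
    then have "H (ray t (vec_nth x 2)) < s\<^sup>2" "ray t (vec_nth x 2) \<in> N"
      using H_ray_compare(1)[of t s "vec_nth x 2"] R(2)[of "vec_nth x 2"] s s' by (auto simp: ray_in_N)
    then show "(sqrt (2 * vec_nth x 1) * e1 (vec_nth x 2), sqrt (2 * vec_nth x 1) * e2 (vec_nth x 2)) \<in> sublevel s"
      by (simp add: sublevel_def ray_def t_def)
  qed
  \<comment> \<open>The missed points are the origin and the ray at angle 0; both lie on the line
    spanned by (\<alpha>, \<beta>), whose normal is (\<beta>, - \<alpha>).\<close>
  have diff: "E - polar ` S \<subseteq> {v. vector [\<beta>, - \<alpha>] \<bullet> v = 0}"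
  proof
    fix v assume v: "v \<in> E - polar ` S"
    \<comment> \<open>\<open>Arg2pi\<close> takes values from 0 up to, but excluding, 2 \<pi>,
      matching the strip over which \<open>S\<close> is defined.\<close>
    define t \<theta> where "t = norm (\<zeta> (g v))" and "\<theta> = Arg2pi (\<zeta> (g v))"
    have "\<zeta> (g v) = of_real t * cis \<theta>"
      unfolding t_def \<theta>_def using Arg2pi_eq[of "\<zeta> (g v)"] by (simp add: cis_conv_exp mult.commute)
    then have gv: "g v = ray t \<theta>" by (rule ray_\<zeta>)
    have t\<theta>: "0 \<le> t" "0 \<le> \<theta>" "\<theta> < 2 * pi"
      using Arg2pi_ge_0 Arg2pi_lt_2pi by (simp_all add: t_def \<theta>_def)
    have "ray t \<theta> \<in> sublevel s" using v gv by (simp add: E_def)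
    then have "t < R s \<theta>" using H_ray_compare(1)[of t s \<theta>] t\<theta> s s' by (auto simp: sublevel_def ray_in_N)
    have v12: "vec_nth v 1 = t * e1 \<theta>" "vec_nth v 2 = t * e2 \<theta>" using gv by (auto simp: g_def ray_def)
    have "t = 0 \<or> \<theta> = 0"
    proof (rule ccontr)
      assume "\<not> (t = 0 \<or> \<theta> = 0)"
      then have "vector [t\<^sup>2 / 2, \<theta>] \<in> S"
        using t\<theta> \<open>t < R s \<theta>\<close> by (simp add: S_iff power_strict_mono)
      moreover have "v = polar (vector [t\<^sup>2 / 2, \<theta>])"
        using t\<theta> v12 by (simp add: Finite_Cartesian_Product.vec_eq_iff forall_2)
      ultimately show False using v by blast
    qed
    then have "\<beta> * vec_nth v 1 - \<alpha> * vec_nth v 2 = 0" unfolding v12 by (auto simp: e1_def e2_def)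
    then show "v \<in> {v. vector [\<beta>, - \<alpha>] \<bullet> v = 0}" by (simp add: inner_vec_def sum_2)
  qed
  have "vector [\<beta>, - \<alpha>] \<noteq> (0 :: real ^ 2)"
  proof
    assume "vector [\<beta>, - \<alpha>] = (0 :: real ^ 2)"
    then have "vec_nth (vector [\<beta>, - \<alpha>] :: real ^ 2) 2 = vec_nth (0 :: real ^ 2) 2"
      by (rule arg_cong[where f = "\<lambda>v. vec_nth v 2"])
    then show False using \<alpha>_pos by simp
  qed
  then have neg: "negligible {v :: real ^ 2. vector [\<beta>, - \<alpha>] \<bullet> v = 0}" by (intro negligible_hyperplane) simp
  have "polar ` S - E = {}" using sub by (simp only: Diff_eq_empty_iff)
  then have "polar ` S - E \<union> (E - polar ` S) \<subseteq> {v. vector [\<beta>, - \<alpha>] \<bullet> v = 0}"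
    using diff by (simp only: Un_empty_left)
  then have "negligible (polar ` S - E \<union> (E - polar ` S))"
    by (rule negligible_subset[OF neg])
  from measure_negligible_symdiff[OF fS this] have "measure lebesgue E = A" using area by simp
  moreover have "measure lebesgue E = measure lborel (sublevel s)"
  proof -
    have b: "sublevel s \<in> sets borel" using open_sublevel by simp
    show ?thesis
      using emeasure_lborel_vec_2[OF b] by (simp add: E_def g_def measure_def)
  qed
  ultimately show ?thesis by (simp add: A_def)
qed

end

section \<open>Centers with positive energy\<close>

lemma double_series_at_0:
  assumes "double_series r c f" "0 < r"
  shows "f (0, 0) = c 0 0"
proof -
  have "(\<lambda>n. (\<Sum>i\<le>n. c i (n - i) * 1 ^ i * 1 ^ (n - i)) * 0 ^ n) sums f (0 * 1, 0 * 1)"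
    by (rule double_series_ray[OF assms(1)]) (use assms(2) in simp_all)
  then show ?thesis using powser_sums_zero_iff[of "\<lambda>n. \<Sum>i\<le>n. c i (n - i) * 1 ^ i * 1 ^ (n - i)"] by simp
qed

lemma double_series_uminus:
  assumes "double_series r c f"
  shows "double_series r (\<lambda>i j. - c i j) (\<lambda>p. - f p)"
  unfolding double_series_def
proof (intro allI impI)
  fix x y assume "\<bar>x\<bar> < r \<and> \<bar>y\<bar> < r"
  then have "((\<lambda>ij. - (case ij of (i, j) \<Rightarrow> c i j * x ^ i * y ^ j)) has_sum - f (x, y)) UNIV"
    using double_series_has_sum[OF assms] by (intro has_sum_uminusI) blast
  then show "((\<lambda>(i, j). - c i j * x ^ i * y ^ j) has_sum - f (x, y)) UNIV"
    by (simp add: case_prod_unfold)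
qed

lemma linearization_hamiltonian_field:
  assumes H: "double_series r c H" and r: "0 < r"
  shows "linearization (hamiltonian_field H) (0, 0) = mat_of_rows_list 2 [[- c 1 1, - 2 * c 0 2], [2 * c 2 0, c 1 1]]"
proof -
  note Hx = double_series_partial_x(1)[OF H]
  note Hy = double_series_uminus[OF double_series_partial_y(1)[OF H]]
  have 1: "fst \<circ> hamiltonian_field H = (\<lambda>p. - partial_y H p)" "snd \<circ> hamiltonian_field H = partial_x H"
    by (auto simp: hamiltonian_field_def fun_eq_iff)
  show ?thesis
    unfolding linearization_def 1
    using double_series_at_0[OF double_series_partial_x(1)[OF Hx] r] double_series_at_0[OF double_series_partial_y(1)[OF Hx] r]
      double_series_at_0[OF double_series_partial_x(1)[OF Hy] r] double_series_at_0[OF double_series_partial_y(1)[OF Hy] r]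
    by (simp add: numeral_2_eq_2)
qed

text \<open>The trace is 0 and the determinant is \<open>4 * a * d - b\<^sup>2\<close>, so the
  eigenvalues are the two square roots of its negative, which are real under the hypothesis.\<close>

lemma eigenvalue_trace_zero:
  fixes a b d :: real
  assumes "4 * a * d - b\<^sup>2 \<le> 0"
  shows "\<exists>\<mu>::real. eigenvalue (map_mat complex_of_real (mat_of_rows_list 2 [[- b, - 2 * d], [2 * a, b]])) (of_real \<mu>)"
proof -
  let ?A = "map_mat complex_of_real (mat_of_rows_list 2 [[- b, - 2 * d], [2 * a, b]])"
  have A: "?A = mat_of_rows_list 2 [[of_real (- b), of_real (- 2 * d)], [of_real (2 * a), of_real b]]"
    by (rule eq_matI) (auto simp: mat_of_rows_list_def less_Suc_eq numeral_2_eq_2)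
  have ev: "eigenvalue ?A (of_real \<mu>)"
    if "- b * x - 2 * d * y = \<mu> * x" "2 * a * x + b * y = \<mu> * y" "x \<noteq> 0 \<or> y \<noteq> 0" for \<mu> x y :: real
    unfolding eigenvalue_def eigenvector_def
  proof (intro exI conjI)
    let ?v = "vec_of_list [complex_of_real x, of_real y]"
    have "dim_row ?A = Suc (Suc 0)" by (simp add: mat_of_rows_list_def)
    then show "?v \<in> carrier_vec (dim_row ?A)" by (intro carrier_vecI) simp
    show "?v \<noteq> 0\<^sub>v (dim_row ?A)"
    proof
      assume v0: "?v = 0\<^sub>v (dim_row ?A)"
      show False
        using arg_cong[OF v0, of "\<lambda>v. vec_index v 0"] arg_cong[OF v0, of "\<lambda>v. vec_index v 1"] that(3)
        by (auto simp: mat_of_rows_list_def)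
    qed
    have 1: "- complex_of_real b * of_real x - 2 * of_real d * of_real y = of_real \<mu> * of_real x"
      "2 * complex_of_real a * of_real x + of_real b * of_real y = of_real \<mu> * of_real y"
      using arg_cong[OF that(1), of complex_of_real] arg_cong[OF that(2), of complex_of_real] by simp_all
    show "?A *\<^sub>v ?v = of_real \<mu> \<cdot>\<^sub>v ?v"
    proof (rule eq_vecI)
      fix i assume "i < dim_vec (of_real \<mu> \<cdot>\<^sub>v ?v)"
      then have "i = 0 \<or> i = 1" by auto
      then show "vec_index (?A *\<^sub>v ?v) i = vec_index (of_real \<mu> \<cdot>\<^sub>v ?v) i"
        using 1 by (auto simp: mat_of_rows_list_def scalar_prod_def numeral_2_eq_2)
    qed (simp add: mat_of_rows_list_def)
  qed
  show ?thesis
  proof (cases "d = 0")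
    case True
    have "eigenvalue ?A (of_real b)" by (rule ev[of 0 1 b]) (simp_all add: True)
    then show ?thesis by blast
  next
    case False
    define \<mu> where "\<mu> = sqrt (b\<^sup>2 - 4 * a * d)"
    have \<mu>: "\<mu>\<^sup>2 = b\<^sup>2 - 4 * a * d" using assms by (simp add: \<mu>_def)
    show ?thesis
    \<comment> \<open>This vector solves the first row identically; the second row is then the
      characteristic equation.\<close>
    proof (intro exI, rule ev[of "2 * d" "- b - \<mu>"])
      show "2 * a * (2 * d) + b * (- b - \<mu>) = \<mu> * (- b - \<mu>)"
        using \<mu> by (simp add: algebra_simps power2_eq_square)
    qed (use False in \<open>auto simp: algebra_simps\<close>)
  qed
qed

lemma double_series_y_axis:
  assumes "double_series r c H" "\<bar>t\<bar> < r"
  shows "(\<lambda>n. c 0 n * t ^ n) sums H (0, t)"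
proof -
  have "(\<lambda>n. (\<Sum>i\<le>n. c i (n - i) * 0 ^ i * 1 ^ (n - i)) * t ^ n) sums H (t * 0, t * 1)"
    by (rule double_series_ray[OF assms(1)]) (use assms(2) in auto)
  moreover have "(\<Sum>i\<le>n. c i (n - i) * 0 ^ i * 1 ^ (n - i)) = c 0 n" for n
    by (subst sum.remove[of _ 0]) auto
  ultimately show ?thesis by simp
qed

lemma y_axis_has_fps_expansion:
  assumes "double_series r c H" "0 < r"
  shows "(\<lambda>t. H (0, t)) has_fps_expansion Abs_fps (c 0)"
proof (rule has_fps_expansionI)
  have "\<forall>\<^sub>F t in nhds (0::real). t \<in> {-r<..<r}"
    using assms(2) by (intro eventually_nhds_in_open) auto
  then show "\<forall>\<^sub>F t in nhds 0. (\<lambda>n. fps_nth (Abs_fps (c 0)) n * t ^ n) sums H (0, t)"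
    by eventually_elim (use double_series_y_axis[OF assms(1)] in auto)
qed

text \<open>Non-degeneracy excludes real eigenvalues, which forces a positive Hessian determinant,
  so the quadratic part is definite. Its sign is fixed on the y-axis:
  \<open>H (0, x) / x ^ 2\<close> tends to \<open>c 0 2\<close>, and a negative value would
  contradict positive energy near the origin.\<close>

lemma hamiltonian_center_imp_morse:
  assumes "hamiltonian_center H U"
  obtains c r where "morse_hamiltonian H c r"
proof -
  have "real_analytic2_on H U" "(0, 0) \<in> U" using assms by (simp_all add: hamiltonian_center_def)
  then obtain c r where r: "0 < r" and cr: "\<forall>x y. \<bar>x\<bar> < r \<and> \<bar>y\<bar> < r \<longrightarrow>
      ((\<lambda>(i, j). c i j * x ^ i * y ^ j) has_sum H ((0, 0) + (x, y))) UNIV"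
    unfolding real_analytic2_on_def by blast
  have H: "double_series r c H" unfolding double_series_def using cr by simp
  have c00: "c 0 0 = 0"
    using double_series_at_0[OF H r] assms by (simp add: hamiltonian_center_def)
  have "hamiltonian_field H (0, 0) = (0, 0)"
    using assms by (simp add: hamiltonian_center_def nondegenerate_center_def center_def)
  then have c1: "c 1 0 = 0" "c 0 1 = 0"
    using double_series_at_0[OF double_series_partial_x(1)[OF H] r]
      double_series_at_0[OF double_series_partial_y(1)[OF H] r]
    by (simp_all add: hamiltonian_field_def)
  have disc: "0 < 4 * c 2 0 * c 0 2 - (c 1 1)\<^sup>2"
  proof (rule ccontr)
    assume "\<not> ?thesis"
    then have "4 * c 2 0 * c 0 2 - (c 1 1)\<^sup>2 \<le> 0" by simp
    from eigenvalue_trace_zero[OF this] obtain \<mu> :: real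
      where \<mu>: "eigenvalue (map_mat complex_of_real (linearization (hamiltonian_field H) (0, 0))) (of_real \<mu>)"
      unfolding linearization_hamiltonian_field[OF H r] by blast
    have "\<forall>\<mu>. eigenvalue (map_mat complex_of_real (linearization (hamiltonian_field H) (0, 0))) \<mu> \<longrightarrow> \<mu> \<noteq> 0 \<and> Re \<mu> = 0"
    proof -
      have "nondegenerate_center (hamiltonian_field H) U (0, 0)" using assms by (simp add: hamiltonian_center_def)
      then show ?thesis unfolding nondegenerate_center_def by (rule conjunct2)
    qed
    from this[rule_format, OF \<mu>] show False by simp
  qed
  have "\<exists>V. period_neighborhood (hamiltonian_field H) U (0, 0) V \<and> (\<forall>q\<in>V - {(0, 0)}. 0 < H q)"
    using assms by (simp only: hamiltonian_center_def)
  then obtain V where "period_neighborhood (hamiltonian_field H) U (0, 0) V" "\<forall>q\<in>V - {(0, 0)}. 0 < H q"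
    by (elim exE conjE)
  then have V: "open V" "(0, 0) \<in> V" "\<And>q. q \<in> V - {(0, 0)} \<Longrightarrow> 0 < H q"
    by (simp_all add: period_neighborhood_def)
  have "0 < c 0 2"
  proof (rule ccontr)
    assume "\<not> ?thesis"
    then have neg: "c 0 2 < 0" using disc by (cases "c 0 2 = 0") auto
    have "2 \<le> subdegree (Abs_fps (c 0))"
    proof (rule subdegree_geI)
      show "Abs_fps (c 0) \<noteq> 0" using neg by (auto simp: fps_eq_iff intro!: exI[of _ 2])
      show "fps_nth (Abs_fps (c 0)) i = 0" if "i < 2" for i
        using that c00 c1 by (auto simp: less_2_cases_iff)
    qed
    from has_fps_expansion_imp_continuous[OF has_fps_expansion_shift[OF y_axis_has_fps_expansion[OF H r] this refl], of UNIV]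
    have "isCont (\<lambda>x. if x = 0 then c 0 2 else H (0, x) / x ^ 2) 0"
      by (simp only: fps_nth_Abs_fps)
    then have "((\<lambda>x. if x = 0 then c 0 2 else H (0, x) / x ^ 2) \<longlongrightarrow> c 0 2) (at 0)"
      by (simp only: isCont_def if_True simp_thms)
    then have "\<forall>\<^sub>F x in at 0. (if x = 0 then c 0 2 else H (0, x) / x ^ 2) < 0"
      by (rule order_tendstoD(2)) (rule neg)
    moreover have "\<forall>\<^sub>F x in at (0::real). x \<noteq> 0 \<and> (0, x) \<in> V"
    proof -
      have "open ((\<lambda>x. (0, x)) -` V)"
        by (rule open_vimage[OF V(1)]) (intro continuous_intros)
      then have "\<forall>\<^sub>F x in at 0. x \<in> (\<lambda>x. (0, x)) -` V"
        by (rule eventually_at_in_open') (simp add: V(2))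
      then show ?thesis using eventually_neq_at_within[of "0::real" 0 UNIV] by eventually_elim simp
    qed
    ultimately have "\<forall>\<^sub>F x in at (0::real). False"
    proof eventually_elim
      case (elim x)
      have "0 < H (0, x)" using V(3)[of "(0, x)"] elim by auto
      then show False using elim by (auto simp: divide_less_0_iff)
    qed
    then show False by simp
  qed
  then have "morse_hamiltonian H c r"
    by unfold_locales (use r H c00 c1 disc in auto)
  then show ?thesis by (rule that)
qed

section \<open>Energy families\<close>

text \<open>A given solution may be known to meet a level curve only at some time \<open>t0\<close>;
  translation in time reduces this to time 0.\<close>

lemma minimal_period_shift: "minimal_period (\<lambda>t. \<phi> (t + u)) = minimal_period \<phi>"
proof -
  have "(\<forall>t. \<phi> (t + \<tau> + u) = \<phi> (t + u)) \<longleftrightarrow> (\<forall>t. \<phi> (t + \<tau>) = \<phi> t)" for \<tau>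
  proof
    assume *: "\<forall>t. \<phi> (t + \<tau> + u) = \<phi> (t + u)"
    show "\<forall>t. \<phi> (t + \<tau>) = \<phi> t"
    proof
      fix t
      show "\<phi> (t + \<tau>) = \<phi> t" using *[rule_format, of "t - u"] by (simp add: algebra_simps)
    qed
  next
    assume *: "\<forall>t. \<phi> (t + \<tau>) = \<phi> t"
    show "\<forall>t. \<phi> (t + \<tau> + u) = \<phi> (t + u)"
    proof
      fix t
      show "\<phi> (t + \<tau> + u) = \<phi> (t + u)" using *[rule_format, of "t + u"] by (simp add: algebra_simps)
    qed
  qed
  then show ?thesis by (simp add: minimal_period_def)
qed

lemma range_shift: "range (\<lambda>t :: real. \<phi> (t + u)) = range \<phi>"
proof (intro equalityI subsetI)
  fix p assume "p \<in> range \<phi>"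
  then obtain t where "p = \<phi> ((t - u) + u)" by auto
  then show "p \<in> range (\<lambda>t. \<phi> (t + u))" by blast
qed auto

lemma solution_in_shift:
  assumes "solution_in X U \<phi>"
  shows "solution_in X U (\<lambda>t. \<phi> (t + u))"
  unfolding solution_in_def
proof (intro allI conjI)
  fix t
  show "\<phi> (t + u) \<in> U" using assms by (simp add: solution_in_def)
  have "(\<phi> \<circ> (\<lambda>t. t + u) has_vector_derivative 1 *\<^sub>R X (\<phi> (t + u))) (at t)"
    by (rule vector_diff_chain_at) (use assms in \<open>auto simp: solution_in_def intro!: derivative_eq_intros\<close>)
  then show "((\<lambda>t. \<phi> (t + u)) has_vector_derivative X (\<phi> (t + u))) (at t)" by (simp add: o_def)
qed

context morse_hamiltonian
begin

lemma curve_subset_open: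
  assumes "open W" "(0, 0) \<in> W"
  obtains \<epsilon> where "0 < \<epsilon>" "\<epsilon> \<le> \<sigma>" "\<And>s. 0 < s \<Longrightarrow> s < \<epsilon> \<Longrightarrow> curve s \<subseteq> W"
proof -
  obtain e where e: "0 < e" "ball (0, 0) e \<subseteq> W" using assms by (meson open_contains_ball)
  define \<epsilon> where "\<epsilon> = min \<sigma> (e / (4 * L))"
  have "0 < \<epsilon>" using e \<sigma> L_pos by (simp add: \<epsilon>_def)
  moreover have "\<epsilon> \<le> \<sigma>" by (simp add: \<epsilon>_def)
  moreover have "curve s \<subseteq> W" if s: "0 < s" "s < \<epsilon>" for s
  proof
    fix p assume "p \<in> curve s"
    then obtain \<theta> where p: "p = ray (R s \<theta>) \<theta>" by (auto simp: curve_def)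
    have s': "s < \<delta>" using s \<sigma> by (simp add: \<epsilon>_def)
    have R: "0 < R s \<theta>" "R s \<theta> < 2 * s" using R_bounds[OF s(1) s'] by auto
    have 1: "\<bar>R s \<theta> * e1 \<theta>\<bar> \<le> 2 * s * L" "\<bar>R s \<theta> * e2 \<theta>\<bar> \<le> 2 * s * L"
      unfolding abs_mult by (intro mult_mono e_bound; use R s in simp)+
    have "dist (0, 0) p = norm p" using dist_0_norm[of p] by (simp only: zero_prod_def)
    also have "\<dots> \<le> \<bar>R s \<theta> * e1 \<theta>\<bar> + \<bar>R s \<theta> * e2 \<theta>\<bar>"
      unfolding p ray_def using norm_Pair_le[of "R s \<theta> * e1 \<theta>" "R s \<theta> * e2 \<theta>"] by simp
    also have "\<dots> \<le> 4 * L * s" using add_mono[OF 1] by (simp add: mult_ac)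
    also have "\<dots> < 4 * L * (e / (4 * L))"
      by (rule mult_strict_left_mono) (use s L_pos in \<open>simp_all add: \<epsilon>_def\<close>)
    also have "\<dots> = e" using L_pos by simp
    finally show "p \<in> W" using e by auto
  qed
  ultimately show ?thesis by (rule that)
qed

lemma origin_not_in_curve: "0 < s \<Longrightarrow> s < \<delta> \<Longrightarrow> (0, 0) \<notin> curve s"
proof -
  assume s: "0 < s" "s < \<delta>"
  have "H (0, 0) = 0" using double_series_at_0[OF H r] c00 by simp
  then show ?thesis using s by (simp add: curve_iff)
qed

text \<open>Every point of the sublevel set other than the origin has positive energy and so lies on
  the curve of its own level. This supplies the openness demanded by
  \<open>energy_family\<close>.\<close>

lemma sublevel_eq_Union:
  assumes "0 < \<epsilon>" "\<epsilon> \<le> \<sigma>"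
  shows "insert (0, 0) (\<Union>h\<in>{0<..<\<epsilon>\<^sup>2}. curve (sqrt h)) = sublevel \<epsilon>"
proof (intro equalityI subsetI)
  have \<epsilon>: "\<epsilon> < \<delta>" using assms \<sigma> by simp
  have H0: "H (ray 0 \<theta>) = 0" "ray 0 \<theta> = (0, 0)" for \<theta>
    using double_series_at_0[OF H r] c00 by (simp_all add: ray_def)
  {
    fix p assume "p \<in> insert (0, 0) (\<Union>h\<in>{0<..<\<epsilon>\<^sup>2}. curve (sqrt h))"
    then consider "p = (0, 0)" | h where "0 < h" "h < \<epsilon>\<^sup>2" "p \<in> curve (sqrt h)" by auto
    then show "p \<in> sublevel \<epsilon>"
    proof cases
      case 1
      then show ?thesis using H0[of 0] ray_in_N[of 0 0] \<delta> assms by (simp add: sublevel_def)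
    next
      case 2
      have "sqrt h < \<epsilon>" using 2 assms by (simp add: real_less_lsqrt)
      then show ?thesis using 2 \<epsilon> by (simp add: curve_iff sublevel_def)
    qed
  }
  fix p assume p: "p \<in> sublevel \<epsilon>"
  then have "p \<in> N" by (simp add: sublevel_def)
  then obtain t \<theta> where t: "p = ray t \<theta>" "0 \<le> t" "t < 4 * \<delta>" using N_cases by blast
  show "p \<in> insert (0, 0) (\<Union>h\<in>{0<..<\<epsilon>\<^sup>2}. curve (sqrt h))"
  proof (cases "t = 0")
    case True
    then show ?thesis using t H0 by simp
  next
    case False
    then have "0 < H p" using H_ray_strict_mono[of 0 t \<theta>] t H0 by simp
    moreover have "H p < \<epsilon>\<^sup>2" "p \<in> N" using p by (auto simp: sublevel_def)
    moreover have "sqrt (H p) < \<delta>"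
      using \<open>H p < \<epsilon>\<^sup>2\<close> assms \<epsilon> by (intro less_trans[OF _ \<epsilon>]) (simp add: real_less_lsqrt)
    ultimately have "p \<in> curve (sqrt (H p))" "H p \<in> {0<..<\<epsilon>\<^sup>2}" by (simp_all add: curve_iff)
    then show ?thesis by blast
  qed
qed

lemma orbit_through_curve:
  assumes s: "0 < s" "s < \<sigma>" and \<phi>: "solution_in (hamiltonian_field H) U \<phi>" and t0: "\<phi> t0 \<in> curve s"
  shows "minimal_period \<phi> = eval_fps period_fps (s\<^sup>2)" "range \<phi> = curve s"
  using orbit_on_curve[OF s solution_in_shift[OF \<phi>, of t0]] t0
  by (simp_all add: minimal_period_shift range_shift)

lemma period_neighborhood_orbits:
  assumes "period_neighborhood (hamiltonian_field H) U (0, 0) W"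
  obtains \<epsilon> where "0 < \<epsilon>" "\<epsilon> \<le> \<sigma>"
    "\<And>s q. 0 < s \<Longrightarrow> s < \<epsilon> \<Longrightarrow> q \<in> curve s \<Longrightarrow>
      \<exists>\<phi>. periodic_orbit_around (hamiltonian_field H) U (0, 0) \<phi> \<and> \<phi> 0 = q"
proof -
  have W: "open W" "(0, 0) \<in> W"
    "\<And>q. q \<in> W - {(0, 0)} \<Longrightarrow> \<exists>\<phi>. periodic_orbit_around (hamiltonian_field H) U (0, 0) \<phi> \<and> \<phi> 0 = q"
    using assms unfolding period_neighborhood_def by blast+
  obtain \<epsilon> where \<epsilon>: "0 < \<epsilon>" "\<epsilon> \<le> \<sigma>" "\<And>s. 0 < s \<Longrightarrow> s < \<epsilon> \<Longrightarrow> curve s \<subseteq> W"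
    using curve_subset_open[OF W(1,2)] by metis
  show ?thesis
  proof (rule that[OF \<epsilon>(1,2)])
    fix s q assume s: "0 < s" "s < \<epsilon>" "q \<in> curve s"
    have "s < \<delta>" using s \<epsilon> \<sigma> by simp
    then have "q \<noteq> (0, 0)" using origin_not_in_curve[OF s(1)] s(3) by blast
    moreover have "q \<in> W" using \<epsilon>(3)[OF s(1,2)] s(3) by blast
    ultimately show "\<exists>\<phi>. periodic_orbit_around (hamiltonian_field H) U (0, 0) \<phi> \<and> \<phi> 0 = q"
      by (intro W(3)) simp
  qed
qed

text \<open>Small curves lie in the period neighborhood, so through a point of each there is a
  periodic orbit, and that orbit covers the whole curve.\<close>

lemma energy_family_exists:
  assumes "period_neighborhood (hamiltonian_field H) U (0, 0) W"
  shows "\<exists>h1 fam. energy_family H U h1 fam"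
proof -
  obtain \<epsilon> where \<epsilon>: "0 < \<epsilon>" "\<epsilon> \<le> \<sigma>"
    and orb: "\<And>s q. 0 < s \<Longrightarrow> s < \<epsilon> \<Longrightarrow> q \<in> curve s \<Longrightarrow>
      \<exists>\<phi>. periodic_orbit_around (hamiltonian_field H) U (0, 0) \<phi> \<and> \<phi> 0 = q"
    using period_neighborhood_orbits[OF assms] by metis
  define good where "good h \<phi> \<longleftrightarrow> periodic_orbit_around (hamiltonian_field H) U (0, 0) \<phi> \<and> \<phi> 0 \<in> curve (sqrt h)" for h \<phi>
  define \<phi> where "\<phi> h = (SOME \<phi>. good h \<phi>)" for h
  have sq: "0 < sqrt h" "sqrt h < \<epsilon>" "sqrt h < \<sigma>" "sqrt h < \<delta>" if "h \<in> {0<..<\<epsilon>\<^sup>2}" for h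
  proof -
    show "0 < sqrt h" "sqrt h < \<epsilon>" using that \<epsilon> by (auto intro: real_less_lsqrt)
    then show "sqrt h < \<sigma>" "sqrt h < \<delta>" using \<epsilon> \<sigma> by auto
  qed
  have good: "good h (\<phi> h)" if h: "h \<in> {0<..<\<epsilon>\<^sup>2}" for h
  proof -
    have "ray (R (sqrt h) 0) 0 \<in> curve (sqrt h)" by (simp add: curve_def)
    then have "\<exists>\<phi>. good h \<phi>" unfolding good_def using orb[OF sq(1,2)[OF h]] by metis
    then show ?thesis unfolding \<phi>_def by (rule someI_ex)
  qed
  have orbit: "periodic_orbit_around (hamiltonian_field H) U (0, 0) (\<phi> h)"
    and sol: "solution_in (hamiltonian_field H) U (\<phi> h)" and rng: "range (\<phi> h) = curve (sqrt h)"
    if h: "h \<in> {0<..<\<epsilon>\<^sup>2}" for h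
  proof -
    show p: "periodic_orbit_around (hamiltonian_field H) U (0, 0) (\<phi> h)" using good[OF h] by (simp add: good_def)
    then show s: "solution_in (hamiltonian_field H) U (\<phi> h)" by (simp add: periodic_orbit_around_def)
    show "range (\<phi> h) = curve (sqrt h)"
      by (rule orbit_through_curve(2)[OF sq(1,3)[OF h] s, where ?t0.0 = 0]) (use good[OF h] in \<open>simp add: good_def\<close>)
  qed
  have "energy_family H U (\<epsilon>\<^sup>2) \<phi>"
    unfolding energy_family_def
  proof (intro conjI ballI)
    show "0 < \<epsilon>\<^sup>2" using \<epsilon> by simp
    fix h assume h: "h \<in> {0<..<\<epsilon>\<^sup>2}"
    show "periodic_orbit_around (hamiltonian_field H) U (0, 0) (\<phi> h)" by (rule orbit[OF h])
    have "range (\<phi> h) \<subseteq> U" using sol[OF h] by (auto simp: solution_in_def)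
    moreover have "H p = h" if "p \<in> range (\<phi> h)" for p
      using that curve_iff[OF sq(1,4)[OF h]] h unfolding rng[OF h] by simp
    ultimately show "range (\<phi> h) \<subseteq> {p \<in> U. H p = h}" by auto
  next
    have "(\<Union>h\<in>{0<..<\<epsilon>\<^sup>2}. range (\<phi> h)) = (\<Union>h\<in>{0<..<\<epsilon>\<^sup>2}. curve (sqrt h))"
      by (rule SUP_cong) (simp_all add: rng)
    then show "open (insert (0, 0) (\<Union>h\<in>{0<..<\<epsilon>\<^sup>2}. range (\<phi> h)))"
      using open_sublevel[of \<epsilon>] by (simp only: sublevel_eq_Union[OF \<epsilon>])
  qed
  then show ?thesis by blast
qed

text \<open>Openness of the union around the origin forces an arbitrary family to meet every small
  level curve, and conservation of energy shows which member does: a point of energy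
  \<open>h\<close> can only lie on the orbit with index \<open>h\<close>. That orbit then is the
  curve, with the computed period and area.\<close>

lemma energy_family_orbits:
  assumes fam: "energy_family H U h1 \<phi>"
  obtains \<epsilon> where "0 < \<epsilon>" "\<epsilon> \<le> \<sigma>" "\<epsilon>\<^sup>2 \<le> h1"
    "\<And>h. 0 < h \<Longrightarrow> h < \<epsilon>\<^sup>2 \<Longrightarrow> period_function \<phi> h = eval_fps period_fps h"
    "\<And>h. 0 < h \<Longrightarrow> h < \<epsilon>\<^sup>2 \<Longrightarrow> area_function \<phi> h = eval_fps area_fps h"
proof -
  let ?W = "insert (0, 0) (\<Union>h\<in>{0<..<h1}. range (\<phi> h))"
  have W: "0 < h1" "open ?W"
    "\<And>h. h \<in> {0<..<h1} \<Longrightarrow> solution_in (hamiltonian_field H) U (\<phi> h) \<and> range (\<phi> h) \<subseteq> {p \<in> U. H p = h}"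
    using fam by (auto simp: energy_family_def periodic_orbit_around_def)
  obtain \<epsilon>0 where \<epsilon>0: "0 < \<epsilon>0" "\<epsilon>0 \<le> \<sigma>" "\<And>s. 0 < s \<Longrightarrow> s < \<epsilon>0 \<Longrightarrow> curve s \<subseteq> ?W"
    using curve_subset_open[OF W(2)] by (metis insertI1)
  define \<epsilon> where "\<epsilon> = min \<epsilon>0 (sqrt h1)"
  have \<epsilon>: "0 < \<epsilon>" "\<epsilon> \<le> \<sigma>" "\<epsilon> \<le> \<epsilon>0" using \<epsilon>0 W(1) by (auto simp: \<epsilon>_def)
  have "\<epsilon>\<^sup>2 \<le> (sqrt h1)\<^sup>2" by (rule power_mono) (use \<epsilon> in \<open>auto simp: \<epsilon>_def\<close>)
  then have \<epsilon>h: "\<epsilon>\<^sup>2 \<le> h1" using W(1) by simp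
  have *: "minimal_period (\<phi> h) = eval_fps period_fps h \<and> range (\<phi> h) = curve (sqrt h)"
    and sq: "0 < sqrt h \<and> sqrt h < \<sigma>"
    if h: "0 < h" "h < \<epsilon>\<^sup>2" for h
  proof -
    have "sqrt h < \<epsilon>" using h \<epsilon> by (auto intro: real_less_lsqrt)
    then have s: "0 < sqrt h" "sqrt h < \<epsilon>0" "sqrt h < \<sigma>" "sqrt h < \<delta>" using h \<epsilon> \<sigma> by auto
    then show "0 < sqrt h \<and> sqrt h < \<sigma>" by simp
    let ?q = "ray (R (sqrt h) 0) 0"
    have q: "?q \<in> curve (sqrt h)" by (simp add: curve_def)
    then have "?q \<noteq> (0, 0)" using origin_not_in_curve[OF s(1,4)] by metis
    moreover have "?q \<in> ?W" using \<epsilon>0(3)[OF s(1,2)] q by blast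
    ultimately obtain h' where h': "h' \<in> {0<..<h1}" "?q \<in> range (\<phi> h')" by blast
    then have "H ?q = h'" using W(3) by blast
    moreover have "H ?q = h" using q curve_iff[OF s(1,4)] h by simp
    ultimately have "h' = h" by simp
    with h' obtain t0 where "?q = \<phi> h t0" "solution_in (hamiltonian_field H) U (\<phi> h)" using W(3) by blast
    then show "minimal_period (\<phi> h) = eval_fps period_fps h \<and> range (\<phi> h) = curve (sqrt h)"
      using orbit_through_curve[OF s(1,3), of U "\<phi> h" t0] q h by simp
  qed
  show ?thesis
  proof (rule that[OF \<epsilon>(1,2) \<epsilon>h])
    fix h assume h: "0 < h" "h < \<epsilon>\<^sup>2"
    show "period_function \<phi> h = eval_fps period_fps h"
      using *[OF h] by (simp add: period_function_def)
    show "area_function \<phi> h = eval_fps area_fps h"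
      using *[OF h] measure_sublevel[of "sqrt h"] inside_curve[of "sqrt h"] sq[OF h] h
      by (simp add: area_function_def)
  qed
qed

end

section \<open>Finite procedures\<close>

text \<open>The procedure is chosen before the instance, which is the uniformity that
  \<open>obtained_algorithmically\<close> asks for.\<close>

definition procedural :: "'z set \<Rightarrow> ('z \<Rightarrow> 'v \<Rightarrow> real) \<Rightarrow> ('z \<Rightarrow> real) \<Rightarrow> bool" where
  "procedural Z dat f \<longleftrightarrow> (\<exists>p. \<forall>z\<in>Z. f z = run (dat z) p)"

lemma procedural_cong:
  "procedural Z dat f \<Longrightarrow> (\<And>z. z \<in> Z \<Longrightarrow> f z = g z) \<Longrightarrow> procedural Z dat g"
  by (simp add: procedural_def)

lemma procedural_datum: "procedural Z dat (\<lambda>z. dat z v)"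
  unfolding procedural_def by (intro exI[of _ "Datum v"]) simp

lemma procedural_of_int: "procedural Z dat (\<lambda>z. of_int k)"
  unfolding procedural_def by (intro exI[of _ "Const k"]) simp

lemma procedural_pi: "procedural Z dat (\<lambda>z. pi)"
  unfolding procedural_def by (intro exI[of _ Pi]) simp

lemma procedural_add:
  assumes "procedural Z dat f" "procedural Z dat g"
  shows "procedural Z dat (\<lambda>z. f z + g z)"
proof -
  from assms obtain p q where "\<forall>z\<in>Z. f z = run (dat z) p" "\<forall>z\<in>Z. g z = run (dat z) q"
    unfolding procedural_def by blast
  then show ?thesis unfolding procedural_def by (intro exI[of _ "Add p q"]) simp
qed

lemma procedural_mult:
  assumes "procedural Z dat f" "procedural Z dat g"
  shows "procedural Z dat (\<lambda>z. f z * g z)"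
proof -
  from assms obtain p q where "\<forall>z\<in>Z. f z = run (dat z) p" "\<forall>z\<in>Z. g z = run (dat z) q"
    unfolding procedural_def by blast
  then show ?thesis unfolding procedural_def by (intro exI[of _ "Mult p q"]) simp
qed

lemma procedural_inverse:
  assumes "procedural Z dat f"
  shows "procedural Z dat (\<lambda>z. inverse (f z))"
proof -
  from assms obtain p where "\<forall>z\<in>Z. f z = run (dat z) p" unfolding procedural_def by blast
  then show ?thesis unfolding procedural_def by (intro exI[of _ "Inv p"]) simp
qed

lemma procedural_sqrt:
  assumes "procedural Z dat f"
  shows "procedural Z dat (\<lambda>z. sqrt (f z))"
proof -
  from assms obtain p where "\<forall>z\<in>Z. f z = run (dat z) p" unfolding procedural_def by blast
  then show ?thesis unfolding procedural_def by (intro exI[of _ "Sqrt p"]) simp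
qed

lemma function_ring_procedural: "function_ring Z (procedural Z dat)"
  by unfold_locales (auto intro: procedural_cong procedural_of_int procedural_add procedural_mult)

lemmas procedural_0 = function_ring.zero[OF function_ring_procedural]
lemmas procedural_1 = function_ring.one[OF function_ring_procedural]
lemmas procedural_of_nat = function_ring.of_nat[OF function_ring_procedural]
lemmas procedural_uminus = function_ring.uminus[OF function_ring_procedural]
lemmas procedural_power = function_ring.power[OF function_ring_procedural]

lemma procedural_divide:
  "procedural Z dat f \<Longrightarrow> procedural Z dat g \<Longrightarrow> procedural Z dat (\<lambda>z. f z / g z)"
  unfolding divide_inverse by (intro procedural_mult procedural_inverse)

lemma procedural_diff:
  "procedural Z dat f \<Longrightarrow> procedural Z dat g \<Longrightarrow> procedural Z dat (\<lambda>z. f z - g z)"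
  unfolding diff_conv_add_uminus by (intro procedural_add procedural_uminus)

lemma procedural_numeral: "procedural Z dat (\<lambda>z. numeral k)"
  using procedural_of_int[of Z dat "numeral k"] by simp

text \<open>An instance may carry more than the data, for example the Hamiltonian itself, so that
  the wanted series is a function of it; the procedures still see only \<open>dat z\<close>.\<close>

lemma obtained_algorithmicallyI:
  assumes "\<And>n. procedural Z dat (\<lambda>z. fps_nth (F z) n)"
    and "\<And>d G. R d G \<Longrightarrow> \<exists>z\<in>Z. dat z = d \<and> F z = G"
  shows "obtained_algorithmically R"
  unfolding obtained_algorithmically_def
proof
  fix N
  obtain p where p: "\<And>n z. z \<in> Z \<Longrightarrow> fps_nth (F z) n = run (dat z) (p n)"
    using assms(1) unfolding procedural_def by metis
  show "\<exists>ps. length ps = Suc N \<and> (\<forall>d G. R d G \<longrightarrow> (\<forall>n\<le>N. fps_nth G n = run d (ps ! n)))"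
  proof (intro exI conjI allI impI)
    show "length (map p [0..<Suc N]) = Suc N" by simp
    fix d G n assume R: "R d G" and n: "n \<le> N"
    obtain z where "z \<in> Z" "dat z = d" "F z = G" using assms(2)[OF R] by blast
    then show "fps_nth G n = run d (map p [0..<Suc N] ! n)"
      using p[of z n] n by (simp add: nth_append less_Suc_eq_le del: upt_Suc)
  qed
qed

section \<open>Trigonometric polynomials with computed coefficients\<close>

inductive trig_procedural :: "'z set \<Rightarrow> ('z \<Rightarrow> 'v \<Rightarrow> real) \<Rightarrow> ('z \<times> real \<Rightarrow> real) \<Rightarrow> bool"
  for Z dat where
  trig_0: "(\<And>z \<theta>. z \<in> Z \<Longrightarrow> f (z, \<theta>) = 0) \<Longrightarrow> trig_procedural Z dat f"
| trig_term: "trig_procedural Z dat f \<Longrightarrow> procedural Z dat a \<Longrightarrow>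
    (\<And>z \<theta>. z \<in> Z \<Longrightarrow> g (z, \<theta>) = a z * (cos \<theta> ^ i * sin \<theta> ^ j) + f (z, \<theta>)) \<Longrightarrow> trig_procedural Z dat g"

lemma trig_procedural_cong:
  assumes "trig_procedural Z dat f" "\<And>z. z \<in> Z \<times> UNIV \<Longrightarrow> f z = g z"
  shows "trig_procedural Z dat g"
  using assms
proof (cases rule: trig_procedural.cases)
  case trig_0
  then show ?thesis using assms(2) by (intro trig_procedural.trig_0) auto
next
  case (trig_term f' a i j)
  show ?thesis
    by (rule trig_procedural.trig_term[OF trig_term(1,2)]) (use trig_term(3) assms(2) in auto)
qed

lemma trig_procedural_monomial:
  "procedural Z dat a \<Longrightarrow> trig_procedural Z dat (\<lambda>(z, \<theta>). a z * (cos \<theta> ^ i * sin \<theta> ^ j))"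
  by (rule trig_procedural.trig_term[OF trig_procedural.trig_0[of Z "\<lambda>_. 0"]]) auto

lemma trig_procedural_add:
  assumes "trig_procedural Z dat f" "trig_procedural Z dat g"
  shows "trig_procedural Z dat (\<lambda>z. f z + g z)"
  using assms(1)
proof induction
  case (trig_0 f)
  then show ?case using assms(2) by (auto elim!: trig_procedural_cong)
next
  case (trig_term f a g' i j)
  show ?case
    by (rule trig_procedural.trig_term[OF trig_term.IH trig_term.hyps(2)]) (use trig_term.hyps(3) in auto)
qed

lemma trig_procedural_monomial_mult:
  assumes "trig_procedural Z dat f" "procedural Z dat a"
  shows "trig_procedural Z dat (\<lambda>z. a (fst z) * (cos (snd z) ^ i * sin (snd z) ^ j) * f z)"
  using assms(1)
proof induction
  case (trig_0 f)
  then show ?case by (intro trig_procedural.trig_0) auto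
next
  case (trig_term f b g k l)
  show ?case
    by (rule trig_procedural.trig_term[OF trig_term.IH procedural_mult[OF assms(2) trig_term.hyps(2)], of _ "i + k" "j + l"])
      (use trig_term.hyps(3) in \<open>auto simp: power_add algebra_simps\<close>)
qed

lemma trig_procedural_mult:
  assumes "trig_procedural Z dat f" "trig_procedural Z dat g"
  shows "trig_procedural Z dat (\<lambda>z. f z * g z)"
  using assms(1)
proof induction
  case (trig_0 f)
  then show ?case by (intro trig_procedural.trig_0) auto
next
  case (trig_term f a g' i j)
  show ?case
    by (rule trig_procedural_cong[OF trig_procedural_add[OF
            trig_procedural_monomial_mult[OF assms(2) trig_term.hyps(2), of i j] trig_term.IH]])
      (use trig_term.hyps(3) in \<open>auto simp: algebra_simps\<close>)
qed

lemma trig_procedural_const: "procedural Z dat a \<Longrightarrow> trig_procedural Z dat (\<lambda>z. a (fst z))"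
  by (rule trig_procedural_cong[OF trig_procedural_monomial[of Z dat a 0 0]]) auto

lemma function_ring_trig: "function_ring (Z \<times> UNIV) (trig_procedural Z dat)"
  by unfold_locales (auto intro: trig_procedural_cong trig_procedural_add trig_procedural_mult
      trig_procedural_const[of Z dat "\<lambda>_. of_int _"] procedural_of_int)

text \<open>Lowering the exponents by two ends in four base cases; the only nonzero one is the
  length 2 \<pi> of the interval, which is where \<open>Pi\<close> enters the procedures.\<close>

lemma procedural_trig_moment: "procedural Z dat (\<lambda>_. trig_moment i j)"
proof (induction "i + j" arbitrary: i j rule: less_induct)
  case less
  consider "2 \<le> i" | "2 \<le> j" | "i < 2" "j < 2" by linarith
  then show ?case
  proof cases
    case 1
    then obtain i' where i: "i = i' + 2" by (metis add.commute le_Suc_ex)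
    show ?thesis unfolding i trig_moment_Suc2(1)
      by (intro procedural_mult procedural_divide procedural_of_nat less) (simp add: i)
  next
    case 2
    then obtain j' where j: "j = j' + 2" by (metis add.commute le_Suc_ex)
    show ?thesis unfolding j trig_moment_Suc2(2)
      by (intro procedural_mult procedural_divide procedural_of_nat less) (simp add: j)
  next
    case 3
    then have "i = 0 \<or> i = 1" "j = 0 \<or> j = 1" by auto
    then show ?thesis
      using trig_moment_base procedural_mult[OF procedural_numeral procedural_pi, of Z dat "num.Bit0 num.One"]
        procedural_0[of Z dat] by auto
  qed
qed

lemma trig_procedural_integral:
  assumes "trig_procedural Z dat f"
  shows "\<exists>I. procedural Z dat I \<and> (\<forall>z\<in>Z. ((\<lambda>\<theta>. f (z, \<theta>)) has_integral I z) {0..2 * pi})"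
  using assms
proof induction
  case (trig_0 f)
  then show ?case by (intro exI[of _ "\<lambda>_. 0"]) (auto intro: procedural_0)
next
  case (trig_term f a g i j)
  then obtain I where I: "procedural Z dat I" "\<And>z. z \<in> Z \<Longrightarrow> ((\<lambda>\<theta>. f (z, \<theta>)) has_integral I z) {0..2 * pi}"
    by blast
  show ?case
  proof (intro exI conjI ballI)
    show "procedural Z dat (\<lambda>z. a z * trig_moment i j + I z)"
      by (intro procedural_add procedural_mult procedural_trig_moment I trig_term.hyps)
    fix z assume z: "z \<in> Z"
    have "((\<lambda>\<theta>. a z * (cos \<theta> ^ i * sin \<theta> ^ j) + f (z, \<theta>)) has_integral (a z * trig_moment i j + I z)) {0..2 * pi}"
      by (intro has_integral_add has_integral_mult_right trig_has_integral I z)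
    then show "((\<lambda>\<theta>. g (z, \<theta>)) has_integral (a z * trig_moment i j + I z)) {0..2 * pi}"
      using trig_term.hyps(3)[OF z] by simp
  qed
qed

text \<open>An instance \<open>(d, H, c, r)\<close> consists of the data \<open>d\<close> given to the procedures, a Hamiltonian, its
  coefficients at the origin and a radius of convergence.\<close>

type_synonym 'v inst = "('v \<Rightarrow> real) \<times> (real \<times> real \<Rightarrow> real) \<times> (nat \<Rightarrow> nat \<Rightarrow> real) \<times> real"

text \<open>Isolates what the period series requires of the input: the Taylor coefficients of
  \<open>H\<close> must be computable from the data. For the polar expression this is verified
  separately.\<close>

locale procedural_coefficients =
  fixes Z :: "'v inst set"
  assumes morse: "(d, H, c, r) \<in> Z \<Longrightarrow> morse_hamiltonian H c r"
    and coeff: "procedural Z fst (\<lambda>(d, H, c, r). c i j)"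
begin

abbreviation coeffs :: "'v inst \<Rightarrow> nat \<Rightarrow> nat \<Rightarrow> real" where "coeffs z \<equiv> fst (snd (snd z))"

lemma morse': "z \<in> Z \<Longrightarrow> morse_hamiltonian (fst (snd z)) (coeffs z) (snd (snd (snd z)))"
  using morse by (cases z) auto

lemma coeff': "procedural Z fst (\<lambda>z. coeffs z i j)"
  using coeff[of i j] by (simp add: case_prod_unfold)

lemmas proc = procedural_add procedural_mult procedural_divide procedural_diff procedural_uminus
  procedural_power procedural_sqrt procedural_inverse procedural_numeral procedural_1 procedural_of_nat coeff'

text \<open>The frame constants as functions of an arbitrary instance; the defining equations inside
  the locale \<open>morse_hamiltonian\<close> are available only for instances in
  \<open>Z\<close>.\<close>

definition "z\<alpha> z = 2 * sqrt (coeffs z 0 2) / sqrt (4 * coeffs z 2 0 * coeffs z 0 2 - (coeffs z 1 1)\<^sup>2)"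
definition "z\<beta> z = - (coeffs z 1 1 * z\<alpha> z) / (2 * coeffs z 0 2)"
definition "z\<gamma> z = 1 / sqrt (coeffs z 0 2)"
definition "zJ z = 2 / sqrt (4 * coeffs z 2 0 * coeffs z 0 2 - (coeffs z 1 1)\<^sup>2)"

lemma z_eq:
  assumes "z \<in> Z"
  shows "morse_hamiltonian.\<alpha> (coeffs z) = z\<alpha> z" "morse_hamiltonian.\<beta> (coeffs z) = z\<beta> z"
    "morse_hamiltonian.\<gamma> (coeffs z) = z\<gamma> z" "morse_hamiltonian.J (coeffs z) = zJ z"
  using morse_hamiltonian.\<alpha>_def[OF morse'[OF assms]] morse_hamiltonian.\<beta>_def[OF morse'[OF assms]]
    morse_hamiltonian.\<gamma>_def[OF morse'[OF assms]] morse_hamiltonian.J_def[OF morse'[OF assms]]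
    morse_hamiltonian.disc_def[OF morse'[OF assms]]
  by (simp_all only: z\<alpha>_def z\<beta>_def z\<gamma>_def zJ_def)

lemma procedural_frame:
  "procedural Z fst z\<alpha>" "procedural Z fst z\<beta>" "procedural Z fst z\<gamma>" "procedural Z fst zJ"
  unfolding z\<alpha>_def[abs_def] z\<beta>_def[abs_def] z\<gamma>_def[abs_def] zJ_def[abs_def] by (intro proc)+

lemma trig_e:
  "trig_procedural Z fst (\<lambda>(z, \<theta>). morse_hamiltonian.e1 (coeffs z) \<theta>)"
  "trig_procedural Z fst (\<lambda>(z, \<theta>). morse_hamiltonian.e2 (coeffs z) \<theta>)"
proof -
  show "trig_procedural Z fst (\<lambda>(z, \<theta>). morse_hamiltonian.e1 (coeffs z) \<theta>)"
  proof (rule trig_procedural_cong[OF trig_procedural_monomial[OF procedural_frame(1), of 1 0]])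
    fix w assume "w \<in> Z \<times> (UNIV :: real set)"
    then obtain z \<theta> where w: "w = (z, \<theta>)" and z: "z \<in> Z" by blast
    show "(case w of (z, \<theta>) \<Rightarrow> z\<alpha> z * (cos \<theta> ^ 1 * sin \<theta> ^ 0))
        = (case w of (z, \<theta>) \<Rightarrow> morse_hamiltonian.e1 (coeffs z) \<theta>)"
      unfolding w prod.case morse_hamiltonian.e1_def[OF morse'[OF z]] z_eq[OF z] by simp
  qed
  show "trig_procedural Z fst (\<lambda>(z, \<theta>). morse_hamiltonian.e2 (coeffs z) \<theta>)"
  proof (rule trig_procedural_cong[OF trig_procedural_add[OF trig_procedural_monomial[OF procedural_frame(2), of 1 0]
            trig_procedural_monomial[OF procedural_frame(3), of 0 1]]])
    fix w assume "w \<in> Z \<times> (UNIV :: real set)"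
    then obtain z \<theta> where w: "w = (z, \<theta>)" and z: "z \<in> Z" by blast
    show "(case w of (z, \<theta>) \<Rightarrow> z\<beta> z * (cos \<theta> ^ 1 * sin \<theta> ^ 0)) + (case w of (z, \<theta>) \<Rightarrow> z\<gamma> z * (cos \<theta> ^ 0 * sin \<theta> ^ 1))
        = (case w of (z, \<theta>) \<Rightarrow> morse_hamiltonian.e2 (coeffs z) \<theta>)"
      unfolding w prod.case morse_hamiltonian.e2_def[OF morse'[OF z]] z_eq[OF z] by simp
  qed
qed

lemma trig_a: "trig_procedural Z fst (\<lambda>z. morse_hamiltonian.a (coeffs (fst z)) (snd z) n)"
proof -
  interpret function_ring "Z \<times> UNIV" "trig_procedural Z fst" by (rule function_ring_trig)
  show ?thesis
  proof (rule cong)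
    show "trig_procedural Z fst (\<lambda>z. \<Sum>i\<le>n + 3. coeffs (fst z) i (n + 3 - i) *
        morse_hamiltonian.e1 (coeffs (fst z)) (snd z) ^ i * morse_hamiltonian.e2 (coeffs (fst z)) (snd z) ^ (n + 3 - i))"
      using trig_e by (intro sum mult power trig_procedural_const coeff') (simp_all add: case_prod_unfold)
    fix z assume "z \<in> Z \<times> (UNIV :: real set)"
    then have z: "fst z \<in> Z" by auto
    show "(\<Sum>i\<le>n + 3. coeffs (fst z) i (n + 3 - i) *
        morse_hamiltonian.e1 (coeffs (fst z)) (snd z) ^ i * morse_hamiltonian.e2 (coeffs (fst z)) (snd z) ^ (n + 3 - i))
        = morse_hamiltonian.a (coeffs (fst z)) (snd z) n"
      unfolding morse_hamiltonian.a_def[OF morse'[OF z]] morse_hamiltonian.k_def[OF morse'[OF z]] ..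
  qed
qed

lemma trig_q: "trig_procedural Z fst (\<lambda>z. morse_hamiltonian.q (coeffs (fst z)) (snd z) n)"
proof -
  interpret function_ring "Z \<times> UNIV" "trig_procedural Z fst" by (rule function_ring_trig)
  let ?a = "\<lambda>z. morse_hamiltonian.a (coeffs (fst z)) (snd z)"
  let ?P = "\<lambda>z. geometric_bound.P (?a z)"
  have P0: "fps_nth (?P z) 0 = 1" if "z \<in> Z \<times> UNIV" for z
    using morse_hamiltonian.P_0[OF morse'[of "fst z"]] that by auto
  have P: "trig_procedural Z fst (\<lambda>z. fps_nth (?P z) n)" for n
  proof (rule implicit_coeffs[where q = "\<lambda>_. 1" and A = "\<lambda>z. Abs_fps (?a z)"])
    show "trig_procedural Z fst (\<lambda>z. fps_nth (Abs_fps (?a z)) n)" for n using trig_a by simp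
    show "trig_procedural Z fst (\<lambda>_. 1)" by (rule one)
    show "trig_procedural Z fst (\<lambda>z. fps_nth (?P z) 0)" by (rule cong[OF one]) (simp add: P0)
    \<comment> \<open>The recursion divides only by twice the constant term, which is 2 for every
      angle. Division by a function of the angle would leave the ring of trigonometric
      polynomials.\<close>
    have "trig_procedural Z fst (\<lambda>z. inverse 2)"
      by (rule trig_procedural_const) (intro proc)
    then show "trig_procedural Z fst (\<lambda>z. inverse (2 * 1 * fps_nth (?P z) 0))"
      by (rule cong) (simp add: P0)
    fix z :: "'v inst \<times> real" assume z: "z \<in> Z \<times> UNIV"
    show "1 * fps_nth (?P z) 0 \<noteq> 0" using P0[OF z] by simp
    have "fst z \<in> Z" using z by auto
    from geometric_bound.P_equation[OF morse_hamiltonian.gb[OF morse'[OF this]], of "snd z"]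
    show "fps_const 1 * ?P z ^ 2 + fps_X * ?P z ^ 3 * (Abs_fps (?a z) oo (fps_X * ?P z)) = 1" by simp
  qed
  have "trig_procedural Z fst (\<lambda>z. \<Sum>i=0..n. fps_nth (?P z) i * fps_nth (?P z) (n - i))"
    by (intro sum mult P)
  then show ?thesis
  proof (rule cong)
    fix z assume "z \<in> Z \<times> (UNIV :: real set)"
    then have z: "fst z \<in> Z" by auto
    show "(\<Sum>i=0..n. fps_nth (?P z) i * fps_nth (?P z) (n - i)) = morse_hamiltonian.q (coeffs (fst z)) (snd z) n"
      unfolding morse_hamiltonian.q_def[OF morse'[OF z]] power2_eq_square fps_mult_nth ..
  qed
qed

lemma procedural_period_fps: "procedural Z fst (\<lambda>z. fps_nth (morse_hamiltonian.period_fps (coeffs z)) m)"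
proof -
  obtain I where I: "procedural Z fst I"
    "\<And>z. z \<in> Z \<Longrightarrow> ((\<lambda>\<theta>. morse_hamiltonian.q (coeffs z) \<theta> (2 * m)) has_integral I z) {0..2 * pi}"
    using trig_procedural_integral[OF trig_q[of "2 * m"]] by auto
  have "procedural Z fst (\<lambda>z. zJ z * of_nat (Suc m) * (I z / 2))"
    by (intro proc procedural_frame I)
  then show ?thesis
  proof (rule procedural_cong)
    fix z assume z: "z \<in> Z"
    show "zJ z * of_nat (Suc m) * (I z / 2) = fps_nth (morse_hamiltonian.period_fps (coeffs z)) m"
      using integral_unique[OF I(2)[OF z]]
      by (simp add: morse_hamiltonian.period_fps_def[OF morse'[OF z]] morse_hamiltonian.Q_def[OF morse'[OF z]] z_eq[OF z])
  qed
qed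

lemma procedural_axis_period:
  "procedural Z fst (\<lambda>z. fps_nth (morse_hamiltonian.period_fps (coeffs z) oo Abs_fps (coeffs z 0)) n)"
proof -
  interpret function_ring Z "procedural Z (fst :: 'v inst \<Rightarrow> _)" by (rule function_ring_procedural)
  have "coeffs_upto n (\<lambda>z. morse_hamiltonian.period_fps (coeffs z) oo Abs_fps (coeffs z 0))"
    by (rule coeffs_upto_compose) (simp_all add: coeffs_upto_def procedural_period_fps coeff')
  then show ?thesis by (simp add: coeffs_upto_def)
qed

end

text \<open>Writing \<open>F = X P\<close> brings \<open>G oo F = X\<^sup>2\<close> into the form of the implicit equation above.\<close>

lemma axis_equation:
  fixes F G :: "real fps"
  assumes G: "fps_nth G 0 = 0" "fps_nth G 1 = 0" and F0: "fps_nth F 0 = 0" and eq: "G oo F = fps_X ^ 2"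
  defines "P \<equiv> fps_shift 1 F"
  shows "fps_const (fps_nth G 2) * P ^ 2 + fps_X * P ^ 3 * (fps_shift 3 G oo (fps_X * P)) = 1"
    "fps_nth G 2 * fps_nth P 0 ^ 2 = 1"
proof -
  have F: "F = fps_X * P"
    by (rule fps_ext) (use F0 in \<open>simp add: P_def fps_X_mult_nth split: nat.split\<close>)
  have G': "G = fps_const (fps_nth G 2) * fps_X ^ 2 + fps_X ^ 3 * fps_shift 3 G"
  proof (rule fps_ext)
    fix n :: nat
    consider "n = 0" | "n = 1" | "n = 2" | "3 \<le> n" by linarith
    then show "fps_nth G n = fps_nth (fps_const (fps_nth G 2) * fps_X ^ 2 + fps_X ^ 3 * fps_shift 3 G) n"
      by cases (use G in \<open>auto simp: fps_X_power_mult_nth fps_X_power_nth\<close>)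
  qed
  have X: "fps_X oo F = F" using F0 by (simp add: fps_X_fps_compose_startby0)
  have "G oo F = fps_const (fps_nth G 2) * F ^ 2 + F ^ 3 * (fps_shift 3 G oo F)"
    by (subst G') (simp add: fps_compose_add_distrib fps_compose_mult_distrib[OF F0] fps_compose_power[OF F0, symmetric] X)
  moreover have "g * F ^ 2 + F ^ 3 * E = fps_X ^ 2 * (g * P ^ 2 + fps_X * P ^ 3 * E)" for g E :: "real fps"
    unfolding F by (simp add: algebra_simps power2_eq_square power3_eq_cube)
  ultimately have "fps_X ^ 2 = fps_X ^ 2 * (fps_const (fps_nth G 2) * P ^ 2 + fps_X * P ^ 3 * (fps_shift 3 G oo F))"
    unfolding eq by simp
  then have "fps_X ^ 2 * (fps_const (fps_nth G 2) * P ^ 2 + fps_X * P ^ 3 * (fps_shift 3 G oo F)) = fps_X ^ 2 * 1"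
    by simp
  then show *: "fps_const (fps_nth G 2) * P ^ 2 + fps_X * P ^ 3 * (fps_shift 3 G oo (fps_X * P)) = 1"
    unfolding F[symmetric] by (subst (asm) mult_left_cancel) auto
  have "fps_nth (fps_const (fps_nth G 2) * P ^ 2 + fps_X * P ^ 3 * (fps_shift 3 G oo (fps_X * P))) 0 = fps_nth 1 0"
    unfolding * ..
  then show "fps_nth G 2 * fps_nth P 0 ^ 2 = 1" by (simp add: mult.assoc power2_eq_square)
qed

text \<open>The coefficient of \<open>F\<close> at order 1 has square 1 / d 2, and its sign is
  settled by the condition that it be nonnegative, so it is computed by one square root; all later
  coefficients follow from the recursion by field operations.\<close>

lemma procedural_axis_solution:
  fixes Z :: "((nat \<Rightarrow> real) \<times> real fps) set"
  assumes Z: "\<And>d F. (d, F) \<in> Z \<Longrightarrow> d 0 = 0 \<and> d 1 = 0 \<and> 0 < d 2 \<and> fps_nth F 0 = 0 \<and> 0 \<le> fps_nth F 1 \<and>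
      Abs_fps d oo F = fps_X ^ 2"
  shows "procedural Z fst (\<lambda>z. fps_nth (snd z) n)"
proof -
  interpret function_ring Z "procedural Z (fst :: (nat \<Rightarrow> real) \<times> real fps \<Rightarrow> _)" by (rule function_ring_procedural)
  let ?P = "\<lambda>z :: (nat \<Rightarrow> real) \<times> real fps. fps_shift 1 (snd z)"
  have eqs: "fps_const (fst z 2) * ?P z ^ 2 + fps_X * ?P z ^ 3 * (fps_shift 3 (Abs_fps (fst z)) oo (fps_X * ?P z)) = 1"
    "fst z 2 * fps_nth (?P z) 0 ^ 2 = 1" "0 < fst z 2" "0 \<le> fps_nth (?P z) 0" if "z \<in> Z" for z
  proof -
    have "fst z 0 = 0 \<and> fst z 1 = 0 \<and> 0 < fst z 2 \<and> fps_nth (snd z) 0 = 0 \<and> 0 \<le> fps_nth (snd z) 1 \<and>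
      Abs_fps (fst z) oo snd z = fps_X ^ 2"
      using Z[of "fst z" "snd z"] that by simp
    then have h: "fps_nth (Abs_fps (fst z)) 0 = 0" "fps_nth (Abs_fps (fst z)) 1 = 0" "0 < fst z 2"
      "fps_nth (snd z) 0 = 0" "0 \<le> fps_nth (snd z) 1" "Abs_fps (fst z) oo snd z = fps_X ^ 2"
      by simp_all
    show "fps_const (fst z 2) * ?P z ^ 2 + fps_X * ?P z ^ 3 * (fps_shift 3 (Abs_fps (fst z)) oo (fps_X * ?P z)) = 1"
      "fst z 2 * fps_nth (?P z) 0 ^ 2 = 1"
      using axis_equation[OF h(1,2,4,6)] by (simp_all only: fps_nth_Abs_fps)
    show "0 < fst z 2" "0 \<le> fps_nth (?P z) 0" using h by simp_all
  qed
  have P0: "fps_nth (?P z) 0 = 1 / sqrt (fst z 2)" if "z \<in> Z" for z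
  proof -
    have "fps_nth (?P z) 0 ^ 2 = 1 / fst z 2" using eqs(2,3)[OF that] by (simp add: field_simps)
    then have "fps_nth (?P z) 0 = sqrt (1 / fst z 2)" using eqs(4)[OF that] by (metis real_sqrt_unique)
    then show ?thesis by (simp add: real_sqrt_divide)
  qed
  have p0: "procedural Z fst (\<lambda>z. fps_nth (?P z) 0)"
  proof (rule procedural_cong[of Z fst "\<lambda>z. 1 / sqrt (fst z 2)"])
    show "procedural Z fst (\<lambda>z. 1 / sqrt (fst z 2))"
      by (intro procedural_divide procedural_1 procedural_sqrt procedural_datum)
  qed (simp only: P0)
  have P: "procedural Z fst (\<lambda>z. fps_nth (?P z) n)" for n
  proof (rule implicit_coeffs[where q = "\<lambda>z. fst z 2" and A = "\<lambda>z. fps_shift 3 (Abs_fps (fst z))"])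
    show "procedural Z fst (\<lambda>z. fps_nth (fps_shift 3 (Abs_fps (fst z))) n)" for n
      using procedural_datum[of Z fst "n + 3"] by simp
    show q: "procedural Z fst (\<lambda>z. fst z 2)" by (rule procedural_datum)
    show "procedural Z fst (\<lambda>z. fps_nth (?P z) 0)" by (rule p0)
    show "procedural Z fst (\<lambda>z. inverse (2 * fst z 2 * fps_nth (?P z) 0))"
      by (intro procedural_inverse procedural_mult procedural_numeral q p0)
    fix z assume z: "z \<in> Z"
    show "fst z 2 * fps_nth (?P z) 0 \<noteq> 0" using eqs(2)[OF z] by auto
    show "fps_const (fst z 2) * ?P z ^ 2 + fps_X * ?P z ^ 3 * (fps_shift 3 (Abs_fps (fst z)) oo (fps_X * ?P z)) = 1"
      by (rule eqs(1)[OF z])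
  qed
  show ?thesis
  proof (cases n)
    case 0
    show ?thesis by (rule procedural_cong[OF procedural_0]) (use Z 0 in auto)
  next
    case (Suc m)
    show ?thesis by (rule procedural_cong[OF P[of m]]) (simp add: Suc)
  qed
qed

section \<open>The polar expression of a Hamiltonian field\<close>

text \<open>Polar radii are positive, so two expansions can be compared only to the right of 0;
  convergence at \<open>e / 2\<close> provides a positive radius of convergence.\<close>

lemma powser_eq_right:
  fixes a b :: "nat \<Rightarrow> real"
  assumes e: "0 < e" and a: "\<And>t. 0 < t \<Longrightarrow> t < e \<Longrightarrow> (\<lambda>n. a n * t ^ n) sums f t"
    and b: "\<And>t. 0 < t \<Longrightarrow> t < e \<Longrightarrow> (\<lambda>n. b n * t ^ n) sums f t"
  shows "a = b"
proof -
  have exp: "eval_fps (Abs_fps a) has_fps_expansion Abs_fps a \<and> (\<forall>t. 0 < t \<and> t < e \<longrightarrow> eval_fps (Abs_fps a) t = f t)"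
    if "\<And>t. 0 < t \<Longrightarrow> t < e \<Longrightarrow> (\<lambda>n. a n * t ^ n) sums f t" for a :: "nat \<Rightarrow> real"
  proof
    have "summable (\<lambda>n. fps_nth (Abs_fps a) n * (e / 2) ^ n)"
      using that[of "e / 2"] e by (auto simp: sums_iff)
    then have "ereal (norm (e / 2)) \<le> fps_conv_radius (Abs_fps a)"
      unfolding fps_conv_radius_def by (rule conv_radius_geI)
    moreover have "0 < ereal (norm (e / 2))" using e by simp
    ultimately have "0 < fps_conv_radius (Abs_fps a)" by (rule less_le_trans[rotated])
    then show "eval_fps (Abs_fps a) has_fps_expansion Abs_fps a" by (rule eval_fps_has_fps_expansion)
  qed (use that in \<open>auto simp: eval_fps_def sums_iff\<close>)
  have "Abs_fps a = Abs_fps b"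
  proof (rule fps_expansion_unique_right)
    show "eval_fps (Abs_fps a) has_fps_expansion Abs_fps a" "eval_fps (Abs_fps b) has_fps_expansion Abs_fps b"
      using exp[OF a] exp[OF b] by simp_all
    show "\<forall>\<^sub>F t in at_right 0. eval_fps (Abs_fps a) t = eval_fps (Abs_fps b) t"
      using exp[OF a] exp[OF b] e by (intro eventually_at_rightI[of 0 e]) auto
  qed
  then show ?thesis by (simp add: fps_eq_iff fun_eq_iff)
qed

text \<open>Dividing by the \<open>n\<close>-th power of the sine gives polynomials in the
  cotangent, and every real \<open>x\<close> is a cotangent: normalise the vector (x, 1).
  Polynomials that agree everywhere have equal coefficients.\<close>

lemma homogeneous_cos_sin_eq:
  fixes a b :: "nat \<Rightarrow> real"
  assumes "\<And>\<theta>. (\<Sum>j\<le>n. a j * cos \<theta> ^ j * sin \<theta> ^ (n - j)) = (\<Sum>j\<le>n. b j * cos \<theta> ^ j * sin \<theta> ^ (n - j))"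
    and "i \<le> n"
  shows "a i = b i"
proof -
  have "(\<Sum>j\<le>n. a j * x ^ j) = (\<Sum>j\<le>n. b j * x ^ j)" for x :: real
  proof -
    define m where "m = sqrt (1 + x\<^sup>2)"
    have m: "0 < m" "m\<^sup>2 = 1 + x\<^sup>2" by (auto simp: m_def add_pos_nonneg)
    have "(x / m)\<^sup>2 + (1 / m)\<^sup>2 = (x\<^sup>2 + 1) / m\<^sup>2" by (simp add: power_divide add_divide_distrib)
    also have "x\<^sup>2 + 1 = m\<^sup>2" unfolding m(2) by (rule add.commute)
    also have "m\<^sup>2 / m\<^sup>2 = 1" using m(1) by simp
    finally obtain t where t: "x / m = cos t" "1 / m = sin t" using sincos_total_2pi by metis
    have *: "(\<Sum>j\<le>n. a j * cos t ^ j * sin t ^ (n - j)) = (\<Sum>j\<le>n. a j * x ^ j) / m ^ n" for a :: "nat \<Rightarrow> real"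
      unfolding sum_divide_distrib
    proof (rule sum.cong)
      fix j assume "j \<in> {..n}"
      then have "m ^ n = m ^ j * m ^ (n - j)" by (simp flip: power_add)
      then show "a j * cos t ^ j * sin t ^ (n - j) = a j * x ^ j / m ^ n"
        unfolding t[symmetric] by (simp add: power_divide)
    qed simp
    show ?thesis using assms(1)[of t] m unfolding * by simp
  qed
  then show ?thesis using polyfun_eq_coeffs[of a n b] assms(2) by blast
qed

context morse_hamiltonian
begin

text \<open>For a Hamiltonian field the angular velocity is the radial derivative of
  \<open>H\<close> divided by the radius, now in ordinary polar coordinates. By homogeneity the part
  of degree n + 2 is simply multiplied by n + 2.\<close>

lemma angular_sums:
  assumes t: "0 < t" "t < r"
  shows "(\<lambda>n. (\<Sum>j\<le>n + 2. real (n + 2) * c j (n + 2 - j) * cos \<theta> ^ j * sin \<theta> ^ (n + 2 - j)) * t ^ n) sums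
    ((cos \<theta> * partial_x H (t * cos \<theta>, t * sin \<theta>) + sin \<theta> * partial_y H (t * cos \<theta>, t * sin \<theta>)) / t)"
proof -
  define h where "h n = (\<Sum>i\<le>n. c i (n - i) * cos \<theta> ^ i * sin \<theta> ^ (n - i))" for n
  have box: "\<bar>u * cos \<theta>\<bar> < r \<and> \<bar>u * sin \<theta>\<bar> < r" if "\<bar>u\<bar> < r" for u
  proof -
    have "\<bar>u\<bar> * \<bar>cos \<theta>\<bar> \<le> \<bar>u\<bar> * 1" "\<bar>u\<bar> * \<bar>sin \<theta>\<bar> \<le> \<bar>u\<bar> * 1" by (intro mult_left_mono; simp)+
    then show ?thesis unfolding abs_mult using that by linarith
  qed
  have Hs: "(\<lambda>n. h n * u ^ n) sums H (u * cos \<theta>, u * sin \<theta>)" if "\<bar>u\<bar> < r" for u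
    unfolding h_def by (rule double_series_ray[OF H]) (use box[OF that] in auto)
  have t': "norm t < r" using t by simp
  have sm: "summable (\<lambda>n. h n * u ^ n)" if "norm u < r" for u
    using Hs[of u] that by (auto simp: sums_iff)
  have "((\<lambda>u. \<Sum>n. h n * u ^ n) has_real_derivative (\<Sum>n. diffs h n * t ^ n)) (at t)"
    by (rule termdiffs_strong'[OF sm t'])
  then have 1: "((\<lambda>u. H (u * cos \<theta>, u * sin \<theta>)) has_real_derivative (\<Sum>n. diffs h n * t ^ n)) (at t)"
    by (rule has_field_derivative_transform_within_open[where S = "{-r<..<r}"])
      (use t Hs in \<open>auto simp: sums_iff abs_less_iff\<close>)
  define X where "X = cos \<theta> * partial_x H (t * cos \<theta>, t * sin \<theta>) + sin \<theta> * partial_y H (t * cos \<theta>, t * sin \<theta>)"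
  have "((\<lambda>u. (u * cos \<theta>, u * sin \<theta>)) has_derivative (\<lambda>s. (s * cos \<theta>, s * sin \<theta>))) (at t)"
    by (auto intro!: derivative_eq_intros)
  then have "((\<lambda>u. H (u * cos \<theta>, u * sin \<theta>)) has_derivative
      (\<lambda>s. (\<lambda>(x, y). x * partial_x H (t * cos \<theta>, t * sin \<theta>) + y * partial_y H (t * cos \<theta>, t * sin \<theta>))
        (s * cos \<theta>, s * sin \<theta>))) (at t)"
    by (rule has_derivative_compose[where g = H])
      (rule double_series_has_derivative[OF H]; use box[of t] t in simp)
  then have 2: "((\<lambda>u. H (u * cos \<theta>, u * sin \<theta>)) has_real_derivative X) (at t)"
    unfolding has_field_derivative_def
    by (rule has_derivative_eq_rhs) (simp add: X_def fun_eq_iff algebra_simps)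
  have "summable (\<lambda>n. diffs h n * t ^ n)"
    by (rule termdiff_converges[OF t' sm])
  then have "(\<lambda>n. diffs h n * t ^ n) sums X"
    using DERIV_unique[OF 1 2] by (simp add: sums_iff)
  \<comment> \<open>The linear part of \<open>H\<close> vanishes, so the derivative starts at order
    1 and the division by \<open>t\<close> shifts the series by one.\<close>
  moreover have "diffs h 0 = 0" using c10 c01 by (simp add: diffs_def h_def)
  ultimately have "(\<lambda>n. diffs h (Suc n) * t ^ Suc n) sums X"
    by (subst sums_Suc_iff) simp
  then have "(\<lambda>n. diffs h (Suc n) * t ^ Suc n / t) sums (X / t)" by (rule sums_divide)
  moreover have "diffs h (Suc n) * t ^ Suc n / t
      = (\<Sum>j\<le>n + 2. real (n + 2) * c j (n + 2 - j) * cos \<theta> ^ j * sin \<theta> ^ (n + 2 - j)) * t ^ n" for n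
  proof -
    have "diffs h (Suc n) = (\<Sum>j\<le>n + 2. real (n + 2) * c j (n + 2 - j) * cos \<theta> ^ j * sin \<theta> ^ (n + 2 - j))"
      by (simp only: diffs_def h_def sum_distrib_left mult.assoc add_2_eq_Suc')
    then show ?thesis using t by simp
  qed
  ultimately show ?thesis unfolding X_def[symmetric] by simp
qed

text \<open>The coefficient of cos^j sin^(m + 1 - j) in sin H_x - cos H_y at degree
  \<open>m\<close>. The factor sin keeps the power of cos and the factor cos raises it by one, hence
  the shifted index in the second part.\<close>

definition radial_coeff where
  "radial_coeff m j = (if j \<le> m then real (Suc j) * c (Suc j) (m - j) else 0)
    - (case j of 0 \<Rightarrow> 0 | Suc i \<Rightarrow> real (Suc (m - i)) * c i (Suc (m - i)))"

lemma radial_sums: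
  assumes t: "0 < t" "t < r"
  shows "(\<lambda>n. (\<Sum>j\<le>n + 1. radial_coeff n j * cos \<theta> ^ j * sin \<theta> ^ (n + 1 - j)) * t ^ n) sums
    (sin \<theta> * partial_x H (t * cos \<theta>, t * sin \<theta>) - cos \<theta> * partial_y H (t * cos \<theta>, t * sin \<theta>))"
proof -
  define u v where "u = cos \<theta>" and "v = sin \<theta>"
  have "\<bar>t\<bar> * \<bar>cos \<theta>\<bar> \<le> \<bar>t\<bar> * 1" "\<bar>t\<bar> * \<bar>sin \<theta>\<bar> \<le> \<bar>t\<bar> * 1" by (intro mult_left_mono; simp)+
  then have box: "\<bar>t * u\<bar> < r" "\<bar>t * v\<bar> < r" unfolding u_def v_def abs_mult using t by linarith+
  let ?A = "\<lambda>n. \<Sum>i\<le>n. real (Suc i) * c (Suc i) (n - i) * u ^ i * v ^ (n - i)"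
  let ?B = "\<lambda>n. \<Sum>i\<le>n. real (Suc (n - i)) * c i (Suc (n - i)) * u ^ i * v ^ (n - i)"
  have "(\<lambda>n. v * (?A n * t ^ n) - u * (?B n * t ^ n)) sums (v * partial_x H (t * u, t * v) - u * partial_y H (t * u, t * v))"
    by (intro sums_diff sums_mult double_series_ray[OF double_series_partial_x(1)[OF H] box]
        double_series_ray[OF double_series_partial_y(1)[OF H] box])
  moreover have "v * (?A n * t ^ n) - u * (?B n * t ^ n)
      = (\<Sum>j\<le>n + 1. radial_coeff n j * u ^ j * v ^ (n + 1 - j)) * t ^ n" for n
  proof -
    let ?x = "\<lambda>j. (if j \<le> n then real (Suc j) * c (Suc j) (n - j) else 0) * u ^ j * v ^ (n + 1 - j)"
    let ?y = "\<lambda>j. (case j of 0 \<Rightarrow> 0 | Suc i \<Rightarrow> real (Suc (n - i)) * c i (Suc (n - i))) * u ^ j * v ^ (n + 1 - j)"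
    have "(\<Sum>j\<le>Suc n. ?x j) = (\<Sum>j\<le>n. ?x j)" by simp
    also have "\<dots> = v * ?A n"
      unfolding sum_distrib_left by (rule sum.cong) (auto simp: Suc_diff_le)
    finally have x: "(\<Sum>j\<le>Suc n. ?x j) = v * ?A n" .
    have "(\<Sum>j\<le>Suc n. ?y j) = (\<Sum>i\<le>n. ?y (Suc i))" by (subst sum.atMost_Suc_shift) simp
    also have "\<dots> = u * ?B n"
      unfolding sum_distrib_left by (rule sum.cong) auto
    finally have y: "(\<Sum>j\<le>Suc n. ?y j) = u * ?B n" .
    have "(\<Sum>j\<le>n + 1. radial_coeff n j * u ^ j * v ^ (n + 1 - j)) = (\<Sum>j\<le>Suc n. ?x j - ?y j)"
      unfolding radial_coeff_def by (rule sum.cong) (auto simp: left_diff_distrib)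
    also have "\<dots> = v * ?A n - u * ?B n" unfolding sum_subtractf x y ..
    finally show ?thesis by (simp only: left_diff_distrib mult.assoc)
  qed
  ultimately show ?thesis by (simp only: u_def v_def)
qed

lemma polar_expression_exists: "\<exists>d. polar_expression (hamiltonian_field H) d"
proof
  let ?d = "\<lambda>i. case i of Radial m j \<Rightarrow> radial_coeff m j | Angular m j \<Rightarrow> real (m + 2) * c j (m + 2 - j)"
  show "polar_expression (hamiltonian_field H) ?d"
    unfolding polar_expression_def Let_def
  proof (intro exI[of _ r] conjI allI impI)
    fix t \<theta> :: real assume "0 < t \<and> t < r"
    then show "(\<lambda>m. (\<Sum>j\<le>m + 1. ?d (Radial m j) * cos \<theta> ^ j * sin \<theta> ^ (m + 1 - j)) * t ^ m) sums
        (cos \<theta> * fst (hamiltonian_field H (t * cos \<theta>, t * sin \<theta>)) +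
         sin \<theta> * snd (hamiltonian_field H (t * cos \<theta>, t * sin \<theta>)))"
      and "(\<lambda>m. (\<Sum>j\<le>m + 2. ?d (Angular m j) * cos \<theta> ^ j * sin \<theta> ^ (m + 2 - j)) * t ^ m) sums
        ((cos \<theta> * snd (hamiltonian_field H (t * cos \<theta>, t * sin \<theta>)) -
          sin \<theta> * fst (hamiltonian_field H (t * cos \<theta>, t * sin \<theta>))) / t)"
      using radial_sums[of t \<theta>] angular_sums[of t \<theta>] by (simp_all add: hamiltonian_field_def)
  qed (rule r)
qed

text \<open>The angular data are the coefficients of \<open>H\<close> multiplied by their degree;
  uniqueness first in the radius and then in the angle allows reading them back.\<close>

lemma polar_expression_coeff:
  assumes d: "polar_expression (hamiltonian_field H) d" and ij: "2 \<le> i + j"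
  shows "c i j = d (Angular (i + j - 2) i) / real (i + j)"
proof -
  obtain r0 where r0: "0 < r0" and sums: "\<And>t \<theta>. 0 < t \<Longrightarrow> t < r0 \<Longrightarrow>
      (\<lambda>m. (\<Sum>j\<le>m + 2. d (Angular m j) * cos \<theta> ^ j * sin \<theta> ^ (m + 2 - j)) * t ^ m) sums
        ((cos \<theta> * snd (hamiltonian_field H (t * cos \<theta>, t * sin \<theta>)) -
          sin \<theta> * fst (hamiltonian_field H (t * cos \<theta>, t * sin \<theta>))) / t)"
    using d unfolding polar_expression_def Let_def by blast
  have "(\<lambda>m. \<Sum>j\<le>m + 2. d (Angular m j) * cos \<theta> ^ j * sin \<theta> ^ (m + 2 - j))
      = (\<lambda>m. \<Sum>j\<le>m + 2. real (m + 2) * c j (m + 2 - j) * cos \<theta> ^ j * sin \<theta> ^ (m + 2 - j))" for \<theta>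
  proof (rule powser_eq_right)
    show "0 < min r0 r" using r0 r by simp
    fix t assume t: "0 < t" "t < min r0 r"
    show "(\<lambda>m. (\<Sum>j\<le>m + 2. d (Angular m j) * cos \<theta> ^ j * sin \<theta> ^ (m + 2 - j)) * t ^ m) sums
        ((cos \<theta> * partial_x H (t * cos \<theta>, t * sin \<theta>) + sin \<theta> * partial_y H (t * cos \<theta>, t * sin \<theta>)) / t)"
      using sums[of t \<theta>] t by (simp add: hamiltonian_field_def)
    show "(\<lambda>n. (\<Sum>j\<le>n + 2. real (n + 2) * c j (n + 2 - j) * cos \<theta> ^ j * sin \<theta> ^ (n + 2 - j)) * t ^ n) sums
        ((cos \<theta> * partial_x H (t * cos \<theta>, t * sin \<theta>) + sin \<theta> * partial_y H (t * cos \<theta>, t * sin \<theta>)) / t)"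
      by (rule angular_sums) (use t in auto)
  qed
  from fun_cong[OF this, of "i + j - 2"]
  have "d (Angular (i + j - 2) i) = real (i + j - 2 + 2) * c i (i + j - 2 + 2 - i)"
    by (rule homogeneous_cos_sin_eq[where n = "i + j - 2 + 2" and a = "\<lambda>i'. d (Angular (i + j - 2) i')"
          and b = "\<lambda>j'. real (i + j - 2 + 2) * c j' (i + j - 2 + 2 - j')"]) simp
  moreover have "i + j - 2 + 2 = i + j" using ij by simp
  ultimately show ?thesis using ij by simp
qed

section \<open>The period in terms of the starting point\<close>

text \<open>\<open>e1\<close> has no sine term: the frame is triangular precisely so that the angle
  \<pi> / 2 is the positive y-axis, where the orbits in question start.\<close>

lemma y_axis_ray: "ray t (pi / 2) = (0, \<gamma> * t)"
  by (simp add: ray_def e1_def e2_def)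

text \<open>The point (0, \<rho>) lies on the level curve of its own energy, and every solution from
  there has the period of that curve, so the description in \<open>period_from_axis\<close> has a
  single value. Existence of a solution comes from the period neighborhood.\<close>

lemma period_from_axis_eq:
  assumes "period_neighborhood (hamiltonian_field H) U (0, 0) W"
  shows "\<forall>\<^sub>F \<rho> in at_right 0. period_from_axis H U \<rho> = eval_fps period_fps (H (0, \<rho>))"
proof -
  obtain \<epsilon> where \<epsilon>: "0 < \<epsilon>" "\<epsilon> \<le> \<sigma>"
    and orb: "\<And>s q. 0 < s \<Longrightarrow> s < \<epsilon> \<Longrightarrow> q \<in> curve s \<Longrightarrow>
      \<exists>\<phi>. periodic_orbit_around (hamiltonian_field H) U (0, 0) \<phi> \<and> \<phi> 0 = q"
    using period_neighborhood_orbits[OF assms] by metis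
  have H0: "H (0, 0) = 0" using double_series_at_0[OF H r] c00 by simp
  have "isCont (\<lambda>\<rho>. H (0, \<rho>)) 0"
    using has_fps_expansion_imp_continuous[OF y_axis_has_fps_expansion[OF H r], of UNIV] by simp
  then have "((\<lambda>\<rho>. H (0, \<rho>)) \<longlongrightarrow> 0) (at 0)" by (simp add: isCont_def H0)
  then have "((\<lambda>\<rho>. H (0, \<rho>)) \<longlongrightarrow> 0) (at_right 0)" by (rule tendsto_within_subset) simp
  then have "\<forall>\<^sub>F \<rho> in at_right 0. H (0, \<rho>) < \<epsilon>\<^sup>2"
    by (rule order_tendstoD(2)) (use \<epsilon> in simp)
  moreover have "\<forall>\<^sub>F \<rho> in at_right 0. \<rho> < \<gamma> * (4 * \<delta>)"
    by (rule eventually_at_rightI[of 0 "\<gamma> * (4 * \<delta>)"]) (use \<gamma>_pos \<delta> in auto)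
  ultimately show ?thesis
    using eventually_at_right_less[of "0::real"]
  proof eventually_elim
    case (elim \<rho>)
    define s where "s = sqrt (H (0, \<rho>))"
    have ray: "(0, \<rho>) = ray (\<rho> / \<gamma>) (pi / 2)" using \<gamma>_pos by (simp add: y_axis_ray)
    have \<rho>: "0 < \<rho> / \<gamma>" "\<rho> / \<gamma> < 4 * \<delta>" using elim \<gamma>_pos by (simp_all add: field_simps)
    have "0 < H (0, \<rho>)"
      using H_ray_strict_mono[of 0 "\<rho> / \<gamma>" "pi / 2"] \<rho> H0 unfolding ray[symmetric] by (simp add: ray_def)
    then have s: "0 < s" "s\<^sup>2 = H (0, \<rho>)" "s < \<epsilon>" using elim \<epsilon> by (auto simp: s_def intro: real_less_lsqrt)
    then have s': "s < \<sigma>" "s < \<delta>" using \<epsilon> \<sigma> by auto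
    have q: "(0, \<rho>) \<in> curve s"
      unfolding curve_iff[OF s(1) s'(2)] using s(2) \<rho> ray_in_N[of "\<rho> / \<gamma>" "pi / 2"] ray by simp
    have period: "minimal_period \<phi> = eval_fps period_fps (s\<^sup>2)"
      if "solution_in (hamiltonian_field H) U \<phi>" "\<phi> 0 = (0, \<rho>)" for \<phi>
      using orbit_through_curve(1)[OF s(1) s'(1) that(1), of 0] q that(2) by simp
    obtain \<phi> where \<phi>: "solution_in (hamiltonian_field H) U \<phi>" "\<phi> 0 = (0, \<rho>)"
      using orb[OF s(1,3) q] by (auto simp: periodic_orbit_around_def)
    show ?case
      unfolding period_from_axis_def s(2)[symmetric]
    proof (rule the_equality)
      show "\<exists>\<phi>. solution_in (hamiltonian_field H) U \<phi> \<and> \<phi> 0 = (0, \<rho>) \<and> eval_fps period_fps (s\<^sup>2) = minimal_period \<phi>"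
        using \<phi> period[OF \<phi>] by metis
    qed (use period in metis)
  qed
qed

lemma period_fps_radius_pos: "0 < fps_conv_radius period_fps"
proof -
  have "0 < ereal (\<sigma>\<^sup>2)" using \<sigma> by simp
  then show ?thesis using conv_radius_period_area(1) by (rule less_le_trans)
qed

lemma axis_period_has_fps_expansion:
  "(\<lambda>\<rho>. eval_fps period_fps (H (0, \<rho>))) has_fps_expansion (period_fps oo Abs_fps (c 0))"
  by (intro has_fps_expansion_compose_real y_axis_has_fps_expansion[OF H r] eval_fps_has_fps_expansion period_fps_radius_pos)
    (simp add: c00)

text \<open>The required solution is the crossing of the level on the ray at angle \<pi> / 2, scaled
  by \<open>\<gamma>\<close>.\<close>

lemma axis_solution_exists: "\<exists>S. axis_solution H S"
proof
  let ?S = "\<lambda>s. \<gamma> * (s * V (pi / 2) s)"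
  have "\<forall>\<^sub>F h in at_right 0. 0 < ?S (sqrt h) \<and> H (0, ?S (sqrt h)) = h"
  proof (rule eventually_at_rightI[of 0 "\<delta>\<^sup>2"])
    fix h assume h: "h \<in> {0<..<\<delta>\<^sup>2}"
    then have s: "0 < sqrt h" "sqrt h < \<delta>" using \<delta> by (auto intro: real_less_lsqrt)
    have "0 < R (sqrt h) (pi / 2)" by (rule R_bounds(1)[OF s])
    moreover have "H (ray (R (sqrt h) (pi / 2)) (pi / 2)) = (sqrt h)\<^sup>2" using H_R s by simp
    ultimately show "0 < ?S (sqrt h) \<and> H (0, ?S (sqrt h)) = h"
      using h \<gamma>_pos by (simp add: y_axis_ray R_def)
  qed (use \<delta> in simp)
  moreover have "?S has_fps_expansion (fps_const \<gamma> * (fps_X * P (pi / 2)))"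
    by (intro has_fps_expansion_mult has_fps_expansion_const has_fps_expansion_fps_X
        geometric_bound.v_has_fps_expansion[OF gb])
  ultimately show "axis_solution H ?S" unfolding axis_solution_def by auto
qed

lemma axis_solution_tendsto:
  assumes "axis_solution H S"
  shows "filterlim (\<lambda>h. S (sqrt h)) (at_right 0) (at_right 0)"
proof -
  obtain F where F: "S has_fps_expansion F" and S0: "S 0 = 0"
    and ev: "\<forall>\<^sub>F h in at_right 0. 0 < S (sqrt h) \<and> H (0, S (sqrt h)) = h"
    using assms by (auto simp: axis_solution_def)
  have "isCont S 0" using has_fps_expansion_imp_continuous[OF F, of UNIV] by simp
  moreover have "((\<lambda>h. sqrt h) \<longlongrightarrow> sqrt 0) (at_right 0)" by (intro tendsto_intros)
  ultimately have "((\<lambda>h. S (sqrt h)) \<longlongrightarrow> S (sqrt 0)) (at_right 0)"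
    by (intro isCont_tendsto_compose[of _ S]) simp_all
  then have "((\<lambda>h. S (sqrt h)) \<longlongrightarrow> 0) (at_right 0)" by (simp add: S0)
  then show ?thesis
    using ev by (intro filterlim_at_withinI) (auto elim: eventually_mono)
qed

text \<open>Substituting h = s^2 removes the square root and makes the condition on \<open>S\<close>
  an identity of expansions. The sign of the first coefficient is that of the limit of
  \<open>S s / s\<close> from the right.\<close>

lemma axis_solution_equation:
  assumes S: "axis_solution H S" and F: "S has_fps_expansion F"
  shows "fps_nth F 0 = 0" "0 \<le> fps_nth F 1" "Abs_fps (c 0) oo F = fps_X ^ 2"
proof -
  have S0: "S 0 = 0" and ev: "\<forall>\<^sub>F h in at_right 0. 0 < S (sqrt h) \<and> H (0, S (sqrt h)) = h"
    using S by (auto simp: axis_solution_def)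
  have evF: "\<forall>\<^sub>F s in nhds 0. eval_fps F s = S s" using F by (simp add: has_fps_expansion_def)
  then have "eval_fps F 0 = S 0" by (rule eventually_nhds_x_imp_x)
  then show F0: "fps_nth F 0 = 0" by (simp add: eval_fps_at_0 S0)
  have "filterlim (\<lambda>s::real. s\<^sup>2) (at_right 0) (at_right 0)"
  proof (rule filterlim_at_withinI)
    have "((\<lambda>s::real. s\<^sup>2) \<longlongrightarrow> 0\<^sup>2) (at_right 0)" by (intro tendsto_intros)
    then show "((\<lambda>s::real. s\<^sup>2) \<longlongrightarrow> 0) (at_right 0)" by simp
    show "\<forall>\<^sub>F s in at_right (0::real). s\<^sup>2 \<in> {0<..} - {0}"
      using eventually_at_right_less[of "0::real"] by eventually_elim auto
  qed
  from eventually_compose_filterlim[OF ev this]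
  have ev': "\<forall>\<^sub>F s in at_right 0. 0 < S s \<and> H (0, S s) = s\<^sup>2"
    using eventually_at_right_less[of "0::real"] by eventually_elim simp
  show "Abs_fps (c 0) oo F = fps_X ^ 2"
  proof (rule fps_expansion_unique_right)
    show "(\<lambda>s. H (0, S s)) has_fps_expansion (Abs_fps (c 0) oo F)"
      by (rule has_fps_expansion_compose_real[OF y_axis_has_fps_expansion[OF H r] F F0])
    show "(\<lambda>s. s\<^sup>2) has_fps_expansion fps_X ^ 2" by (rule has_fps_expansion_fps_X_power)
    show "\<forall>\<^sub>F s in at_right 0. H (0, S s) = s\<^sup>2" using ev' by eventually_elim simp
  qed
  have "((\<lambda>s. S s / s) \<longlongrightarrow> fps_nth F 1) (at_right 0)"
  proof (cases "F = 0")
    \<comment> \<open>The zero series has subdegree 0, so the division by \<open>s\<close> used in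
      the other case does not apply to it.\<close>
    case True
    have "\<forall>\<^sub>F s in nhds 0. S s / s = 0" using evF by eventually_elim (simp add: True)
    then have "\<forall>\<^sub>F s in at_right 0. S s / s = 0" by (rule filter_leD[OF at_within_le_nhds])
    then have "((\<lambda>s. S s / s) \<longlongrightarrow> 0) (at_right 0)" by (rule tendsto_eventually)
    then show ?thesis by (simp add: True)
  next
    case False
    have "1 \<le> subdegree F"
    proof (rule subdegree_geI[OF False])
      show "fps_nth F i = 0" if "i < 1" for i using that F0 by simp
    qed
    from has_fps_expansion_imp_continuous[OF has_fps_expansion_shift[OF F this refl], of UNIV]
    have "isCont (\<lambda>x. if x = 0 then fps_nth F 1 else S x / x ^ 1) 0" .
    then have "((\<lambda>x. if x = 0 then fps_nth F 1 else S x / x ^ 1) \<longlongrightarrow> fps_nth F 1) (at 0)"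
      by (simp only: isCont_def if_True simp_thms)
    then have "((\<lambda>x. if x = 0 then fps_nth F 1 else S x / x ^ 1) \<longlongrightarrow> fps_nth F 1) (at_right 0)"
      by (rule tendsto_within_subset) simp
    moreover have "\<forall>\<^sub>F x in at_right 0. (if x = 0 then fps_nth F 1 else S x / x ^ 1) = S x / x"
      using eventually_at_right_less[of "0::real"] by eventually_elim simp
    ultimately show ?thesis by (rule Lim_transform_eventually)
  qed
  moreover have "\<forall>\<^sub>F s in at_right 0. 0 \<le> S s / s"
    using ev' eventually_at_right_less[of "0::real"] by eventually_elim simp
  ultimately show "0 \<le> fps_nth F 1"
    by (rule tendsto_lowerbound) simp
qed

end

section \<open>Analyticity of period and area\<close>

text \<open>Analyticity asks for an expansion at every point of the interval, not only at 0; the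
  complexified sum is holomorphic on a disc around \<open>a\<close> and is expanded there
  anew.\<close>

lemma real_analytic_on_eval_fps:
  assumes "ereal \<rho> \<le> fps_conv_radius F"
  shows "real_analytic_on (eval_fps F) {-\<rho><..<\<rho>}"
  unfolding real_analytic_on_def
proof
  fix a assume a: "a \<in> {-\<rho><..<\<rho>}"
  define f where "f = eval_fps (complex_fps F)"
  define e where "e = \<rho> - \<bar>a\<bar>"
  have e: "0 < e" using a by (auto simp: e_def)
  have inball: "norm x < fps_conv_radius F" if "\<bar>x\<bar> < \<rho>" for x :: real
    using that by (intro less_le_trans[OF _ assms]) simp
  have "ball (of_real a) e \<subseteq> eball (0::complex) (fps_conv_radius (complex_fps F))"
  proof
    fix z :: complex assume "z \<in> ball (of_real a) e"
    then have "norm z < \<rho>" using norm_triangle_ineq2[of z "of_real a"] by (simp add: dist_norm norm_minus_commute e_def)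
    then have "ereal (norm z) < fps_conv_radius F" by (intro less_le_trans[OF _ assms]) simp
    then show "z \<in> eball 0 (fps_conv_radius (complex_fps F))" by simp
  qed
  then have hol: "f holomorphic_on ball (of_real a) e"
    unfolding f_def by (intro holomorphic_on_eval_fps)
  define d where "d n = (deriv ^^ n) f (of_real a) / fact n" for n
  have "(\<lambda>x. eval_fps F (a + x)) has_fps_expansion Abs_fps (\<lambda>n. Re (d n))"
  proof (rule has_fps_expansionI)
    have "\<forall>\<^sub>F x in nhds (0::real). x \<in> {-e<..<e}"
      using e by (intro eventually_nhds_in_open) auto
    then show "\<forall>\<^sub>F x in nhds 0. (\<lambda>n. fps_nth (Abs_fps (\<lambda>n. Re (d n))) n * x ^ n) sums eval_fps F (a + x)"
    proof eventually_elim
      case (elim x)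
      have "of_real (a + x) \<in> ball (complex_of_real a) e" using elim by (simp add: dist_norm abs_less_iff)
      from holomorphic_power_series[OF hol this]
      have "(\<lambda>n. d n * of_real (x ^ n)) sums f (of_real (a + x))" by (simp add: d_def)
      then have "(\<lambda>n. Re (d n * of_real (x ^ n))) sums Re (f (of_real (a + x)))" by (rule sums_Re)
      moreover have "f (of_real (a + x)) = of_real (eval_fps F (a + x))"
        unfolding f_def by (rule eval_complex_fps, rule inball) (use elim in \<open>auto simp: e_def\<close>)
      ultimately show ?case by simp
    qed
  qed
  then show "\<exists>F'. (\<lambda>x. eval_fps F (a + x)) has_fps_expansion F'" by blast
qed

lemma hamiltonian_center_period_neighborhood:
  assumes "hamiltonian_center H U"
  obtains W where "period_neighborhood (hamiltonian_field H) U (0, 0) W"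
proof -
  have "\<exists>W. period_neighborhood (hamiltonian_field H) U (0, 0) W"
    using assms by (simp only: hamiltonian_center_def nondegenerate_center_def center_def)
  then show thesis by (elim exE) (rule that)
qed

text \<open>Coefficients of \<open>H\<close> of degree at least 2 come from the angular data, the
  lower ones vanish. The series to be computed is the formal composite of the period series with
  \<open>H (0, \<rho>)\<close>, and a right expansion is unique.\<close>

lemma obtained_algorithmically_axis_period:
  "obtained_algorithmically
     (\<lambda>d F. \<exists>H U. hamiltonian_center H U \<and> polar_expression (hamiltonian_field H) d \<and>
        has_right_expansion (period_from_axis H U) F)"
proof -
  define Z :: "polar_index inst set" where "Z = {(d, H, c, r). morse_hamiltonian H c r \<and> polar_expression (hamiltonian_field H) d}"
  interpret procedural_coefficients Z
  proof (unfold procedural_coefficients_def, intro conjI allI impI)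
    fix d H c r assume "(d, H, c, r) \<in> Z"
    then show "morse_hamiltonian H c r" by (simp add: Z_def)
  next
    fix i j :: nat
    show "procedural Z fst (\<lambda>(d, H, c, r). c i j)"
    proof (cases "2 \<le> i + j")
      case True
      have "procedural Z fst (\<lambda>z. fst z (Angular (i + j - 2) i) / of_nat (i + j))"
        by (intro procedural_divide procedural_datum procedural_of_nat)
      then show ?thesis
      proof (rule procedural_cong)
        fix z assume "z \<in> Z"
        then obtain d H c r where z: "z = (d, H, c, r)" "morse_hamiltonian H c r" "polar_expression (hamiltonian_field H) d"
          by (auto simp: Z_def)
        show "fst z (Angular (i + j - 2) i) / of_nat (i + j) = (case z of (d, H, c, r) \<Rightarrow> c i j)"
          using morse_hamiltonian.polar_expression_coeff[OF z(2,3) True] by (simp add: z(1))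
      qed
    next
      case False
      then have ij: "(i = 0 \<and> j = 0) \<or> (i = 1 \<and> j = 0) \<or> (i = 0 \<and> j = 1)" by auto
      show ?thesis
      proof (rule procedural_cong[OF procedural_0])
        fix z assume "z \<in> Z"
        then obtain d H c r where z: "z = (d, H, c, r)" "morse_hamiltonian H c r" by (auto simp: Z_def)
        have "c i j = 0"
          using ij morse_hamiltonian.c00[OF z(2)] morse_hamiltonian.c10[OF z(2)] morse_hamiltonian.c01[OF z(2)] by auto
        then show "0 = (case z of (d, H, c, r) \<Rightarrow> c i j)" by (simp add: z(1))
      qed
    qed
  qed
  show ?thesis
  proof (rule obtained_algorithmicallyI[OF procedural_axis_period])
    fix d :: "polar_index \<Rightarrow> real" and F
    assume "\<exists>H U. hamiltonian_center H U \<and> polar_expression (hamiltonian_field H) d \<and>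
        has_right_expansion (period_from_axis H U) F"
    then obtain H U where HU: "hamiltonian_center H U" "polar_expression (hamiltonian_field H) d"
      "has_right_expansion (period_from_axis H U) F" by blast
    obtain c r where morse: "morse_hamiltonian H c r" by (rule hamiltonian_center_imp_morse[OF HU(1)])
    obtain W where W: "period_neighborhood (hamiltonian_field H) U (0, 0) W"
      by (rule hamiltonian_center_period_neighborhood[OF HU(1)])
    obtain g where g: "g has_fps_expansion F" "\<forall>\<^sub>F x in at_right 0. period_from_axis H U x = g x"
      using HU(3) by (auto simp: has_right_expansion_def)
    have "morse_hamiltonian.period_fps c oo Abs_fps (c 0) = F"
    proof (rule fps_expansion_unique_right[OF morse_hamiltonian.axis_period_has_fps_expansion[OF morse] g(1)])
      show "\<forall>\<^sub>F x in at_right 0. eval_fps (morse_hamiltonian.period_fps c) (H (0, x)) = g x"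
        using morse_hamiltonian.period_from_axis_eq[OF morse W] g(2) by eventually_elim simp
    qed
    moreover have "(d, H, c, r) \<in> Z" using morse HU(2) by (simp add: Z_def)
    ultimately show "\<exists>z\<in>Z. fst z = d \<and> morse_hamiltonian.period_fps (coeffs z) oo Abs_fps (coeffs z 0) = F"
      by (intro bexI[of _ "(d, H, c, r)"]) simp_all
  qed
qed

text \<open>An instance here is just the pair of formal series, constrained by the composition
  identity and the signs; any center with an axis solution produces such a pair.\<close>

lemma obtained_algorithmically_axis_solution:
  "obtained_algorithmically
     (\<lambda>d F. \<exists>H U S G. hamiltonian_center H U \<and>
        (\<lambda>\<rho>. H (0, \<rho>)) has_fps_expansion G \<and> d = fps_nth G \<and>
        axis_solution H S \<and> S has_fps_expansion F)"
proof -
  define Z :: "((nat \<Rightarrow> real) \<times> real fps) set"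
    where "Z = {(d, F). d 0 = 0 \<and> d 1 = 0 \<and> 0 < d 2 \<and> fps_nth F 0 = 0 \<and> 0 \<le> fps_nth F 1 \<and> Abs_fps d oo F = fps_X ^ 2}"
  have "procedural Z fst (\<lambda>z. fps_nth (snd z) n)" for n
    by (rule procedural_axis_solution) (simp add: Z_def)
  then show ?thesis
  proof (rule obtained_algorithmicallyI)
    fix d F
    assume "\<exists>H U S G. hamiltonian_center H U \<and> (\<lambda>\<rho>. H (0, \<rho>)) has_fps_expansion G \<and> d = fps_nth G \<and>
        axis_solution H S \<and> S has_fps_expansion F"
    then obtain H U S G where *: "hamiltonian_center H U" "(\<lambda>\<rho>. H (0, \<rho>)) has_fps_expansion G" "d = fps_nth G"
        "axis_solution H S" "S has_fps_expansion F" by blast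
    obtain c r where morse: "morse_hamiltonian H c r" by (rule hamiltonian_center_imp_morse[OF *(1)])
    have "G = Abs_fps (c 0)"
      by (rule fps_expansion_unique_real[OF *(2) y_axis_has_fps_expansion[OF morse_hamiltonian.H[OF morse] morse_hamiltonian.r[OF morse]]])
    then have d: "d = c 0" using *(3) by (simp add: fun_eq_iff)
    have "(d, F) \<in> Z"
      unfolding Z_def d
      using morse_hamiltonian.axis_solution_equation[OF morse *(4,5)] morse_hamiltonian.c00[OF morse]
        morse_hamiltonian.c01[OF morse] morse_hamiltonian.c02[OF morse] by simp
    then show "\<exists>z\<in>Z. fst z = d \<and> snd z = F" by (intro bexI[of _ "(d, F)"]) simp_all
  qed
qed

context morse_hamiltonian
begin

lemma period_area_analytic:
  assumes fam: "energy_family H U h1 \<phi>"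
  shows "\<exists>\<epsilon> T A. 0 < \<epsilon> \<and> \<epsilon> \<le> h1 \<and>
      real_analytic_on T {-\<epsilon><..<\<epsilon>} \<and> real_analytic_on A {-\<epsilon><..<\<epsilon>} \<and>
      (\<forall>h\<in>{0<..<\<epsilon>}. T h = period_function \<phi> h \<and> A h = area_function \<phi> h) \<and>
      (\<forall>h\<in>{-\<epsilon><..<\<epsilon>}. (A has_real_derivative T h) (at h))"
    and "\<forall>\<^sub>F h in at_right 0. (period_function \<phi> has_integral area_function \<phi> h) {0..h}"
    and "axis_solution H S \<Longrightarrow> period_neighborhood (hamiltonian_field H) U (0, 0) W \<Longrightarrow>
      \<forall>\<^sub>F h in at_right 0. period_function \<phi> h = period_from_axis H U (S (sqrt h))"
proof -
  let ?T = "eval_fps period_fps" and ?A = "eval_fps area_fps"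
  obtain \<epsilon> where \<epsilon>: "0 < \<epsilon>" "\<epsilon> \<le> \<sigma>" "\<epsilon>\<^sup>2 \<le> h1"
    and T: "\<And>h. 0 < h \<Longrightarrow> h < \<epsilon>\<^sup>2 \<Longrightarrow> period_function \<phi> h = ?T h"
    and A: "\<And>h. 0 < h \<Longrightarrow> h < \<epsilon>\<^sup>2 \<Longrightarrow> area_function \<phi> h = ?A h"
    by (rule energy_family_orbits[OF fam]) (rule that; assumption)
  have "\<epsilon>\<^sup>2 \<le> \<sigma>\<^sup>2" using \<epsilon>(1,2) by (intro power_mono) simp_all
  then have "ereal (\<epsilon>\<^sup>2) \<le> ereal (\<sigma>\<^sup>2)" by simp
  then have rad: "ereal (\<epsilon>\<^sup>2) \<le> fps_conv_radius period_fps" "ereal (\<epsilon>\<^sup>2) \<le> fps_conv_radius area_fps"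
    by (rule order_trans, intro conv_radius_period_area)+
  have \<epsilon>2: "0 < \<epsilon>\<^sup>2" using \<epsilon> by simp
  have deriv: "(?A has_real_derivative ?T h) (at h)" if "h \<in> {-(\<epsilon>\<^sup>2)<..<\<epsilon>\<^sup>2}" for h
  proof -
    have "- (\<epsilon>\<^sup>2) < h" "h < \<epsilon>\<^sup>2" using that by simp_all
    then have "\<bar>h\<bar> < \<epsilon>\<^sup>2" by linarith
    then have "ereal (norm h) < ereal (\<epsilon>\<^sup>2)" by simp
    then have "ereal (norm h) < fps_conv_radius area_fps" by (rule less_le_trans) (rule rad(2))
    from has_field_derivative_eval_fps[OF this] show ?thesis by (simp only: area_fps_deriv)
  qed
  show "\<exists>\<epsilon> T A. 0 < \<epsilon> \<and> \<epsilon> \<le> h1 \<and>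
      real_analytic_on T {-\<epsilon><..<\<epsilon>} \<and> real_analytic_on A {-\<epsilon><..<\<epsilon>} \<and>
      (\<forall>h\<in>{0<..<\<epsilon>}. T h = period_function \<phi> h \<and> A h = area_function \<phi> h) \<and>
      (\<forall>h\<in>{-\<epsilon><..<\<epsilon>}. (A has_real_derivative T h) (at h))"
  proof (rule exI[of _ "\<epsilon>\<^sup>2"], rule exI[of _ ?T], rule exI[of _ ?A], intro conjI ballI)
    show "0 < \<epsilon>\<^sup>2" "\<epsilon>\<^sup>2 \<le> h1" by (fact \<epsilon>2, fact \<epsilon>(3))
    show "real_analytic_on ?T {-(\<epsilon>\<^sup>2)<..<\<epsilon>\<^sup>2}" by (rule real_analytic_on_eval_fps[OF rad(1)])
    show "real_analytic_on ?A {-(\<epsilon>\<^sup>2)<..<\<epsilon>\<^sup>2}" by (rule real_analytic_on_eval_fps[OF rad(2)])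
    fix h
    assume "h \<in> {0<..<\<epsilon>\<^sup>2}"
    then show "?T h = period_function \<phi> h" "?A h = area_function \<phi> h" using T[of h] A[of h] by simp_all
  qed (rule deriv)
  have ev: "\<forall>\<^sub>F h in at_right 0. 0 < h \<and> h < \<epsilon>\<^sup>2"
    by (rule eventually_at_rightI[of 0 "\<epsilon>\<^sup>2"]) (use \<epsilon>2 in auto)
  then show "\<forall>\<^sub>F h in at_right 0. (period_function \<phi> has_integral area_function \<phi> h) {0..h}"
  proof eventually_elim
    case (elim h)
    have "(?T has_integral (?A h - ?A 0)) {0..h}"
    proof (rule fundamental_theorem_of_calculus)
      fix x assume "x \<in> {0..h}"
      with elim \<epsilon>2 have "x \<in> {-(\<epsilon>\<^sup>2)<..<\<epsilon>\<^sup>2}" by simp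
      then have "(?A has_real_derivative ?T x) (at x within {0..h})"
        by (rule has_field_derivative_at_within[OF deriv])
      then show "(?A has_vector_derivative ?T x) (at x within {0..h})"
        by (simp only: has_real_derivative_iff_has_vector_derivative)
    qed (use elim in simp)
    \<comment> \<open>The constant term of \<open>area_fps\<close> is 0, so the antiderivative is
      the area itself.\<close>
    moreover have "?A 0 = 0" by (simp add: eval_fps_at_0 area_fps_def)
    ultimately have "(?T has_integral area_function \<phi> h) {0..h}" using A[of h] elim by simp
    then show ?case
      \<comment> \<open>At energy 0 the period function of the family has an unspecified value; a
        single point does not affect the integral.\<close>
      by (rule has_integral_spike_finite[of "{0}", rotated 2]) (use T elim in auto)
  qed
  assume S: "axis_solution H S" and W: "period_neighborhood (hamiltonian_field H) U (0, 0) W"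
  have "\<forall>\<^sub>F h in at_right 0. H (0, S (sqrt h)) = h"
    using S by (auto simp: axis_solution_def elim: eventually_mono)
  moreover have "\<forall>\<^sub>F h in at_right 0. period_from_axis H U (S (sqrt h)) = ?T (H (0, S (sqrt h)))"
    by (rule eventually_compose_filterlim[OF period_from_axis_eq[OF W] axis_solution_tendsto[OF S]])
  ultimately show "\<forall>\<^sub>F h in at_right 0. period_function \<phi> h = period_from_axis H U (S (sqrt h))"
    using ev by eventually_elim (simp add: T)
qed

lemma has_right_expansion_axis_period:
  assumes "period_neighborhood (hamiltonian_field H) U (0, 0) W"
  shows "\<exists>F. has_right_expansion (period_from_axis H U) F"
  unfolding has_right_expansion_def
  by (intro exI conjI, rule axis_period_has_fps_expansion, rule period_from_axis_eq[OF assms])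

end

theorem theorem1p1:
  shows
    "(\<forall>H U. hamiltonian_center H U \<longrightarrow>
       (\<exists>h1 \<gamma>. energy_family H U h1 \<gamma>) \<and>
       (\<forall>h1 \<gamma>. energy_family H U h1 \<gamma> \<longrightarrow>
         \<comment> \<open>(i)\<close>
         (\<exists>\<epsilon> T A. 0 < \<epsilon> \<and> \<epsilon> \<le> h1 \<and>
            real_analytic_on T {-\<epsilon><..<\<epsilon>} \<and> real_analytic_on A {-\<epsilon><..<\<epsilon>} \<and>
            (\<forall>h\<in>{0<..<\<epsilon>}. T h = period_function \<gamma> h \<and> A h = area_function \<gamma> h) \<and>
            (\<forall>h\<in>{-\<epsilon><..<\<epsilon>}. (A has_real_derivative T h) (at h))) \<and>
         \<comment> \<open>(ii)\<close>
         (\<exists>F. has_right_expansion (period_from_axis H U) F) \<and>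
         (\<exists>d. polar_expression (hamiltonian_field H) d) \<and>
         (\<exists>S. axis_solution H S) \<and>
         (\<forall>S. axis_solution H S \<longrightarrow>
            (\<forall>\<^sub>F h in at_right 0. period_function \<gamma> h = period_from_axis H U (S (sqrt h)))) \<and>
         (\<forall>\<^sub>F h in at_right 0. (period_function \<gamma> has_integral area_function \<gamma> h) {0..h}))) \<and>
     obtained_algorithmically
       (\<lambda>d F. \<exists>H U. hamiltonian_center H U \<and> polar_expression (hamiltonian_field H) d \<and>
          has_right_expansion (period_from_axis H U) F) \<and>
     obtained_algorithmically
       (\<lambda>d F. \<exists>H U S G. hamiltonian_center H U \<and>
          (\<lambda>\<rho>. H (0, \<rho>)) has_fps_expansion G \<and> d = fps_nth G \<and>
          axis_solution H S \<and> S has_fps_expansion F)"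
proof (intro conjI allI impI)
  fix H U assume HU: "hamiltonian_center H U"
  obtain c r where "morse_hamiltonian H c r" by (rule hamiltonian_center_imp_morse[OF HU])
  then interpret morse_hamiltonian H c r .
  obtain W where W: "period_neighborhood (hamiltonian_field H) U (0, 0) W"
    by (rule hamiltonian_center_period_neighborhood[OF HU])
  show "\<exists>h1 \<gamma>. energy_family H U h1 \<gamma>" by (rule energy_family_exists[OF W])
  fix h1 fam assume fam: "energy_family H U h1 fam"
  show "\<exists>\<epsilon> T A. 0 < \<epsilon> \<and> \<epsilon> \<le> h1 \<and>
      real_analytic_on T {-\<epsilon><..<\<epsilon>} \<and> real_analytic_on A {-\<epsilon><..<\<epsilon>} \<and>
      (\<forall>h\<in>{0<..<\<epsilon>}. T h = period_function fam h \<and> A h = area_function fam h) \<and>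
      (\<forall>h\<in>{-\<epsilon><..<\<epsilon>}. (A has_real_derivative T h) (at h))"
    by (rule period_area_analytic(1)[OF fam])
  show "\<exists>F. has_right_expansion (period_from_axis H U) F" by (rule has_right_expansion_axis_period[OF W])
  show "\<exists>d. polar_expression (hamiltonian_field H) d" by (rule polar_expression_exists)
  show "\<exists>S. axis_solution H S" by (rule axis_solution_exists)
  show "\<forall>\<^sub>F h in at_right 0. (period_function fam has_integral area_function fam h) {0..h}"
    by (rule period_area_analytic(2)[OF fam])
  fix S assume "axis_solution H S"
  then show "\<forall>\<^sub>F h in at_right 0. period_function fam h = period_from_axis H U (S (sqrt h))"
    by (intro period_area_analytic(3)[OF fam _ W])
qed (rule obtained_algorithmically_axis_period obtained_algorithmically_axis_solution)+

end
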